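(* Let $\tau>0$ and $\lambda=(\lambda_1,\lambda_2)\in\mathbb{R}^2$ with $1+\tau(1+\lambda_i)>0$, $i=1,2$, and write $\tau\lambda=(\tau\lambda_1,\tau\lambda_2)$. The distributions $L(\tau)$, $X_i(\tau,\lambda)$ and $M_{(a(\tau),x(\tau,\lambda))}$ are invariant under the involution $\tau\to1/\tau$, $\lambda\to\tau\lambda$ in the following sense: $$L\bigl(\tfrac1\tau\bigr)^{1/\tau}\overset{\text{in law}}{=}L(\tau),$$ $$X_i\bigl(\tfrac1\tau,\tau\lambda\bigr)^{1/\tau}\overset{\text{in law}}{=}X_i(\tau,\lambda),\quad i=1,2,3,$$ $$\bigl(M_{(a(1/\tau),\,x(1/\tau,\tau\lambda))}\bigr)^{1/\tau}\overset{\text{in law}}{=}M_{(a(\tau),\,x(\tau,\lambda))}.$$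
   Context: Barnes double gamma function: for $a=(a_1,a_2)$, $a_j>0$, $\zeta_2(s,w\,|\,a)=\sum_{k_1,k_2=0}^\infty(w+k_1a_1+k_2a_2)^{-s}$ for $\Re(s)>2$, $\Re(w)>0$, continued meromorphically in $s$; $\Gamma_2(w\,|\,a)=\exp\bigl(\partial_s\zeta_2(s,w\,|\,a)|_{s=0}\bigr)$. $\beta_{2,2}(a,b)$, $b=(b_0,b_1,b_2)$, is the probability distribution on $(0,1]$ with $$\mathbf{E}[\beta_{2,2}(a,b)^q]=\frac{\Gamma_2(q+b_0|a)}{\Gamma_2(b_0|a)}\frac{\Gamma_2(b_0+b_1|a)}{\Gamma_2(q+b_0+b_1|a)}\frac{\Gamma_2(b_0+b_2|a)}{\Gamma_2(q+b_0+b_2|a)}\frac{\Gamma_2(q+b_0+b_1+b_2|a)}{\Gamma_2(b_0+b_1+b_2|a)}=\exp\Bigl(\int_0^\infty(e^{-tq}-1)e^{-b_0t}\frac{(1-e^{-b_1t})(1-e^{-b_2t})}{(1-e^{-a_1t})(1-e^{-a_2t})}\frac{dt}{t}\Bigr)$$ for $\Re(q)>-\min(b_0,b_0+b_1+b_2)$; it is well defined for $b_0,b_1,b_2>0$ and also whenever $b_1=b_2\in\mathbb{R}$, $b_0>0$, $b_0+b_1+b_2>0$. $\beta_{2,2}^{-1}$ is the reciprocal random variable. Set $a(\tau)=(a_1,a_2)=(1,\tau)$, $x_i=x_i(\tau,\lambda_i)=1+\tau(1+\lambda_i)$, $x(\tau,\lambda)=(x_1,x_2)$. Define: $L(\tau)=\exp(\mathcal{N}(0,4\log2/\tau))$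 (mean $0$, variance $4\log 2/\tau$); $X_1(\tau,\lambda)=\beta_{2,2}^{-1}(a(\tau),b_0=x_1,b_1=b_2=(x_2-x_1)/2)$; $X_2(\tau,\lambda)=\beta_{2,2}^{-1}(a(\tau),b_0=(x_1+x_2)/2,b_1=1/2,b_2=\tau/2)$; $X_3(\tau,\lambda)=\beta_{2,2}^{-1}(a(\tau),b_0=1+\tau,b_1=b_2=(x_1+x_2-1-\tau)/2)$. For $a=(a_1,a_2)$, $x=(x_1,x_2)$ with positive entries, $M_{(a,x)}$ is the probability distribution on $(0,\infty)$ with Mellin transform $\mathbf{E}[M_{(a,x)}^q]=\frac{\Gamma_2(x_1-q|a)}{\Gamma_2(x_1|a)}\frac{\Gamma_2(x_2-q|a)}{\Gamma_2(x_2|a)}\frac{\Gamma_2(a_1+a_2-q|a)}{\Gamma_2(a_1+a_2|a)}\frac{\Gamma_2(x_1+x_2-q|a)}{\Gamma_2(x_1+x_2-2q|a)}$, $\Re(q)<\min(x_1,x_2,a_1+a_2)$; for $a=a(\tau)$, $x=x(\tau,\lambda)$ it equals in law $2^{-(2(x_1+x_2)-(1+\tau))/\tau}L(\tau)X_1(\tau,\lambda)X_2(\tau,\lambda)X_3(\tau,\lambda)$ with independent factors. *)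

theory Defs
  imports "HOL-Probability.Probability" "HOL-Complex_Analysis.Complex_Analysis"
begin

text \<open>
  The meromorphic continuation in \<open>s\<close> of the Barnes double zeta series. The notion
  \<open>nicely_meromorphic_on\<close> (limit value at every regular point, value 0 at poles) makes
  the continuation unique as a total function. Powers use the principal branch; every
  \<open>w + k\<^sub>1 a\<^sub>1 + k\<^sub>2 a\<^sub>2\<close> has positive real part when \<open>w\<close> does.
\<close>

definition double_zeta :: "real \<Rightarrow> real \<Rightarrow> complex \<Rightarrow> complex \<Rightarrow> complex" where
  "double_zeta a1 a2 w = (THE Z. Z nicely_meromorphic_on UNIV \<and>
     (\<forall>s. Re s > 2 \<longrightarrow>
       ((\<lambda>(k1::nat, k2::nat).
           (w + of_nat k1 * of_real a1 + of_nat k2 * of_real a2) powr (- s))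
         has_sum Z s) UNIV))"

definition double_Gamma :: "real \<Rightarrow> real \<Rightarrow> complex \<Rightarrow> complex" where
  "double_Gamma a1 a2 w = exp (deriv (double_zeta a1 a2 w) 0)"

text \<open>
  Probability distributions on a subset \<open>S\<close> of \<open>(0,\<infinity>)\<close> are Borel probability measures on
  the real line that are concentrated on \<open>S\<close>. Integrability is part of the requirement
  because the Bochner integral of a non-integrable function is 0.
\<close>

definition has_Mellin_transform ::
    "real measure \<Rightarrow> real set \<Rightarrow> complex set \<Rightarrow> (complex \<Rightarrow> complex) \<Rightarrow> bool" where
  "has_Mellin_transform \<mu> S D \<phi> \<longleftrightarrow>
     real_distribution \<mu> \<and> (AE x in \<mu>. x \<in> S) \<and>
     (\<forall>q\<in>D. integrable \<mu> (\<lambda>x. complex_of_real x powr q) \<and>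
             (LINT x|\<mu>. complex_of_real x powr q) = \<phi> q)"

definition beta22 :: "real \<Rightarrow> real \<Rightarrow> real \<Rightarrow> real \<Rightarrow> real \<Rightarrow> real measure" where
  "beta22 a1 a2 b0 b1 b2 =
     (let G = double_Gamma a1 a2; c0 = complex_of_real b0;
          c1 = complex_of_real b1; c2 = complex_of_real b2
      in THE \<mu>. has_Mellin_transform \<mu> {0<..1} {q. Re q > - min b0 (b0 + b1 + b2)}
           (\<lambda>q. G (q + c0) / G c0 *
                (G (c0 + c1) / G (q + c0 + c1)) *
                (G (c0 + c2) / G (q + c0 + c2)) *
                (G (q + c0 + c1 + c2) / G (c0 + c1 + c2))))"

text \<open>Laws of the reciprocal and of a real power of a positive random variable with law \<open>\<mu>\<close>.\<close>

definition recip_law :: "real measure \<Rightarrow> real measure" where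
  "recip_law \<mu> = distr \<mu> borel (\<lambda>x. 1 / x)"

definition power_law :: "real measure \<Rightarrow> real \<Rightarrow> real measure" where
  "power_law \<mu> p = distr \<mu> borel (\<lambda>x. x powr p)"

definition M_law :: "real \<Rightarrow> real \<Rightarrow> real \<Rightarrow> real \<Rightarrow> real measure" where
  "M_law a1 a2 x1 x2 =
     (let G = double_Gamma a1 a2; c1 = complex_of_real x1; c2 = complex_of_real x2;
          c = complex_of_real (a1 + a2)
      in THE \<mu>. has_Mellin_transform \<mu> {0<..} {q. Re q < min x1 (min x2 (a1 + a2))}
           (\<lambda>q. G (c1 - q) / G c1 *
                (G (c2 - q) / G c2) *
                (G (c - q) / G c) *
                (G (c1 + c2 - q) / G (c1 + c2 - 2 * q))))"

definition x_par :: "real \<Rightarrow> real \<Rightarrow> real" where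
  "x_par \<tau> l = 1 + \<tau> * (1 + l)"

text \<open>The second argument of \<open>normal_density\<close> is the standard deviation.\<close>

definition L_law :: "real \<Rightarrow> real measure" where
  "L_law \<tau> = distr (density lborel (normal_density 0 (sqrt (4 * ln 2 / \<tau>)))) borel exp"

definition X1_law :: "real \<Rightarrow> real \<Rightarrow> real \<Rightarrow> real measure" where
  "X1_law \<tau> l1 l2 =
     (let x1 = x_par \<tau> l1; x2 = x_par \<tau> l2
      in recip_law (beta22 1 \<tau> x1 ((x2 - x1) / 2) ((x2 - x1) / 2)))"

definition X2_law :: "real \<Rightarrow> real \<Rightarrow> real \<Rightarrow> real measure" where
  "X2_law \<tau> l1 l2 =
     (let x1 = x_par \<tau> l1; x2 = x_par \<tau> l2
      in recip_law (beta22 1 \<tau> ((x1 + x2) / 2) (1 / 2) (\<tau> / 2)))"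

definition X3_law :: "real \<Rightarrow> real \<Rightarrow> real \<Rightarrow> real measure" where
  "X3_law \<tau> l1 l2 =
     (let x1 = x_par \<tau> l1; x2 = x_par \<tau> l2
      in recip_law (beta22 1 \<tau> (1 + \<tau>) ((x1 + x2 - 1 - \<tau>) / 2) ((x1 + x2 - 1 - \<tau>) / 2)))"

end

theory Submission
  imports Defs
begin

text \<open>
  The logarithm of the Mellin transform of \<open>\<beta>\<^sub>2\<^sub>,\<^sub>2\<close> is a mixed third difference of the
  function \<open>\<partial>\<^sub>s\<zeta>\<^sub>2(0, w)\<close>. Up to a quadratic polynomial in \<open>w\<close>, which such differences annihilate,
  this function is minus a regularised sum of \<open>Ln (w + k\<^sub>1 a\<^sub>1 + k\<^sub>2 a\<^sub>2)\<close>, so the transform is an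
  absolutely convergent product over the lattice of factors that are invariant under a common
  scaling of all parameters and under exchanging the two periods. With \<open>a = (1, \<tau>)\<close> this is the
  invariance under the involution. Each factor is the transform of an explicit law on \<open>(0,1]\<close>,
  and an infinite product of independent variables with these laws shows that
  \<open>\<beta>\<^sub>2\<^sub>,\<^sub>2\<close> exists. For \<open>M\<close>, the duplication formula of \<open>\<Gamma>\<^sub>2\<close>, whose exponential factor comes from
  the explicit quadratic polynomial \<open>\<zeta>\<^sub>2(0, w)\<close>, exhibits the transform as the product of a
  lognormal one and three transforms of \<open>\<beta>\<^sub>2\<^sub>,\<^sub>2\<^sup>-\<^sup>1\<close>. Uniqueness of the
  laws follows from the values on the imaginary axis by Levy's theorem.
\<close>

section \<open>Lattice sums of Taylor remainders\<close>

text \<open>Every law here is a definite description, and so is the continued zeta function beneath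
  it; an equation between laws is accessible only once the described objects are known to exist and
  to be unique. Hence most of the work is construction rather than comparison. The continuation
  rests on Taylor expansion over the lattice: each further Taylor order lets the remainder converge
  one unit further to the left, and order three is the first to reach a neighbourhood of
  \<open>s = 0\<close>. This order also matches \<beta>: its steps are q, b1 and b2, so second-order
  Taylor polynomials drop out, both at each lattice point and in the total, with coefficients left
  uncomputed. For M some coefficients must be known: duplication contributes ln 2 times differences
  of the values at \<open>s = 0\<close>, and their linear and quadratic parts give mean and variance
  of the normal law behind the lognormal factor. The comparison itself is short, because a power
  1/\<tau> multiplies the Mellin variable by 1/\<tau> and so preserves the imaginary axis.\<close>

definition lat :: "real \<Rightarrow> real \<Rightarrow> nat \<times> nat \<Rightarrow> real" where
  "lat a1 a2 k = real (fst k) * a1 + real (snd k) * a2"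

lemma lat_nonneg: "a1 > 0 \<Longrightarrow> a2 > 0 \<Longrightarrow> lat a1 a2 k \<ge> 0"
  by (simp add: lat_def)

text \<open>Since (1 + x)(1 + y) \<le> (1 + x + y)^2, the terms are dominated by a product of two
  single series with exponent \<open>p / 2 > 1\<close>; hence the threshold 2 for a double
  lattice.\<close>

lemma summable_on_lat_powr:
  fixes a1 a2 m p :: real
  assumes a: "a1 > 0" "a2 > 0" and m: "m > 0" and p: "p > 2"
  shows "(\<lambda>k. (m + lat a1 a2 k) powr (- p)) summable_on UNIV"
proof -
  define c where "c = min m (min a1 a2)"
  have c: "c > 0" "c \<le> m" "c \<le> a1" "c \<le> a2"
    using a m by (auto simp: c_def)
  define g :: "nat \<Rightarrow> real" where "g = (\<lambda>n. real (Suc n) powr (- p / 2))"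
  have "summable (\<lambda>n. real n powr (- p / 2))"
    using p by (simp add: summable_real_powr_iff)
  hence "summable g"
    unfolding g_def by (subst summable_Suc_iff)
  hence g: "g summable_on UNIV"
    by (subst summable_on_UNIV_nonneg_real_iff) (auto simp: g_def)
  have "(\<lambda>(x, y). g x * g y) summable_on UNIV \<times> UNIV"
  proof (rule summable_on_SigmaI)
    show "((\<lambda>y. (case (x, y) of (x, y) \<Rightarrow> g x * g y)) has_sum g x * infsum g UNIV) UNIV" for x
      using has_sum_cmult_right[OF has_sum_infsum[OF g]] by simp
    show "(\<lambda>x. g x * infsum g UNIV) summable_on UNIV"
      by (intro summable_on_cmult_left g)
  qed (simp add: g_def)
  hence *: "(\<lambda>k. c powr (- p) * (g (fst k) * g (snd k))) summable_on UNIV"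
    by (intro summable_on_cmult_right) (simp add: case_prod_unfold)
  show ?thesis
  proof (rule summable_on_comparison_test[OF *])
    fix k :: "nat \<times> nat"
    obtain x y where k: "k = (x, y)" by (cases k)
    have 1: "c * (1 + real x + real y) \<le> m + lat a1 a2 k"
    proof -
      have "real x * c \<le> real x * a1" "real y * c \<le> real y * a2"
        using c by (auto intro: mult_left_mono)
      thus ?thesis using c by (simp add: lat_def k algebra_simps)
    qed
    have 2: "(1 + real x + real y) powr 2 \<ge> real (Suc x) * real (Suc y)"
      by (simp add: power2_eq_square algebra_simps)
    have "(m + lat a1 a2 k) powr (- p) \<le> (c * (1 + real x + real y)) powr (- p)"
      using 1 c p by (intro powr_mono2') auto
    also have "\<dots> = c powr (- p) * ((1 + real x + real y) powr 2) powr (- p / 2)"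
      using c by (simp only: powr_powr powr_mult) simp
    also have "\<dots> \<le> c powr (- p) * (real (Suc x) * real (Suc y)) powr (- p / 2)"
      using 2 p by (intro mult_left_mono powr_mono2') auto
    also have "\<dots> = c powr (- p) * (g (fst k) * g (snd k))"
      by (simp add: k g_def powr_mult)
    finally show "(m + lat a1 a2 k) powr (- p) \<le> c powr (- p) * (g (fst k) * g (snd k))" .
  qed auto
qed

text \<open>The falling factorial of \<open>- s\<close>; divided by \<open>fact j\<close> it is the
  binomial coefficient in the Taylor expansion of \<open>x powr (- s)\<close>.\<close>

definition powr_coeff :: "complex \<Rightarrow> nat \<Rightarrow> complex" where
  "powr_coeff s j = (\<Prod>l<j. - s - of_nat l)"

lemma powr_coeff_0 [simp]: "powr_coeff s 0 = 1"
  and powr_coeff_Suc: "powr_coeff s (Suc j) = powr_coeff s j * (- s - of_nat j)"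
  by (simp_all add: powr_coeff_def)

lemma holomorphic_on_powr_coeff [holomorphic_intros]:
  "g holomorphic_on A \<Longrightarrow> (\<lambda>s. powr_coeff (g s) j) holomorphic_on A"
  unfolding powr_coeff_def by (intro holomorphic_intros)

text \<open>\<open>N = 0\<close> gives the bare power \<open>v powr (- s)\<close>, so the zeta
  series is itself a remainder sum and inherits convergence and holomorphy from the general
  case.\<close>

definition powr_rem :: "nat \<Rightarrow> complex \<Rightarrow> complex \<Rightarrow> complex \<Rightarrow> complex" where
  "powr_rem N s u v = v powr (- s)
     - (\<Sum>j<N. powr_coeff s j / fact j * (v - u) ^ j * u powr (- s - of_nat j))"

text \<open>The modulus is \<open>norm y powr Re z\<close> times
  \<open>exp (- Im z * Im (Ln y))\<close>. In the right half plane the argument of \<open>y\<close>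
  stays below \<open>pi / 2\<close>, so the second factor is bounded independently of
  \<open>y\<close>; with \<open>Re z \<le> 0\<close> the first is largest at the smallest
  modulus.\<close>

lemma norm_powr_le:
  fixes y z :: complex and M :: real
  assumes M: "0 < M" "M \<le> Re y" and z: "Re z \<le> 0"
  shows "norm (y powr z) \<le> exp (pi / 2 * \<bar>Im z\<bar>) * M powr (Re z)"
proof -
  have y: "y \<noteq> 0" "Re y > 0" using M by auto
  have "Re (z * Ln y) = Re z * ln (norm y) - Im z * Im (Ln y)"
    using y by simp
  also have "\<dots> \<le> Re z * ln M + \<bar>Im z\<bar> * (pi / 2)"
  proof -
    have "M \<le> norm y" using M complex_Re_le_cmod[of y] by linarith
    hence "Re z * ln (norm y) \<le> Re z * ln M"
      using z M y by (intro mult_left_mono_neg) (auto simp del: ln_le_cancel_iff intro!: ln_mono)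
    moreover have "\<bar>Im (Ln y)\<bar> < pi / 2"
      using y Re_Ln_pos_lt[OF y(1)] by auto
    hence "\<bar>Im z * Im (Ln y)\<bar> \<le> \<bar>Im z\<bar> * (pi / 2)"
      unfolding abs_mult by (intro mult_left_mono) auto
    ultimately show ?thesis by linarith
  qed
  finally have "exp (Re (z * Ln y)) \<le> exp (pi / 2 * \<bar>Im z\<bar>) * exp (Re z * ln M)"
    unfolding exp_add[symmetric] by (simp add: algebra_simps)
  thus ?thesis using y M by (simp add: powr_def)
qed

text \<open>Taylor's theorem on the half plane \<open>Re x \<ge> M\<close>, which is convex and on
  which the derivatives are again powers controlled by \<open>norm_powr_le\<close>. The gain over
  the power itself is \<open>N\<close> in the exponent of \<open>M\<close>.\<close>

lemma norm_powr_rem_le: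
  fixes u v s :: complex and M :: real
  assumes M: "0 < M" "M \<le> Re u" "M \<le> Re v" and s: "Re s + real N \<ge> 0"
  shows "norm (powr_rem N s u v)
    \<le> norm (powr_coeff s N) * exp (pi / 2 * \<bar>Im s\<bar>) * norm (v - u) ^ N * M powr (- (Re s + real N))"
proof -
  have b: "norm (powr_coeff s N * x powr (- s - of_nat N))
      \<le> norm (powr_coeff s N) * exp (pi / 2 * \<bar>Im s\<bar>) * M powr (- (Re s + real N))"
    if "M \<le> Re x" for x
    using norm_powr_le[OF M(1) that, of "- s - of_nat N"] s
    by (simp add: norm_mult mult_left_mono mult.assoc)
  show ?thesis
  proof (cases N)
    case 0
    thus ?thesis using b[OF M(3)] by (simp add: powr_rem_def)
  next
    case (Suc n)
    define S where "S = {x::complex. Re x \<ge> M}"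
    define f where "f = (\<lambda>j x. powr_coeff s j * x powr (- s - of_nat j))"
    define B where "B = norm (powr_coeff s N) * exp (pi / 2 * \<bar>Im s\<bar>) * M powr (- (Re s + real N))"
    have "norm (f 0 v - (\<Sum>j\<le>n. f j u * (v - u) ^ j / fact j)) \<le> B * norm (v - u) ^ Suc n / fact n"
    proof (rule complex_Taylor)
      show "convex S" unfolding S_def by (rule convex_halfspace_Re_ge)
      show "u \<in> S" "v \<in> S" using M by (auto simp: S_def)
      show "norm (f (Suc n) x) \<le> B" if "x \<in> S" for x
        using b[of x] that Suc by (simp add: f_def B_def S_def)
      fix i x assume "x \<in> S" "i \<le> n"
      hence x: "x \<notin> \<real>\<^sub>\<le>\<^sub>0" using M by (auto simp: S_def complex_nonpos_Reals_iff)
      show "(f i has_field_derivative f (Suc i) x) (at x within S)"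
        unfolding f_def powr_coeff_Suc
        by (rule derivative_eq_intros refl x | simp add: algebra_simps)+
    qed
    also have "f 0 v - (\<Sum>j\<le>n. f j u * (v - u) ^ j / fact j) = powr_rem N s u v"
      by (simp add: powr_rem_def f_def Suc lessThan_Suc_atMost mult_ac)
    also have "B * norm (v - u) ^ Suc n / fact n \<le> B * norm (v - u) ^ N / 1"
      unfolding Suc by (intro divide_left_mono) (auto simp: B_def fact_ge_1)
    finally show ?thesis by (simp add: B_def mult_ac)
  qed
qed

lemma holomorphic_on_powr_rem:
  assumes "u \<noteq> 0" "v \<noteq> 0" "g holomorphic_on A"
  shows "(\<lambda>s. powr_rem N (g s) u v) holomorphic_on A"
  unfolding powr_rem_def using assms by (auto intro!: holomorphic_intros)

text \<open>Local domination gives uniform convergence of the finite partial sums on small discs, so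
  the limit is holomorphic and may be differentiated termwise. The termwise derivative is what later
  turns powers into logarithms.\<close>

lemma holomorphic_infsum:
  fixes f :: "'a \<Rightarrow> complex \<Rightarrow> complex"
  assumes A: "open A" and holo: "\<And>k. f k holomorphic_on A"
    and bound: "\<And>z. z \<in> A \<Longrightarrow> \<exists>r>0. cball z r \<subseteq> A \<and>
      (\<exists>M. M summable_on UNIV \<and> (\<forall>k. \<forall>t\<in>cball z r. norm (f k t) \<le> M k))"
  shows "(\<lambda>z. \<Sum>\<^sub>\<infinity>k. f k z) holomorphic_on A"
    and "z \<in> A \<Longrightarrow> ((\<lambda>k. deriv (f k) z) has_sum deriv (\<lambda>z. \<Sum>\<^sub>\<infinity>k. f k z) z) UNIV"
    and "z \<in> A \<Longrightarrow> (\<lambda>k. f k z) summable_on UNIV"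
proof -
  let ?g = "\<lambda>z. \<Sum>\<^sub>\<infinity>k. f k z"
  have *: "\<exists>g'. (?g has_field_derivative g') (at z) \<and> ((\<lambda>k. deriv (f k) z) has_sum g') UNIV
             \<and> (\<lambda>k. f k z) summable_on UNIV" if z: "z \<in> A" for z
  proof -
    obtain r M where r: "r > 0" "cball z r \<subseteq> A" "M summable_on UNIV"
      "\<And>k t. t \<in> cball z r \<Longrightarrow> norm (f k t) \<le> M k"
      using bound[OF z] by blast
    have ul: "uniform_limit (cball z r) (\<lambda>X y. \<Sum>k\<in>X. f k y) ?g (finite_subsets_at_top UNIV)"
      by (rule Weierstrass_m_test_general) (use r in auto)
    have ev: "\<forall>\<^sub>F X in finite_subsets_at_top UNIV. continuous_on (cball z r) (\<lambda>y. \<Sum>k\<in>X. f k y) \<and>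
        (\<forall>w\<in>ball z r. ((\<lambda>y. \<Sum>k\<in>X. f k y) has_field_derivative (\<Sum>k\<in>X. deriv (f k) w)) (at w))"
    proof (intro always_eventually allI conjI ballI)
      fix X
      show "continuous_on (cball z r) (\<lambda>y. \<Sum>k\<in>X. f k y)"
        using holomorphic_on_imp_continuous_on[OF holo] r(2)
        by (intro continuous_on_sum) (auto intro: continuous_on_subset)
      fix w assume "w \<in> ball z r"
      hence "w \<in> A" using r(2) by auto
      thus "((\<lambda>y. \<Sum>k\<in>X. f k y) has_field_derivative (\<Sum>k\<in>X. deriv (f k) w)) (at w)"
        by (intro DERIV_sum holomorphic_derivI[OF holo A])
    qed
    obtain g' where g': "\<And>w. w \<in> ball z r \<Longrightarrow> (?g has_field_derivative g' w) (at w) \<and>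
        ((\<lambda>X. \<Sum>k\<in>X. deriv (f k) w) \<longlongrightarrow> g' w) (finite_subsets_at_top UNIV)"
      using has_complex_derivative_uniform_limit[OF ev ul finite_subsets_at_top_neq_bot r(1)] by blast
    have "(\<lambda>k. f k z) summable_on UNIV"
    proof (rule abs_summable_summable, rule Infinite_Sum.abs_summable_on_comparison_test')
      show "M summable_on UNIV" by fact
      show "norm (f k z) \<le> M k" for k using r(1,4) by auto
    qed
    thus ?thesis using g'[of z] r(1) by (auto simp: has_sum_def)
  qed
  show "?g holomorphic_on A"
    unfolding holomorphic_on_open[OF A] using * by blast
  show "z \<in> A \<Longrightarrow> ((\<lambda>k. deriv (f k) z) has_sum deriv ?g z) UNIV"
    using * DERIV_imp_deriv by metis
  show "z \<in> A \<Longrightarrow> (\<lambda>k. f k z) summable_on UNIV"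
    using * by blast
qed

lemma open_Re_gt: "open {s::complex. Re s > c}"
  using open_halfspace_Re_gt[of c] by simp

definition powr_rem_sum :: "real \<Rightarrow> real \<Rightarrow> nat \<Rightarrow> complex \<Rightarrow> complex \<Rightarrow> complex \<Rightarrow> complex" where
  "powr_rem_sum a1 a2 N u v s =
     (\<Sum>\<^sub>\<infinity>k. powr_rem N s (u + of_real (lat a1 a2 k)) (v + of_real (lat a1 a2 k)))"

text \<open>The remainder of order \<open>N\<close> decays with exponent
  \<open>- (Re s + N)\<close>, which is summable over the lattice once \<open>Re s + N > 2\<close>.
  Raising \<open>N\<close> by one moves the half plane of holomorphy one unit to the left.\<close>

lemma powr_rem_sum:
  fixes a1 a2 :: real and u v :: complex and N :: nat
  assumes a: "a1 > 0" "a2 > 0" and uv: "Re u > 0" "Re v > 0"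
  defines "f \<equiv> (\<lambda>k s. powr_rem N s (u + of_real (lat a1 a2 k)) (v + of_real (lat a1 a2 k)))"
  shows "powr_rem_sum a1 a2 N u v holomorphic_on {s. Re s > 2 - real N}"
    and "Re s > 2 - real N \<Longrightarrow> ((\<lambda>k. deriv (f k) s) has_sum deriv (powr_rem_sum a1 a2 N u v) s) UNIV"
    and "Re s > 2 - real N \<Longrightarrow> ((\<lambda>k. f k s) has_sum powr_rem_sum a1 a2 N u v s) UNIV"
proof -
  define A where "A = {s::complex. Re s > 2 - real N}"
  have A: "open A" unfolding A_def by (rule open_Re_gt)
  define m where "m = min (Re u) (Re v)"
  have m: "m > 0" "m \<le> Re u" "m \<le> Re v" using uv by (auto simp: m_def)
  have nz: "u + of_real (lat a1 a2 k) \<noteq> 0" "v + of_real (lat a1 a2 k) \<noteq> 0" for k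
    using uv lat_nonneg[OF a, of k] by (auto simp: complex_eq_iff)
  have holo: "f k holomorphic_on A" for k
    unfolding f_def by (intro holomorphic_on_powr_rem nz holomorphic_intros)
  have bound: "\<exists>r>0. cball z r \<subseteq> A \<and>
      (\<exists>M. M summable_on UNIV \<and> (\<forall>k. \<forall>t\<in>cball z r. norm (f k t) \<le> M k))" if "z \<in> A" for z
  proof -
    \<comment> \<open>Half the distance to the boundary line, so that the smallest real part
      \<sigma> on the disc still exceeds \<open>2 - real N\<close>.\<close>
    define r where "r = (Re z - (2 - real N)) / 2"
    define \<sigma> where "\<sigma> = Re z - r"
    have r: "r > 0" "\<sigma> > 2 - real N" using that by (auto simp: r_def A_def \<sigma>_def field_simps)
    have ge: "Re t \<ge> \<sigma>" if "t \<in> cball z r" for t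
    proof -
      have "\<bar>Re (z - t)\<bar> \<le> r"
        using that abs_Re_le_cmod[of "z - t"] by (simp add: dist_norm)
      thus ?thesis by (simp add: \<sigma>_def)
    qed
    \<comment> \<open>The exponent \<open>Re t + N\<close> splits into
      \<open>Re t - \<sigma>\<close>, which is nonnegative and allows the base to be replaced by
      \<open>m\<close>, and \<open>\<sigma> + N\<close>. So \<open>b\<close> depends on
      \<open>t\<close> alone and is bounded on the compact disc, and the other factor is summable
      and free of \<open>t\<close>.\<close>
    define b where "b = (\<lambda>t. norm (powr_coeff t N) * exp (pi / 2 * \<bar>Im t\<bar>) * norm (v - u) ^ N
        * m powr (- (Re t - \<sigma>)))"
    have "continuous_on (cball z r) (\<lambda>t. powr_coeff t N)"
      by (intro holomorphic_on_imp_continuous_on holomorphic_intros)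
    hence "continuous_on (cball z r) b"
      unfolding b_def using m by (intro continuous_intros) auto
    hence "bounded (b ` cball z r)"
      by (intro compact_imp_bounded compact_continuous_image) auto
    then obtain C where C: "\<And>t. t \<in> cball z r \<Longrightarrow> norm (b t) \<le> C"
      unfolding bounded_iff by blast
    define M where "M = (\<lambda>k. C * (m + lat a1 a2 k) powr (- (\<sigma> + real N)))"
    show ?thesis
    proof (intro exI[of _ r] exI[of _ M] conjI allI ballI)
      show "r > 0" by fact
      show "cball z r \<subseteq> A" using ge r by (force simp: A_def)
      show "M summable_on UNIV"
        unfolding M_def using a m r by (intro summable_on_cmult_right summable_on_lat_powr) auto
      fix k t assume t: "t \<in> cball z r"
      let ?K = "lat a1 a2 k"
      have K: "?K \<ge> 0" using lat_nonneg[OF a] .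
      have "norm (f k t) \<le> norm (powr_coeff t N) * exp (pi / 2 * \<bar>Im t\<bar>) * norm (v - u) ^ N
              * (m + ?K) powr (- (Re t + real N))"
        unfolding f_def
        using norm_powr_rem_le[of "m + ?K" "u + ?K" "v + ?K" t N] m K ge[OF t] r by simp
      also have "\<dots> \<le> norm (powr_coeff t N) * exp (pi / 2 * \<bar>Im t\<bar>) * norm (v - u) ^ N
              * (m powr (- (Re t - \<sigma>)) * (m + ?K) powr (- (\<sigma> + real N)))"
      proof (intro mult_left_mono)
        have "(m + ?K) powr (- (Re t + real N))
            = (m + ?K) powr (- (Re t - \<sigma>)) * (m + ?K) powr (- (\<sigma> + real N))"
          using m K by (subst powr_add[symmetric]) (simp add: algebra_simps)
        also have "\<dots> \<le> m powr (- (Re t - \<sigma>)) * (m + ?K) powr (- (\<sigma> + real N))"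
          using m K ge[OF t] by (intro mult_right_mono powr_mono2') auto
        finally show "(m + ?K) powr (- (Re t + real N))
            \<le> m powr (- (Re t - \<sigma>)) * (m + ?K) powr (- (\<sigma> + real N))" .
      qed auto
      finally have "norm (f k t) \<le> b t * (m + ?K) powr (- (\<sigma> + real N))"
        by (simp add: b_def mult_ac)
      also have "\<dots> \<le> M k"
        unfolding M_def using C[OF t] by (intro mult_right_mono) auto
      finally show "norm (f k t) \<le> M k" .
    qed
  qed
  have S: "powr_rem_sum a1 a2 N u v = (\<lambda>s. \<Sum>\<^sub>\<infinity>k. f k s)"
    by (auto simp: powr_rem_sum_def f_def)
  note H = holomorphic_infsum[OF A holo bound]
  show "powr_rem_sum a1 a2 N u v holomorphic_on {s. Re s > 2 - real N}"
    using H(1) unfolding S A_def .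
  show "((\<lambda>k. deriv (f k) s) has_sum deriv (powr_rem_sum a1 a2 N u v) s) UNIV"
    if "Re s > 2 - real N" using H(2)[of s] that unfolding S A_def by simp
  show "((\<lambda>k. f k s) has_sum powr_rem_sum a1 a2 N u v s) UNIV"
    if "Re s > 2 - real N" using H(3)[of s] that unfolding S A_def by simp
qed

section \<open>Continuation of the double zeta function\<close>

definition zeta_series :: "real \<Rightarrow> real \<Rightarrow> complex \<Rightarrow> complex \<Rightarrow> complex" where
  "zeta_series a1 a2 w s = (\<Sum>\<^sub>\<infinity>k. (w + of_real (lat a1 a2 k)) powr (- s))"

lemma has_sum_sum:
  fixes f :: "'b \<Rightarrow> 'a \<Rightarrow> 'c::topological_comm_monoid_add"
  assumes "\<And>i. i \<in> I \<Longrightarrow> (f i has_sum S i) A"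
  shows "((\<lambda>x. \<Sum>i\<in>I. f i x) has_sum (\<Sum>i\<in>I. S i)) A"
  using assms by (induction I rule: infinite_finite_induct) (auto intro!: has_sum_add)

lemma has_sum_diff:
  fixes f g :: "'a \<Rightarrow> 'b::topological_ab_group_add"
  assumes "(f has_sum S) A" "(g has_sum T) A"
  shows "((\<lambda>x. f x - g x) has_sum (S - T)) A"
proof -
  have "((\<lambda>x. - g x) has_sum - T) A"
    using assms(2) by (simp add: has_sum_uminus)
  thus ?thesis using has_sum_add[OF assms(1)] by fastforce
qed

lemma zeta_series_eq: "zeta_series a1 a2 w = powr_rem_sum a1 a2 0 w w"
  by (simp add: fun_eq_iff zeta_series_def powr_rem_sum_def powr_rem_def)

context
  fixes a1 a2 :: real
  assumes a: "a1 > 0" "a2 > 0"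
begin

lemma has_sum_zeta_series:
  assumes "Re w > 0" "Re s > 2"
  shows "((\<lambda>k. (w + of_real (lat a1 a2 k)) powr (- s)) has_sum zeta_series a1 a2 w s) UNIV"
  using powr_rem_sum(3)[OF a assms(1) assms(1), of 0 s] assms(2)
  by (simp add: powr_rem_def zeta_series_eq)

lemma holomorphic_on_zeta_series:
  assumes "Re w > 0"
  shows "zeta_series a1 a2 w holomorphic_on {s. Re s > 2}"
  using powr_rem_sum(1)[OF a assms assms, of 0] by (simp add: zeta_series_eq)

text \<open>Shifting \<open>w\<close> by \<open>a1\<close> restricts the sum to
  \<open>k1 \<ge> 1\<close>, and likewise for \<open>a2\<close>; inclusion and exclusion leave the
  origin of the lattice.\<close>

lemma zeta_series_mixed_difference:
  assumes w: "Re w > 0" and s: "Re s > 2"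
  shows "zeta_series a1 a2 w s - zeta_series a1 a2 (w + a1) s - zeta_series a1 a2 (w + a2) s
     + zeta_series a1 a2 (w + a1 + a2) s = w powr (- s)"
proof -
  define f where "f = (\<lambda>k. (w + of_real (lat a1 a2 k)) powr (- s))"
  define S1 where "S1 = (\<lambda>k. (Suc (fst k), snd k)) ` (UNIV :: (nat \<times> nat) set)"
  define S2 where "S2 = (\<lambda>k. (fst k, Suc (snd k))) ` (UNIV :: (nat \<times> nat) set)"
  define S3 where "S3 = (\<lambda>k. (Suc (fst k), Suc (snd k))) ` (UNIV :: (nat \<times> nat) set)"
  have 0: "(f has_sum zeta_series a1 a2 w s) UNIV"
    unfolding f_def by (rule has_sum_zeta_series[OF w s])
  have 1: "(f has_sum zeta_series a1 a2 (w + a1) s) S1"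
    unfolding S1_def
    by (subst has_sum_reindex)
       (use has_sum_zeta_series[of "w + a1" s] w s a in
         \<open>auto simp: inj_on_def prod_eq_iff f_def o_def lat_def algebra_simps\<close>)
  have 2: "(f has_sum zeta_series a1 a2 (w + a2) s) S2"
    unfolding S2_def
    by (subst has_sum_reindex)
       (use has_sum_zeta_series[of "w + a2" s] w s a in
         \<open>auto simp: inj_on_def prod_eq_iff f_def o_def lat_def algebra_simps\<close>)
  have 3: "(f has_sum zeta_series a1 a2 (w + a1 + a2) s) S3"
    unfolding S3_def
    by (subst has_sum_reindex)
       (use has_sum_zeta_series[of "w + a1 + a2" s] w s a in
         \<open>auto simp: inj_on_def prod_eq_iff f_def o_def lat_def algebra_simps\<close>)
  have "(f has_sum ((zeta_series a1 a2 w s - zeta_series a1 a2 (w + a1) s)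
           - (zeta_series a1 a2 (w + a2) s - zeta_series a1 a2 (w + a1 + a2) s)))
         ((UNIV - S1) - (S2 - S3))"
    by (intro has_sum_Diff 0 1 2 3) (auto simp: S1_def S2_def S3_def image_iff)
  also have "(UNIV - S1) - (S2 - S3) = {(0, 0)}"
  proof -
    have "k \<in> S1 \<longleftrightarrow> fst k \<noteq> 0" "k \<in> S2 \<longleftrightarrow> snd k \<noteq> 0" "k \<in> S3 \<longleftrightarrow> fst k \<noteq> 0 \<and> snd k \<noteq> 0" for k
      by (cases k; cases "fst k"; cases "snd k"; force simp: S1_def S2_def S3_def image_iff)+
    thus ?thesis by (auto simp: prod_eq_iff)
  qed
  finally have "(zeta_series a1 a2 w s - zeta_series a1 a2 (w + a1) s)
           - (zeta_series a1 a2 (w + a2) s - zeta_series a1 a2 (w + a1 + a2) s) = f (0, 0)"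
    by (simp add: has_sum_finite_iff)
  thus ?thesis by (simp add: f_def lat_def algebra_simps)
qed

text \<open>
  Expand the mixed difference of \<open>x powr (2 - s)\<close> with steps \<open>a\<^sub>1\<close> and \<open>a\<^sub>2\<close> by Taylor's formula and
  sum over the lattice. The left side telescopes to \<open>w powr (2 - s)\<close>, so the series at \<open>s\<close> is
  expressed through its values at \<open>s + 1, s + 2, \<dots>\<close> and a remainder that converges further to
  the left; the factor \<open>(s - 1) * (s - 2)\<close> cancels all poles.
\<close>

lemma zeta_series_recursion:
  fixes n :: nat
  assumes w: "Re w > 0" and s: "Re s > 4"
  defines "\<delta> \<equiv> (\<lambda>j. of_real ((a1 + a2) ^ j - a1 ^ j - a2 ^ j) :: complex)"
  defines "R \<equiv> (\<lambda>u. powr_rem_sum a1 a2 (n + 3) w (w + u) (s - 2))"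
  defines "h \<equiv> (\<lambda>s. (s - 1) * (s - 2) * zeta_series a1 a2 w s)"
  shows "of_real (a1 * a2) * h s = w powr (2 - s) - (R (a1 + a2) - R a1 - R a2)
     - (\<Sum>i=1..n. powr_coeff (s - 2) i / fact (i + 2) * \<delta> (i + 2) * h (s + of_nat i))"
proof -
  define x where "x = (\<lambda>k. w + of_real (lat a1 a2 k) :: complex)"
  define r where "r = (\<lambda>u k. powr_rem (n + 3) (s - 2) (x k) (x k + u))"
  have hR: "(r u has_sum R u) UNIV" if "Re u \<ge> 0" for u
    using powr_rem_sum(3)[OF a w, of "w + u" "n + 3" "s - 2"] w s that
    by (simp add: r_def x_def R_def add_ac)
  define t where "t = (\<lambda>i k. powr_coeff (s - 2) (i + 2) / fact (i + 2) * \<delta> (i + 2) * x k powr (- (s + of_nat i)))"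
  have ht: "(t i has_sum powr_coeff (s - 2) i / fact (i + 2) * \<delta> (i + 2) * h (s + of_nat i)) UNIV" for i
  proof -
    \<comment> \<open>The last two factors of the coefficient are exactly the polynomial by which
      \<open>h (s + of_nat i)\<close> multiplies the zeta series.\<close>
    have "powr_coeff (s - 2) (i + 2) = powr_coeff (s - 2) i * ((s + of_nat i - 1) * (s + of_nat i - 2))"
      by (simp add: powr_coeff_Suc algebra_simps)
    hence *: "powr_coeff (s - 2) i / fact (i + 2) * \<delta> (i + 2) * h (s + of_nat i)
        = powr_coeff (s - 2) (i + 2) / fact (i + 2) * \<delta> (i + 2) * zeta_series a1 a2 w (s + of_nat i)"
      by (simp only: h_def mult_ac times_divide_eq_left times_divide_eq_right)
    show ?thesis
      unfolding * t_def x_def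
      by (intro has_sum_cmult_right has_sum_zeta_series w) (use s in auto)
  qed
  have sum_t: "((\<lambda>k. \<Sum>i\<in>{0..n}. t i k) has_sum
      (\<Sum>i\<in>{0..n}. powr_coeff (s - 2) i / fact (i + 2) * \<delta> (i + 2) * h (s + of_nat i))) UNIV"
    by (intro has_sum_sum ht)
  have D: "((\<lambda>k. x k powr (- (s - 2)) - (x k + a1) powr (- (s - 2)) - (x k + a2) powr (- (s - 2))
      + (x k + a1 + a2) powr (- (s - 2))) has_sum w powr (- (s - 2))) UNIV"
  proof -
    have *: "((\<lambda>k. (x k + u) powr (- (s - 2))) has_sum zeta_series a1 a2 (w + u) (s - 2)) UNIV"
      if "Re u \<ge> 0" for u
      using has_sum_zeta_series[of "w + u" "s - 2"] that w s by (simp add: x_def add_ac)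
    have "((\<lambda>k. (x k + 0) powr (- (s - 2)) - (x k + a1) powr (- (s - 2)) - (x k + a2) powr (- (s - 2))
      + (x k + (a1 + a2)) powr (- (s - 2))) has_sum
        (zeta_series a1 a2 (w + 0) (s - 2) - zeta_series a1 a2 (w + a1) (s - 2)
          - zeta_series a1 a2 (w + a2) (s - 2) + zeta_series a1 a2 (w + (a1 + a2)) (s - 2))) UNIV"
      by (intro has_sum_add has_sum_diff *) (use a in auto)
    thus ?thesis
      using zeta_series_mixed_difference[OF w, of "s - 2"] s by (simp add: add.assoc)
  qed
  have E: "x k powr (- (s - 2)) - (x k + a1) powr (- (s - 2)) - (x k + a2) powr (- (s - 2))
      + (x k + a1 + a2) powr (- (s - 2))
      = (r (a1 + a2) k - r a1 k - r a2 k) + (\<Sum>i\<in>{0..n}. t i k)" for k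
  proof -
    define c where "c = (\<lambda>j. powr_coeff (s - 2) j / fact j * x k powr (- (s - 2) - of_nat j))"
    have r: "r u k = (x k + u) powr (- (s - 2)) - (\<Sum>j<n+3. c j * u ^ j)" for u
      by (simp add: r_def powr_rem_def c_def mult_ac)
    have "(\<Sum>i\<in>{0..n}. t i k) = (\<Sum>i\<in>{0..n}. c (i + 2) * \<delta> (i + 2))"
      by (intro sum.cong) (auto simp: t_def c_def algebra_simps)
    also have "\<dots> = (\<Sum>j\<in>{2..n+2}. c j * \<delta> j)"
      by (rule sum.reindex_bij_witness[of _ "\<lambda>j. j - 2" "\<lambda>i. i + 2"]) auto
    also have "\<dots> = (\<Sum>j<n+3. c j * \<delta> j) - (c 0 * \<delta> 0 + c 1 * \<delta> 1)"
    proof -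
      have "{..<n+3} = {0, 1} \<union> {2..n+2}" by auto
      hence "(\<Sum>j<n+3. c j * \<delta> j) = (\<Sum>j\<in>{0,1}. c j * \<delta> j) + (\<Sum>j\<in>{2..n+2}. c j * \<delta> j)"
        by (simp only:) (subst sum.union_disjoint, auto)
      thus ?thesis by simp
    qed
    \<comment> \<open>Here \<open>\<delta> 0 = - 1\<close> and \<open>\<delta> 1 = 0\<close>: the
      constant Taylor terms cancel against the unshifted power, and the linear terms cancel among
      themselves.\<close>
    also have "c 0 * \<delta> 0 + c 1 * \<delta> 1 = - (x k powr (- (s - 2)))"
      by (simp add: \<delta>_def c_def)
    also have "(\<Sum>j<n+3. c j * \<delta> j) = (\<Sum>j<n+3. c j * (of_real (a1 + a2)) ^ j)
        - (\<Sum>j<n+3. c j * of_real a1 ^ j) - (\<Sum>j<n+3. c j * of_real a2 ^ j)"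
      by (simp add: \<delta>_def algebra_simps sum_subtractf sum.distrib)
    finally show ?thesis unfolding r by (simp add: algebra_simps)
  qed
  have "((\<lambda>k. (r (a1 + a2) k - r a1 k - r a2 k) + (\<Sum>i\<in>{0..n}. t i k)) has_sum
     ((R (a1 + a2) - R a1 - R a2)
        + (\<Sum>i\<in>{0..n}. powr_coeff (s - 2) i / fact (i + 2) * \<delta> (i + 2) * h (s + of_nat i)))) UNIV"
    by (intro has_sum_add has_sum_diff hR sum_t) (use a in auto)
  from has_sum_unique[OF D this[folded E]]
  have "w powr (- (s - 2)) = (R (a1 + a2) - R a1 - R a2)
     + (\<Sum>i\<in>{0..n}. powr_coeff (s - 2) i / fact (i + 2) * \<delta> (i + 2) * h (s + of_nat i))" .
  moreover have "(\<Sum>i\<in>{0..n}. powr_coeff (s - 2) i / fact (i + 2) * \<delta> (i + 2) * h (s + of_nat i))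
     = of_real (a1 * a2) * h s
       + (\<Sum>i=1..n. powr_coeff (s - 2) i / fact (i + 2) * \<delta> (i + 2) * h (s + of_nat i))"
  proof -
    \<comment> \<open>The leading coefficient \<open>\<delta> 2 / fact 2\<close> is
      \<open>a1 * a2\<close>, which is nonzero and so allows the identity to be solved for
      \<open>h s\<close>.\<close>
    have "\<delta> 2 = 2 * of_real (a1 * a2)"
      by (simp add: \<delta>_def power2_eq_square algebra_simps)
    thus ?thesis by (subst sum.atLeast_Suc_atMost) (simp_all add: numeral_2_eq_2)
  qed
  ultimately show ?thesis by simp
qed

text \<open>Solved for \<open>h s\<close>, the recursion involves \<open>h\<close> at
  \<open>s + of_nat i\<close> with \<open>i \<ge> 1\<close>, known by induction, and remainder sums
  of order \<open>n + 3\<close> at \<open>s - 2\<close>, which converge for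
  \<open>Re (s - 2) > - n - 1\<close>; both reach one unit further left. Agreement is recorded for
  \<open>Re s > 4\<close>, where the series at \<open>s - 2\<close> converge.\<close>

lemma zeta_series_partial_continuation:
  assumes w: "Re w > 0"
  shows "\<exists>h. h holomorphic_on {s. Re s > 2 - real n} \<and>
     (\<forall>s. Re s > 4 \<longrightarrow> h s = (s - 1) * (s - 2) * zeta_series a1 a2 w s)"
proof (induction n)
  case 0
  show ?case
    by (rule exI[of _ "\<lambda>s. (s - 1) * (s - 2) * zeta_series a1 a2 w s"])
       (auto intro!: holomorphic_intros holomorphic_on_zeta_series[OF w])
next
  case (Suc n)
  then obtain h where h: "h holomorphic_on {s. Re s > 2 - real n}"
    "\<And>s. Re s > 4 \<Longrightarrow> h s = (s - 1) * (s - 2) * zeta_series a1 a2 w s" by blast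
  define \<delta> where "\<delta> = (\<lambda>j. of_real ((a1 + a2) ^ j - a1 ^ j - a2 ^ j) :: complex)"
  define R where "R = (\<lambda>u s. powr_rem_sum a1 a2 (n + 3) w (w + u) (s - 2))"
  define h' where "h' = (\<lambda>s. (w powr (2 - s) - (R (a1 + a2) s - R a1 s - R a2 s)
     - (\<Sum>i=1..n. powr_coeff (s - 2) i / fact (i + 2) * \<delta> (i + 2) * h (s + of_nat i))) / of_real (a1 * a2))"
  let ?A = "{s::complex. Re s > 2 - real (Suc n)}"
  have R: "R u holomorphic_on ?A" if "Re u \<ge> 0" for u
  proof -
    have "(powr_rem_sum a1 a2 (n + 3) w (w + u) \<circ> (\<lambda>s. s - 2)) holomorphic_on ?A"
      by (rule holomorphic_on_compose_gen[OF _ powr_rem_sum(1)[OF a w]])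
         (use that w in \<open>auto intro!: holomorphic_intros\<close>)
    thus ?thesis by (simp add: R_def o_def)
  qed
  have hh: "(\<lambda>s. h (s + of_nat i)) holomorphic_on ?A" if "i \<ge> 1" for i
  proof -
    have "(h \<circ> (\<lambda>s. s + of_nat i)) holomorphic_on ?A"
      by (rule holomorphic_on_compose_gen[OF _ h(1)])
         (use that in \<open>auto intro!: holomorphic_intros\<close>)
    thus ?thesis by (simp add: o_def)
  qed
  have "h' holomorphic_on ?A"
    unfolding h'_def using a w by (intro holomorphic_intros R hh) auto
  moreover have "h' s = (s - 1) * (s - 2) * zeta_series a1 a2 w s" if "Re s > 4" for s
  proof -
    have "(\<Sum>i=1..n. powr_coeff (s - 2) i / fact (i + 2) * \<delta> (i + 2) * h (s + of_nat i))
        = (\<Sum>i=1..n. powr_coeff (s - 2) i / fact (i + 2) * \<delta> (i + 2)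
            * ((s + of_nat i - 1) * (s + of_nat i - 2) * zeta_series a1 a2 w (s + of_nat i)))"
      using that by (intro sum.cong refl) (simp add: h(2))
    thus ?thesis
      using zeta_series_recursion[OF w that, of n] a
      unfolding h'_def R_def \<delta>_def by (simp add: field_simps)
  qed
  ultimately show ?case by blast
qed

text \<open>Two partial continuations agree for \<open>Re s > 4\<close>, hence on their whole
  overlap, which is again a half plane and so connected; the half planes exhaust the plane.\<close>

lemma zeta_series_continuation:
  assumes w: "Re w > 0"
  shows "\<exists>E. E holomorphic_on UNIV \<and>
     (\<forall>s. Re s > 2 \<longrightarrow> E s = (s - 1) * (s - 2) * zeta_series a1 a2 w s)"
proof -
  let ?A = "\<lambda>n::nat. {s::complex. Re s > 2 - real n}"
  obtain h where h: "\<And>n. h n holomorphic_on ?A n"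
    "\<And>n s. Re s > 4 \<Longrightarrow> h n s = (s - 1) * (s - 2) * zeta_series a1 a2 w s"
    using zeta_series_partial_continuation[OF w] by metis
  have ext: "f s = g s" if "f holomorphic_on ?A n" "g holomorphic_on ?A n"
      "\<And>s. Re s > 4 \<Longrightarrow> f s = g s" "s \<in> ?A n" for f g s n
  proof (rule analytic_continuation_open[of "{s. Re s > 4}" "?A n" f g])
    show "open {s::complex. Re s > 4}" "open (?A n)" by (rule open_Re_gt)+
    show "{s::complex. Re s > 4} \<noteq> {}" by (auto intro: exI[of _ "5::complex"])
    show "connected (?A n)" by (intro convex_connected convex_halfspace_Re_gt)
  qed (use that in auto)
  have agree: "h n s = h m s" if "Re s > 2 - real n" "Re s > 2 - real m" for n m s
  proof (rule ext[where n = "min n m" and f = "h n" and g = "h m"])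
    show "h n holomorphic_on ?A (min n m)" "h m holomorphic_on ?A (min n m)"
      by (auto intro!: holomorphic_on_subset[OF h(1)])
  qed (use that h(2) in auto)
  define E where "E = (\<lambda>s. h (LEAST n. Re s > 2 - real n) s)"
  have E: "E s = h n s" if "Re s > 2 - real n" for s n
    unfolding E_def using agree[OF LeastI[of "\<lambda>n. Re s > 2 - real n", OF that] that] .
  have "E holomorphic_on (\<Union>n. ?A n)"
  proof (rule holomorphic_on_UN_open)
    show "E holomorphic_on ?A n" for n
      using h(1)[of n] by (rule holomorphic_transform) (simp add: E)
  qed (rule open_Re_gt)
  also have "(\<Union>n. ?A n) = UNIV"
  proof -
    have "\<exists>n. Re s > 2 - real n" for s
      using reals_Archimedean2[of "2 - Re s"] by (auto simp: algebra_simps)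
    thus ?thesis by auto
  qed
  finally have "E holomorphic_on UNIV" .
  moreover have "E s = (s - 1) * (s - 2) * zeta_series a1 a2 w s" if "Re s > 2" for s
  proof (rule ext[where n = 0 and f = E and g = "\<lambda>s. (s - 1) * (s - 2) * zeta_series a1 a2 w s"])
    show "E holomorphic_on ?A 0"
      using h(1)[of 0] by (rule holomorphic_transform) (simp add: E)
    show "E s = (s - 1) * (s - 2) * zeta_series a1 a2 w s" if "Re s > 4" for s
      using E[of 0 s] h(2)[of s 0] that by simp
  qed (use that in \<open>auto intro!: holomorphic_intros holomorphic_on_zeta_series[OF w]\<close>)
  ultimately show ?thesis by blast
qed

end

text \<open>After removal of its singularities the difference is constant zero, so \<open>f\<close>
  and \<open>g\<close> coincide in a punctured neighbourhood of each point. They then have the same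
  poles, where both are 0 by convention, and the same limits elsewhere.\<close>

lemma nicely_meromorphic_on_UNIV_eqI:
  assumes f: "f nicely_meromorphic_on UNIV" and g: "g nicely_meromorphic_on UNIV"
    and eq: "\<And>s. Re s > c \<Longrightarrow> f s = g s"
  shows "f = g"
proof
  fix z
  define d where "d = (\<lambda>z. f z - g z)"
  have mero: "f meromorphic_on UNIV" "g meromorphic_on UNIV" "d meromorphic_on UNIV"
    using f g by (auto simp: nicely_meromorphic_on_def d_def intro!: meromorphic_intros)
  have iso: "isolated_singularity_at d z" for z
    using mero(3) by (auto intro: meromorphic_on_isolated_singularity meromorphic_on_subset)
  let ?z = "of_real (c + 1) :: complex"
  have "eventually (\<lambda>w. w \<in> {s. Re s > c}) (at ?z)"
    by (intro eventually_at_in_open' open_Re_gt) auto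
  hence "eventually (\<lambda>w. remove_sings d w = 0) (at ?z)"
    using eventually_remove_sings_eq_at[OF iso] by eventually_elim (simp add: d_def eq)
  hence "frequently (\<lambda>w. remove_sings d w = 0) (at ?z)"
    by (intro eventually_frequently) auto
  hence d0: "remove_sings d w = 0" for w
    by (rule frequently_eq_meromorphic_imp_constant[of _ _ _ UNIV])
       (auto intro!: remove_sings_nicely_meromorphic mero)
  have ev: "eventually (\<lambda>w. f w = g w) (at z)"
    using eventually_remove_sings_eq_at[OF iso, of z]
    by eventually_elim (use d0 in \<open>simp add: d_def\<close>)
  show "f z = g z"
  proof (cases "is_pole f z")
    case True
    moreover have "is_pole f z \<longleftrightarrow> is_pole g z" by (rule is_pole_cong[OF ev refl])
    ultimately show ?thesis
      using f g unfolding nicely_meromorphic_on_def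
      by (metis UNIV_I at_neq_bot is_pole_def not_tendsto_and_filterlim_at_infinity)
  next
    case False
    moreover have "is_pole f z \<longleftrightarrow> is_pole g z" by (rule is_pole_cong[OF ev refl])
    ultimately have "f \<midarrow>z\<rightarrow> f z" "g \<midarrow>z\<rightarrow> g z"
      using f g unfolding nicely_meromorphic_on_def by blast+
    moreover from this(2) have "f \<midarrow>z\<rightarrow> g z"
      using tendsto_cong[OF ev] by blast
    ultimately show ?thesis by (meson LIM_unique)
  qed
qed

text \<open>Dividing the entire numerator by \<open>(s - 1) * (s - 2)\<close> and normalising the
  result with \<open>remove_sings\<close> gives a function that meets the description, and
  uniqueness identifies it with \<open>double_zeta\<close>. From here on everything is read off the
  entire function \<open>E\<close>.\<close>

lemma double_zeta_continuation:
  assumes a: "a1 > 0" "a2 > 0" and w: "Re w > 0"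
  shows "\<exists>E. E holomorphic_on UNIV \<and>
     (\<forall>s. Re s > 2 \<longrightarrow> E s = (s - 1) * (s - 2) * zeta_series a1 a2 w s) \<and>
     (\<forall>s. s \<noteq> 1 \<longrightarrow> s \<noteq> 2 \<longrightarrow> double_zeta a1 a2 w s = E s / ((s - 1) * (s - 2)))"
proof -
  obtain E where E: "E holomorphic_on UNIV"
    "\<And>s. Re s > 2 \<Longrightarrow> E s = (s - 1) * (s - 2) * zeta_series a1 a2 w s"
    using zeta_series_continuation[OF a w] by blast
  define Q where "Q = (\<lambda>s. E s / ((s - 1) * (s - 2)))"
  have Q_an: "Q analytic_on {s}" if "s \<noteq> 1" "s \<noteq> 2" for s
    unfolding Q_def using that E(1)
    by (intro analytic_intros) (auto simp: analytic_on_open[symmetric] intro: analytic_on_subset)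
  have Q_mero: "Q meromorphic_on UNIV"
    unfolding Q_def using E(1)
    by (intro meromorphic_intros analytic_on_imp_meromorphic_on) (auto simp: analytic_on_open)
  define Z where "Z = remove_sings Q"
  have Z: "Z nicely_meromorphic_on UNIV"
    unfolding Z_def by (intro remove_sings_nicely_meromorphic Q_mero)
  have ZQ: "Z s = Q s" if "s \<noteq> 1" "s \<noteq> 2" for s
    unfolding Z_def by (intro remove_sings_at_analytic Q_an that)
  let ?P = "\<lambda>Z. Z nicely_meromorphic_on UNIV \<and>
     (\<forall>s. Re s > 2 \<longrightarrow>
       ((\<lambda>(k1::nat, k2::nat).
           (w + of_nat k1 * of_real a1 + of_nat k2 * of_real a2) powr (- s))
         has_sum Z s) UNIV)"
  have series: "((\<lambda>(k1::nat, k2::nat).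
           (w + of_nat k1 * of_real a1 + of_nat k2 * of_real a2) powr (- s))
         has_sum zeta_series a1 a2 w s) UNIV" if "Re s > 2" for s
    using has_sum_zeta_series[OF a w that] by (simp add: lat_def case_prod_unfold add.assoc)
  have PZ: "?P Z"
  proof (intro conjI Z allI impI)
    fix s :: complex assume s: "Re s > 2"
    hence "s \<noteq> 1" "s \<noteq> 2" by auto
    hence "Z s = zeta_series a1 a2 w s" using s by (simp add: ZQ Q_def E(2))
    thus "((\<lambda>(k1::nat, k2::nat).
           (w + of_nat k1 * of_real a1 + of_nat k2 * of_real a2) powr (- s)) has_sum Z s) UNIV"
      using series[OF s] by simp
  qed
  have "double_zeta a1 a2 w = Z"
    unfolding double_zeta_def
  proof (rule the_equality[where P = ?P, OF PZ])
    fix Z' assume P': "?P Z'"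
    show "Z' = Z"
    proof (rule nicely_meromorphic_on_UNIV_eqI)
      show "Z' s = Z s" if "Re s > 2" for s
        using P' PZ that has_sum_unique by blast
    qed (use P' PZ in auto)
  qed
  thus ?thesis using E ZQ by (auto simp: Q_def)
qed

section \<open>The double zeta function near zero\<close>

text \<open>The clearing factors of the zeta values at \<open>s + 1\<close> and \<open>s + 2\<close>
  absorb the factors \<open>s\<close> and \<open>s + 1\<close> of the binomial coefficients. This is
  how the poles at 1 and 2 leave finite contributions at \<open>s = 0\<close>.\<close>

lemma expansion_algebra:
  fixes s d A B C D :: complex
  shows "(s - 1) * (s - 2) * A = (s - 1) * (s - 2) * B - d * (s - 2) * ((s + 1 - 1) * (s + 1 - 2) * C)
     + (s - 1) * (s - 2) / 2 * d\<^sup>2 * ((s + 2 - 1) * (s + 2 - 2) * D)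
     + (s - 1) * (s - 2) * (A - (B - s * d * C + s * (s + 1) / 2 * d\<^sup>2 * D))"
proof -
  have "(s - 1) * (s - 2) / 2 * d\<^sup>2 * ((s + 2 - 1) * (s + 2 - 2) * D)
      = (s - 1) * (s - 2) * (s * (s + 1) / 2 * d\<^sup>2 * D)"
    by simp
  moreover have "d * (s - 2) * ((s + 1 - 1) * (s + 1 - 2) * C) = (s - 1) * (s - 2) * (s * d * C)"
    by simp
  ultimately show ?thesis by (simp only: right_diff_distrib distrib_left) simp
qed

lemma expansion_division:
  fixes p p' q d A B C D S :: complex
  assumes "p \<noteq> 0" "q \<noteq> 0" "p' = - p"
    and "A = B - d * q * C + p * q / 2 * d\<^sup>2 * D + p * q * S"
  shows "A / (p * q) = B / (p * q) + d * (C / p') + d\<^sup>2 * (D / 2) + S"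
  unfolding assms(3,4) using assms(1,2) by (simp add: divide_simps)

context
  fixes a1 a2 :: real
  assumes a: "a1 > 0" "a2 > 0"
begin

text \<open>An entire substitute for \<open>double_zeta\<close>: identities proved for
  \<open>Re s > 2\<close> carry over to half planes around 0 by the identity theorem, without
  detours around 1 and 2. The choice is prescribed for \<open>Re s > 2\<close> and hence determined
  everywhere.\<close>

definition zeta_num :: "complex \<Rightarrow> complex \<Rightarrow> complex" where
  "zeta_num w = (SOME E. E holomorphic_on UNIV \<and>
     (\<forall>s. Re s > 2 \<longrightarrow> E s = (s - 1) * (s - 2) * zeta_series a1 a2 w s) \<and>
     (\<forall>s. s \<noteq> 1 \<longrightarrow> s \<noteq> 2 \<longrightarrow> double_zeta a1 a2 w s = E s / ((s - 1) * (s - 2))))"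

lemma zeta_num:
  assumes "Re w > 0"
  shows "zeta_num w holomorphic_on UNIV"
    and "Re s > 2 \<Longrightarrow> zeta_num w s = (s - 1) * (s - 2) * zeta_series a1 a2 w s"
    and "s \<noteq> 1 \<Longrightarrow> s \<noteq> 2 \<Longrightarrow> double_zeta a1 a2 w s = zeta_num w s / ((s - 1) * (s - 2))"
  using someI_ex[OF double_zeta_continuation[OF a assms], folded zeta_num_def] by blast+

lemma holomorphic_on_zeta_num [holomorphic_intros]:
  assumes "Re w > 0" "g holomorphic_on A"
  shows "(\<lambda>s. zeta_num w (g s)) holomorphic_on A"
  using holomorphic_on_compose[OF assms(2), of "zeta_num w"] zeta_num(1)[OF assms(1)]
  by (auto simp: o_def intro: holomorphic_on_subset)

lemma eq_from_half_plane:
  assumes "f holomorphic_on {s. Re s > c}" "g holomorphic_on {s. Re s > c}"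
    and eq: "\<And>s. Re s > 2 \<Longrightarrow> f s = g s" and c: "c \<le> 2"
  shows "\<forall>s. Re s > c \<longrightarrow> f s = g s"
proof (intro allI impI)
  fix s :: complex assume s: "Re s > c"
  show "f s = g s"
  proof (rule analytic_continuation_open[of "{s. Re s > 2}" "{s. Re s > c}" f g])
    show "open {s::complex. Re s > 2}" "open {s::complex. Re s > c}" by (rule open_Re_gt)+
    show "{s::complex. Re s > 2} \<noteq> {}" by (auto intro: exI[of _ "3::complex"])
    show "connected {s::complex. Re s > c}" by (intro convex_connected convex_halfspace_Re_gt)
  qed (use assms s in auto)
qed

text \<open>The Taylor expansion about \<open>u\<close>, translated along the lattice, is summed for
  \<open>Re s > 2\<close> and then continued. Order three is the least for which the remainder sum
  is holomorphic near \<open>s = 0\<close>.\<close>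

lemma zeta_num_expansion:
  assumes u: "Re u > 0" and w: "Re w > 0"
  shows "\<forall>s. Re s > -1 \<longrightarrow> zeta_num w s = zeta_num u s - (w - u) * (s - 2) * zeta_num u (s + 1)
     + (s - 1) * (s - 2) / 2 * (w - u)\<^sup>2 * zeta_num u (s + 2)
     + (s - 1) * (s - 2) * powr_rem_sum a1 a2 3 u w s"
proof (rule eq_from_half_plane)
  show "zeta_num w holomorphic_on {s. - 1 < Re s}"
    using zeta_num(1)[OF w] by (rule holomorphic_on_subset) auto
  have "powr_rem_sum a1 a2 3 u w holomorphic_on {s. Re s > -1}"
    using powr_rem_sum(1)[OF a u w, of 3] by simp
  thus "(\<lambda>s. zeta_num u s - (w - u) * (s - 2) * zeta_num u (s + 1)
     + (s - 1) * (s - 2) / 2 * (w - u)\<^sup>2 * zeta_num u (s + 2)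
     + (s - 1) * (s - 2) * powr_rem_sum a1 a2 3 u w s) holomorphic_on {s. - 1 < Re s}"
    by (intro holomorphic_intros u) auto
  fix s :: complex assume s: "Re s > 2"
  have ff3: "(\<Sum>j<3. powr_coeff s j / fact j * h ^ j * Z j) = Z 0 - s * h * Z 1 + s * (s + 1) / 2 * h\<^sup>2 * Z 2"
    for h and Z :: "nat \<Rightarrow> complex"
    by (simp add: numeral_3_eq_3 numeral_2_eq_2 powr_coeff_Suc field_simps)
  let ?x = "\<lambda>k. complex_of_real (lat a1 a2 k)"
  have z: "((\<lambda>k. (x + ?x k) powr (- s - of_nat j)) has_sum zeta_series a1 a2 x (s + of_nat j)) UNIV"
    if "Re x > 0" for x j
    using has_sum_zeta_series[OF a that, of "s + of_nat j"] s by (simp add: algebra_simps)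
  have "((\<lambda>k. (w + ?x k) powr (- s - of_nat 0)
     - (\<Sum>j<3. powr_coeff s j / fact j * (w - u) ^ j * (u + ?x k) powr (- s - of_nat j))) has_sum
     (zeta_series a1 a2 w (s + of_nat 0)
       - (\<Sum>j<3. powr_coeff s j / fact j * (w - u) ^ j * zeta_series a1 a2 u (s + of_nat j)))) UNIV"
    by (intro has_sum_diff has_sum_sum has_sum_cmult_right z u w)
  hence "((\<lambda>k. powr_rem 3 s (u + ?x k) (w + ?x k)) has_sum
     (zeta_series a1 a2 w s
       - (\<Sum>j<3. powr_coeff s j / fact j * (w - u) ^ j * zeta_series a1 a2 u (s + of_nat j)))) UNIV"
    by (simp add: powr_rem_def)
  from has_sum_unique[OF powr_rem_sum(3)[OF a u w] this]
  have "powr_rem_sum a1 a2 3 u w s = zeta_series a1 a2 w s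
       - (\<Sum>j<3. powr_coeff s j / fact j * (w - u) ^ j * zeta_series a1 a2 u (s + of_nat j))"
    using s by simp
  also have "(\<Sum>j<3. powr_coeff s j / fact j * (w - u) ^ j * zeta_series a1 a2 u (s + of_nat j))
    = zeta_series a1 a2 u s - s * (w - u) * zeta_series a1 a2 u (s + 1)
      + s * (s + 1) / 2 * (w - u)\<^sup>2 * zeta_series a1 a2 u (s + 2)"
    using ff3[of "w - u" "\<lambda>j. zeta_series a1 a2 u (s + of_nat j)"] by simp
  finally show "zeta_num w s = zeta_num u s - (w - u) * (s - 2) * zeta_num u (s + 1)
     + (s - 1) * (s - 2) / 2 * (w - u)\<^sup>2 * zeta_num u (s + 2)
     + (s - 1) * (s - 2) * powr_rem_sum a1 a2 3 u w s"
    using s u w expansion_algebra[of s "zeta_series a1 a2 w s" "zeta_series a1 a2 u s" "w - u"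
        "zeta_series a1 a2 u (s + 1)" "zeta_series a1 a2 u (s + 2)"]
    by (simp only: zeta_num(2) plus_complex.simps one_complex.simps complex_Re_numeral)
qed auto

lemma eventually_double_zeta_eq:
  assumes w: "Re w > 0"
  shows "eventually (\<lambda>s. double_zeta a1 a2 w s = zeta_num w s / ((s - 1) * (s - 2))) (nhds 0)"
proof -
  have "eventually (\<lambda>s. s \<in> {s::complex. s \<noteq> 1 \<and> s \<noteq> 2}) (nhds 0)"
    by (intro eventually_nhds_in_open open_Collect_conj open_Collect_neq continuous_intros) auto
  thus ?thesis by eventually_elim (simp add: zeta_num(3)[OF w])
qed

lemma double_zeta_0: "Re w > 0 \<Longrightarrow> double_zeta a1 a2 w 0 = zeta_num w 0 / 2"
  by (simp add: zeta_num(3))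

lemma double_zeta_has_derivative_0:
  assumes w: "Re w > 0"
  shows "(double_zeta a1 a2 w has_field_derivative deriv (double_zeta a1 a2 w) 0) (at 0)"
proof -
  have "(\<lambda>s. zeta_num w s / ((s - 1) * (s - 2))) holomorphic_on (- {1, 2})"
    by (intro holomorphic_intros w) auto
  hence "(\<lambda>s. zeta_num w s / ((s - 1) * (s - 2))) field_differentiable at 0"
    by (rule holomorphic_on_imp_differentiable_at) (auto intro: finite_imp_closed)
  then obtain D where "((\<lambda>s. zeta_num w s / ((s - 1) * (s - 2))) has_field_derivative D) (at 0)"
    unfolding field_differentiable_def by blast
  hence "(double_zeta a1 a2 w has_field_derivative D) (at 0)"
    using DERIV_cong_ev[OF refl eventually_double_zeta_eq[OF w] refl] by blast
  thus ?thesis using DERIV_imp_deriv by metis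
qed

text \<open>The derivative of \<open>x powr (- s)\<close> at 0 is \<open>- Ln x\<close>; the result
  is minus the remainder of \<open>Ln v\<close> after its second-order Taylor polynomial at
  \<open>u\<close>.\<close>

lemma deriv_powr_rem_0:
  assumes "u \<noteq> 0" "v \<noteq> 0"
  shows "deriv (\<lambda>s. powr_rem 3 s u v) 0 = - (Ln v - Ln u - (v - u) / u + (v - u)\<^sup>2 / (2 * u\<^sup>2))"
proof (rule DERIV_imp_deriv)
  define h where "h = v - u"
  have eq: "(\<lambda>s. powr_rem 3 s u v) = (\<lambda>s. v powr (- s) - u powr (- s)
     + s * (h * u powr (- s - 1)) - s * ((s + 1) / 2 * h\<^sup>2 * u powr (- s - 2)))"
    unfolding powr_rem_def h_def[symmetric]
    by (simp add: fun_eq_iff numeral_3_eq_3 powr_coeff_Suc power2_eq_square algebra_simps)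
  have q: "((\<lambda>s. x powr (- s)) has_field_derivative - Ln x) (at 0)" if "x \<noteq> 0" for x :: complex
    using that by (auto simp: powr_def intro!: derivative_eq_intros)
  \<comment> \<open>The linear and quadratic Taylor terms carry a factor \<open>s\<close>, so their
    derivative at 0 is the value of the cofactor, which itself is never differentiated.\<close>
  have m: "((\<lambda>s. s * F s) has_field_derivative F 0) (at 0)"
    if "F holomorphic_on UNIV" for F :: "complex \<Rightarrow> complex"
    using DERIV_mult[OF DERIV_ident holomorphic_derivI[OF that open_UNIV UNIV_I], of 0] by simp
  have pw: "u powr (-1) = 1 / u" "u powr (-2) = 1 / u\<^sup>2"
    using assms powr_minus[of u 1] powr_minus[of u 2] powr_nat[of u 2]
    by (simp_all add: field_simps)
  have "((\<lambda>s. v powr (- s) - u powr (- s) + s * (h * u powr (- s - 1))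
      - s * ((s + 1) / 2 * h\<^sup>2 * u powr (- s - 2))) has_field_derivative
      - Ln v - (- Ln u) + h * u powr (- 0 - 1) - (0 + 1) / 2 * h\<^sup>2 * u powr (- 0 - 2)) (at 0)"
    using assms by (intro DERIV_add DERIV_diff q m holomorphic_intros) auto
  also have "- Ln v - (- Ln u) + h * u powr (- 0 - 1) - (0 + 1) / 2 * h\<^sup>2 * u powr (- 0 - 2)
      = - (Ln v - Ln u - h / u + h\<^sup>2 / (2 * u\<^sup>2))"
    by (simp add: pw)
  finally show "((\<lambda>s. powr_rem 3 s u v) has_field_derivative
      - (Ln v - Ln u - (v - u) / u + (v - u)\<^sup>2 / (2 * u\<^sup>2))) (at 0)"
    unfolding eq h_def .
qed

text \<open>With \<open>u\<close> fixed, \<open>w\<close> enters the expansion only through powers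
  of \<open>w - u\<close> up to the second and through the remainder sum. The latter vanishes at
  \<open>s = 0\<close>, and its derivative there is a sum of logarithmic remainders.\<close>

lemma double_zeta_near_0:
  assumes u: "Re u > 0" and w: "Re w > 0"
  defines "D \<equiv> (\<lambda>w. deriv (double_zeta a1 a2 w) 0)"
  shows "double_zeta a1 a2 w 0 = double_zeta a1 a2 u 0 + (w - u) * zeta_num u 1
      + (w - u)\<^sup>2 * (zeta_num u 2 / 2)" (is ?th1)
    and "((\<lambda>k. let x = u + of_real (lat a1 a2 k); y = w + of_real (lat a1 a2 k)
           in Ln y - Ln x - (w - u) / x + (w - u)\<^sup>2 / (2 * x\<^sup>2)) has_sum
          (D u + (w - u) * deriv (\<lambda>s. zeta_num u (s + 1) / (1 - s)) 0
            + (w - u)\<^sup>2 * deriv (\<lambda>s. zeta_num u (s + 2) / 2) 0 - D w)) UNIV" (is ?th2)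
proof -
  let ?x = "\<lambda>k. u + complex_of_real (lat a1 a2 k)" and ?y = "\<lambda>k. w + complex_of_real (lat a1 a2 k)"
  have nz: "?x k \<noteq> 0" "?y k \<noteq> 0" for k
    using u w lat_nonneg[OF a, of k] by (auto simp: complex_eq_iff)
  let ?S = "powr_rem_sum a1 a2 3 u w"
  let ?e1 = "\<lambda>s. zeta_num u (s + 1) / (1 - s)" and ?e2 = "\<lambda>s. zeta_num u (s + 2) / 2"
  have eq: "double_zeta a1 a2 w s = double_zeta a1 a2 u s + (w - u) * ?e1 s + (w - u)\<^sup>2 * ?e2 s + ?S s"
    if "Re s > -1" "s \<noteq> 1" "s \<noteq> 2" for s
    using expansion_division[OF _ _ _ zeta_num_expansion[OF u w, rule_format, OF that(1)], of "1 - s"] that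
    unfolding zeta_num(3)[OF u that(2,3)] zeta_num(3)[OF w that(2,3)] by simp
  \<comment> \<open>At \<open>s = 0\<close> every power is 1 and the coefficients of order 1 and 2
    vanish, so each remainder is 1 - 1.\<close>
  have "?S 0 = 0"
    by (simp add: powr_rem_sum_def powr_rem_def numeral_3_eq_3 powr_coeff_Suc nz)
  with eq[of 0] show ?th1 by simp
  have hS: "?S holomorphic_on {s. Re s > -1}"
    using powr_rem_sum(1)[OF a u w, of 3] by simp
  have dS: "(?S has_field_derivative deriv ?S 0) (at 0)"
    by (rule holomorphic_derivI[OF hS open_Re_gt]) auto
  have de1: "(?e1 has_field_derivative deriv ?e1 0) (at 0)"
  proof (rule holomorphic_derivI)
    show "?e1 holomorphic_on - {1}" by (intro holomorphic_intros u) auto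
  qed auto
  have de2: "(?e2 has_field_derivative deriv ?e2 0) (at 0)"
  proof (rule holomorphic_derivI)
    show "?e2 holomorphic_on UNIV" by (intro holomorphic_intros u) auto
  qed auto
  have ev: "eventually (\<lambda>s. s \<in> {s::complex. Re s > -1} \<inter> {s. s \<noteq> 1 \<and> s \<noteq> 2}) (nhds 0)"
    by (intro eventually_nhds_in_open open_Int open_Re_gt open_Collect_conj open_Collect_neq
          continuous_intros) auto
  have ev2: "eventually (\<lambda>s. double_zeta a1 a2 w s
     = double_zeta a1 a2 u s + (w - u) * ?e1 s + (w - u)\<^sup>2 * ?e2 s + ?S s) (nhds 0)"
    using ev by eventually_elim (rule eq, auto)
  have d2: "((\<lambda>s. double_zeta a1 a2 u s + (w - u) * ?e1 s + (w - u)\<^sup>2 * ?e2 s + ?S s)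
     has_field_derivative D u + (w - u) * deriv ?e1 0 + (w - u)\<^sup>2 * deriv ?e2 0 + deriv ?S 0) (at 0)"
    unfolding D_def
    by (intro DERIV_add DERIV_cmult double_zeta_has_derivative_0[OF u] de1 de2 dS)
  have "(double_zeta a1 a2 w
     has_field_derivative D u + (w - u) * deriv ?e1 0 + (w - u)\<^sup>2 * deriv ?e2 0 + deriv ?S 0) (at 0)"
    by (rule iffD2[OF DERIV_cong_ev[OF refl ev2 refl] d2])
  hence Dw: "D w = D u + (w - u) * deriv ?e1 0 + (w - u)\<^sup>2 * deriv ?e2 0 + deriv ?S 0"
    unfolding D_def by (rule DERIV_imp_deriv)
  have "((\<lambda>k. deriv (\<lambda>s. powr_rem 3 s (?x k) (?y k)) 0) has_sum deriv ?S 0) UNIV"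
    by (rule powr_rem_sum(2)[OF a u w]) auto
  moreover have "deriv (\<lambda>s. powr_rem 3 s (?x k) (?y k)) 0
      = - (let x = ?x k; y = ?y k in Ln y - Ln x - (w - u) / x + (w - u)\<^sup>2 / (2 * x\<^sup>2))" for k
    unfolding deriv_powr_rem_0[OF nz(1)[of k] nz(2)[of k]] Let_def by simp
  ultimately have "((\<lambda>k. let x = ?x k; y = ?y k in
      Ln y - Ln x - (w - u) / x + (w - u)\<^sup>2 / (2 * x\<^sup>2)) has_sum - deriv ?S 0) UNIV"
    by (simp only: has_sum_uminus)
  thus ?th2 by (simp only: Dw) (simp add: algebra_simps)
qed

text \<open>The base point is fixed at 1, so that the coefficients are the same for all
  \<open>w\<close> and can cancel between different arguments.\<close>

lemma double_zeta_quadratic_0: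
  "\<exists>c0 c1 c2 d0 d1 d2. \<forall>w. Re w > 0 \<longrightarrow>
     double_zeta a1 a2 w 0 = c0 + c1 * w + c2 * w\<^sup>2 \<and>
     ((\<lambda>k. let x = 1 + of_real (lat a1 a2 k); y = w + of_real (lat a1 a2 k)
           in Ln y - Ln x - (w - 1) / x + (w - 1)\<^sup>2 / (2 * x\<^sup>2)) has_sum
          (d0 + d1 * w + d2 * w\<^sup>2 - deriv (double_zeta a1 a2 w) 0)) UNIV"
proof -
  have expand: "\<exists>c0 c1 c2. \<forall>w::complex. x + (w - 1) * y + (w - 1)\<^sup>2 * z = c0 + c1 * w + c2 * w\<^sup>2"
    for x y z :: complex
    by (rule exI[of _ "x - y + z"], rule exI[of _ "y - 2 * z"], rule exI[of _ z])
       (simp add: power2_eq_square algebra_simps)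
  obtain c0 c1 c2 where c: "\<And>w. double_zeta a1 a2 1 0 + (w - 1) * zeta_num 1 1
      + (w - 1)\<^sup>2 * (zeta_num 1 2 / 2) = c0 + c1 * w + c2 * w\<^sup>2"
    using expand[of "double_zeta a1 a2 1 0" "zeta_num 1 1" "zeta_num 1 2 / 2"] by blast
  obtain d0 d1 d2 where d: "\<And>w. deriv (double_zeta a1 a2 1) 0
      + (w - 1) * deriv (\<lambda>s. zeta_num 1 (s + 1) / (1 - s)) 0
      + (w - 1)\<^sup>2 * deriv (\<lambda>s. zeta_num 1 (s + 2) / 2) 0 = d0 + d1 * w + d2 * w\<^sup>2"
    using expand[of "deriv (double_zeta a1 a2 1) 0" "deriv (\<lambda>s. zeta_num 1 (s + 1) / (1 - s)) 0"
        "deriv (\<lambda>s. zeta_num 1 (s + 2) / 2) 0"] by blast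
  show ?thesis
  proof (rule exI[of _ c0], rule exI[of _ c1], rule exI[of _ c2], rule exI[of _ d0],
      rule exI[of _ d1], rule exI[of _ d2], intro allI impI conjI)
    fix w :: complex assume w: "Re w > 0"
    show "double_zeta a1 a2 w 0 = c0 + c1 * w + c2 * w\<^sup>2"
      using double_zeta_near_0(1)[of 1 w] w c by simp
    show "((\<lambda>k. let x = 1 + of_real (lat a1 a2 k); y = w + of_real (lat a1 a2 k)
           in Ln y - Ln x - (w - 1) / x + (w - 1)\<^sup>2 / (2 * x\<^sup>2)) has_sum
          (d0 + d1 * w + d2 * w\<^sup>2 - deriv (double_zeta a1 a2 w) 0)) UNIV"
      using double_zeta_near_0(2)[of 1 w] w unfolding d by simp
  qed
qed

text \<open>The mixed difference continues to \<open>w powr (- s)\<close>, which is 1 at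
  \<open>s = 0\<close>. Applied to a quadratic polynomial it isolates the leading
  coefficient.\<close>

lemma double_zeta_mixed_difference_0:
  assumes w: "Re w > 0"
  shows "double_zeta a1 a2 w 0 - double_zeta a1 a2 (w + a1) 0 - double_zeta a1 a2 (w + a2) 0
     + double_zeta a1 a2 (w + a1 + a2) 0 = 1"
proof -
  have w': "Re (w + a1) > 0" "Re (w + a2) > 0" "Re (w + a1 + a2) > 0" "w \<noteq> 0"
    using w a by auto
  have "\<forall>s. Re s > -1 \<longrightarrow>
     zeta_num w s - zeta_num (w + a1) s - zeta_num (w + a2) s + zeta_num (w + a1 + a2) s
     = (s - 1) * (s - 2) * w powr (- s)"
  proof (rule eq_from_half_plane)
    show "(\<lambda>s. zeta_num w s - zeta_num (w + a1) s - zeta_num (w + a2) s + zeta_num (w + a1 + a2) s)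
        holomorphic_on {s. Re s > -1}"
      by (intro holomorphic_intros w w')
    show "(\<lambda>s. (s - 1) * (s - 2) * w powr (- s)) holomorphic_on {s. Re s > -1}"
      using w' by (intro holomorphic_intros)
    show "zeta_num w s - zeta_num (w + a1) s - zeta_num (w + a2) s + zeta_num (w + a1 + a2) s
      = (s - 1) * (s - 2) * w powr (- s)" if "Re s > 2" for s
      unfolding zeta_series_mixed_difference[OF a w that, symmetric]
      using that w w' by (simp add: zeta_num(2) algebra_simps)
  qed auto
  from this[rule_format, of 0] show ?thesis using w w'
    by (simp add: double_zeta_0 flip: diff_divide_distrib add_divide_distrib)
qed

section \<open>The duplication formula and the explicit quadratic polynomial at s = 0\<close>

lemma powr_double:
  fixes z s :: complex
  assumes "z \<noteq> 0"
  shows "2 powr s * (2 * z) powr (- s) = z powr (- s)"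
proof -
  have "Ln (2 * z) = Ln 2 + Ln z"
    using Ln_times_of_real[of 2 z] assms by (simp add: Ln_of_real[of 2, simplified])
  thus ?thesis using assms by (simp add: powr_def exp_add[symmetric] algebra_simps)
qed

text \<open>The lattice is split by the parities \<open>i\<close>, \<open>j\<close> of its two
  indices: twice the sum of \<open>w\<close>, the half period \<open>(i * a1 + j * a2) / 2\<close>
  and a lattice value is \<open>2 * w\<close> plus the lattice value with indices
  \<open>2 * k1 + i\<close> and \<open>2 * k2 + j\<close>.\<close>

lemma zeta_series_duplication:
  assumes w: "Re w > 0" and s: "Re s > 2"
  shows "zeta_series a1 a2 w s + zeta_series a1 a2 (w + a1 / 2) s + zeta_series a1 a2 (w + a2 / 2) s
     + zeta_series a1 a2 (w + (a1 + a2) / 2) s = 2 powr s * zeta_series a1 a2 (2 * w) s"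
proof -
  define f where "f = (\<lambda>k. 2 powr s * (2 * w + of_real (lat a1 a2 k)) powr (- s))"
  define h where "h = (\<lambda>i j k. (2 * fst k + i, 2 * snd k + j) :: nat \<times> nat)"
  have f: "(f has_sum 2 powr s * zeta_series a1 a2 (2 * w) s) UNIV"
    unfolding f_def by (intro has_sum_cmult_right has_sum_zeta_series[OF a]) (use w s in auto)
  have 1: "(f has_sum zeta_series a1 a2 (w + (of_nat i * a1 + of_nat j * a2) / 2) s) (range (h i j))" for i j
  proof (subst has_sum_reindex)
    show "inj (h i j)" by (auto simp: inj_on_def h_def prod_eq_iff)
    define v where "v = w + (of_nat i * a1 + of_nat j * a2) / 2"
    have v: "Re v > 0" using w a by (simp add: v_def add_pos_nonneg)
    have "(f \<circ> h i j) k = (v + of_real (lat a1 a2 k)) powr (- s)" for k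
    proof -
      have nz: "v + of_real (lat a1 a2 k) \<noteq> 0"
        using v lat_nonneg[OF a, of k] by (auto simp: complex_eq_iff)
      have e: "2 * w + of_real (lat a1 a2 (h i j k)) = 2 * (v + of_real (lat a1 a2 k))"
        by (simp add: v_def h_def lat_def field_simps)
      show ?thesis unfolding f_def o_def e by (rule powr_double[OF nz])
    qed
    hence "f \<circ> h i j = (\<lambda>k. (v + of_real (lat a1 a2 k)) powr (- s))" by (rule ext)
    thus "((f \<circ> h i j) has_sum zeta_series a1 a2 (w + (of_nat i * a1 + of_nat j * a2) / 2) s) UNIV"
      using has_sum_zeta_series[OF a v s] by (simp only: v_def)
  qed
  have ne: "2 * x \<noteq> Suc (2 * y)" for x y :: nat by presburger
  have "(f has_sum (((zeta_series a1 a2 (w + (of_nat 0 * a1 + of_nat 0 * a2) / 2) s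
      + zeta_series a1 a2 (w + (of_nat 1 * a1 + of_nat 0 * a2) / 2) s)
      + zeta_series a1 a2 (w + (of_nat 0 * a1 + of_nat 1 * a2) / 2) s)
      + zeta_series a1 a2 (w + (of_nat 1 * a1 + of_nat 1 * a2) / 2) s))
    (((range (h 0 0) \<union> range (h 1 0)) \<union> range (h 0 1)) \<union> range (h 1 1))"
    by (intro has_sum_Un_disjoint 1) (auto simp: h_def ne ne[symmetric])
  also have "((range (h 0 0) \<union> range (h 1 0)) \<union> range (h 0 1)) \<union> range (h 1 1) = UNIV"
  proof -
    have mem: "k \<in> range (h (fst k mod 2) (snd k mod 2))" for k
      by (rule image_eqI[of _ _ "(fst k div 2, snd k div 2)"]) (simp_all add: h_def)
    have m2: "fst k mod 2 = 0 \<or> fst k mod 2 = 1" "snd k mod 2 = 0 \<or> snd k mod 2 = 1"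
      for k :: "nat \<times> nat" by auto
    have "k \<in> ((range (h 0 0) \<union> range (h 1 0)) \<union> range (h 0 1)) \<union> range (h 1 1)" for k
      using mem[of k] m2[of k] by (elim disjE) (simp_all only: Un_iff simp_thms)
    thus ?thesis by blast
  qed
  finally show ?thesis using has_sum_unique[OF f] by simp
qed

text \<open>Value and derivative at \<open>s = 0\<close> of one continued identity. Differentiating
  the factor \<open>2 powr s\<close> produces \<open>ln 2\<close> times the zeta value, which is the
  origin of the exponential factor.\<close>

lemma
  assumes w: "Re w > 0"
  shows double_zeta_0_duplication:
    "double_zeta a1 a2 w 0 + double_zeta a1 a2 (w + a1 / 2) 0 + double_zeta a1 a2 (w + a2 / 2) 0
      + double_zeta a1 a2 (w + (a1 + a2) / 2) 0 = double_zeta a1 a2 (2 * w) 0" (is ?th1)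
    and double_Gamma_duplication:
    "double_Gamma a1 a2 w * double_Gamma a1 a2 (w + a1 / 2) * double_Gamma a1 a2 (w + a2 / 2)
      * double_Gamma a1 a2 (w + (a1 + a2) / 2)
     = exp (of_real (ln 2) * double_zeta a1 a2 (2 * w) 0) * double_Gamma a1 a2 (2 * w)" (is ?th2)
proof -
  have w': "Re (w + a1 / 2) > 0" "Re (w + a2 / 2) > 0" "Re (w + (a1 + a2) / 2) > 0" "Re (2 * w) > 0"
    using w a by (simp_all add: add_pos_pos)
  have num: "\<forall>s. Re s > -1 \<longrightarrow> zeta_num w s + zeta_num (w + a1 / 2) s + zeta_num (w + a2 / 2) s
      + zeta_num (w + (a1 + a2) / 2) s = 2 powr s * zeta_num (2 * w) s"
  proof (rule eq_from_half_plane)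
    show "(\<lambda>s. zeta_num w s + zeta_num (w + a1 / 2) s + zeta_num (w + a2 / 2) s
      + zeta_num (w + (a1 + a2) / 2) s) holomorphic_on {s. Re s > -1}"
      by (intro holomorphic_intros w w')
    show "(\<lambda>s. 2 powr s * zeta_num (2 * w) s) holomorphic_on {s. Re s > -1}"
      by (intro holomorphic_intros w w') auto
    fix s :: complex assume s: "Re s > 2"
    have "2 powr s * zeta_num (2 * w) s
      = (s - 1) * (s - 2) * (2 powr s * zeta_series a1 a2 (2 * w) s)"
      using s w' by (simp add: zeta_num(2))
    thus "zeta_num w s + zeta_num (w + a1 / 2) s + zeta_num (w + a2 / 2) s
      + zeta_num (w + (a1 + a2) / 2) s = 2 powr s * zeta_num (2 * w) s"
      unfolding zeta_series_duplication[OF w s, symmetric]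
      using s w w' by (simp add: zeta_num(2) algebra_simps)
  qed auto
  show ?th1 using num[rule_format, of 0] w w' by (simp add: double_zeta_0 field_simps)
  let ?Z = "\<lambda>w. double_zeta a1 a2 w" and ?D = "\<lambda>w. deriv (double_zeta a1 a2 w) 0"
  have ev: "eventually (\<lambda>s. s \<in> {s::complex. Re s > -1} \<inter> {s. s \<noteq> 1 \<and> s \<noteq> 2}) (nhds 0)"
    by (intro eventually_nhds_in_open open_Int open_Re_gt open_Collect_conj open_Collect_neq
          continuous_intros) auto
  have ev2: "eventually (\<lambda>s. ?Z w s + ?Z (w + a1 / 2) s + ?Z (w + a2 / 2) s + ?Z (w + (a1 + a2) / 2) s
      = 2 powr s * ?Z (2 * w) s) (nhds 0)"
    using ev
  proof eventually_elim
    case (elim s)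
    thus ?case
      using num[rule_format, of s] w w' by (simp add: zeta_num(3) add_divide_distrib[symmetric])
  qed
  have d2: "((\<lambda>s. ?Z w s + ?Z (w + a1 / 2) s + ?Z (w + a2 / 2) s + ?Z (w + (a1 + a2) / 2) s)
     has_field_derivative ?D w + ?D (w + a1 / 2) + ?D (w + a2 / 2) + ?D (w + (a1 + a2) / 2)) (at 0)"
    by (intro DERIV_add double_zeta_has_derivative_0 w w')
  have "((\<lambda>s. 2 powr s * ?Z (2 * w) s)
     has_field_derivative ?D w + ?D (w + a1 / 2) + ?D (w + a2 / 2) + ?D (w + (a1 + a2) / 2)) (at 0)"
    by (rule iffD1[OF DERIV_cong_ev[OF refl ev2 refl] d2])
  moreover have "((\<lambda>s. 2 powr s * ?Z (2 * w) s)
     has_field_derivative 2 powr 0 * Ln 2 * ?Z (2 * w) 0 + ?D (2 * w) * 2 powr 0) (at 0)"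
    by (intro DERIV_mult double_zeta_has_derivative_0 w')
       (auto simp: powr_def intro!: derivative_eq_intros)
  ultimately have "?D w + ?D (w + a1 / 2) + ?D (w + a2 / 2) + ?D (w + (a1 + a2) / 2)
     = Ln 2 * ?Z (2 * w) 0 + ?D (2 * w)"
    using DERIV_unique by fastforce
  moreover have "Ln 2 = of_real (ln 2)"
    using Ln_of_real[of 2] by simp
  ultimately have "exp (?D w + ?D (w + a1 / 2) + ?D (w + a2 / 2) + ?D (w + (a1 + a2) / 2))
     = exp (of_real (ln 2) * ?Z (2 * w) 0 + ?D (2 * w))" by simp
  thus ?th2 by (simp add: double_Gamma_def exp_add)
qed

text \<open>
  The coefficients of the quadratic polynomial are found from the mixed difference (leading
  coefficient) and from the duplication formula (linear coefficient).
\<close>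

lemma double_zeta_0_eq:
  "\<exists>c0. \<forall>w. Re w > 0 \<longrightarrow>
     double_zeta a1 a2 w 0 = c0 - of_real ((a1 + a2) / (2 * a1 * a2)) * w + of_real (1 / (2 * a1 * a2)) * w\<^sup>2"
proof -
  obtain c0 c1 c2 where c: "\<And>w. Re w > 0 \<Longrightarrow> double_zeta a1 a2 w 0 = c0 + c1 * w + c2 * w\<^sup>2"
    using double_zeta_quadratic_0 by blast
  have "1 = c2 * (2 * of_real a1 * of_real a2)"
    using double_zeta_mixed_difference_0[of 1] a
    by (simp add: c power2_eq_square algebra_simps)
  hence c2: "c2 = of_real (1 / (2 * a1 * a2))"
    using a by (simp add: field_simps)
  \<comment> \<open>Inserting the quadratic polynomial into the duplication formula, the terms in
    \<open>w\<^sup>2\<close> cancel. What remains is affine in \<open>w\<close> with constant part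
    \<open>C\<close>, and its vanishing at \<open>w = 1\<close> and \<open>w = 2\<close> forces the
    slope to be 0.\<close>
  define C where "C = 3 * c0 + c1 * (a1 + a2) + c2 * (a1\<^sup>2 + a2\<^sup>2 + (a1 + a2)\<^sup>2) / 4"
  have C: "C + 2 * w * (c1 + c2 * (a1 + a2)) = 0" if "Re w > 0" for w
  proof -
    have "C + 2 * w * (c1 + c2 * (a1 + a2)) =
        (c0 + c1 * w + c2 * w\<^sup>2) + (c0 + c1 * (w + a1 / 2) + c2 * (w + a1 / 2)\<^sup>2)
        + (c0 + c1 * (w + a2 / 2) + c2 * (w + a2 / 2)\<^sup>2)
        + (c0 + c1 * (w + (a1 + a2) / 2) + c2 * (w + (a1 + a2) / 2)\<^sup>2)
        - (c0 + c1 * (2 * w) + c2 * (2 * w)\<^sup>2)"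
      by (simp add: C_def power2_eq_square field_simps)
    also have "\<dots> = double_zeta a1 a2 w 0 + double_zeta a1 a2 (w + a1 / 2) 0
        + double_zeta a1 a2 (w + a2 / 2) 0 + double_zeta a1 a2 (w + (a1 + a2) / 2) 0
        - double_zeta a1 a2 (2 * w) 0"
      using that a c[OF that] c[of "w + a1 / 2"] c[of "w + a2 / 2"] c[of "w + (a1 + a2) / 2"]
        c[of "2 * w"] by (simp add: add_pos_pos)
    also have "\<dots> = 0"
      using double_zeta_0_duplication[OF that] by simp
    finally show ?thesis .
  qed
  have "c1 + c2 * (a1 + a2) = 0"
    using C[of 1] C[of 2] by (simp add: eq_neg_iff_add_eq_0[symmetric])
  hence c1: "c1 = - of_real ((a1 + a2) / (2 * a1 * a2))"
    unfolding c2 by (simp add: add_eq_0_iff2 field_simps)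
  show ?thesis using c unfolding c1 c2 by auto
qed

end

section \<open>Mellin transforms of probability laws\<close>

lemma has_Mellin_transformD:
  assumes "has_Mellin_transform \<mu> S D \<phi>"
  shows "real_distribution \<mu>" "AE x in \<mu>. x \<in> S"
    and "q \<in> D \<Longrightarrow> integrable \<mu> (\<lambda>x. complex_of_real x powr q)"
    and "q \<in> D \<Longrightarrow> (LINT x|\<mu>. complex_of_real x powr q) = \<phi> q"
  using assms by (auto simp: has_Mellin_transform_def)

lemma has_Mellin_transform_mono:
  assumes "has_Mellin_transform \<mu> S D \<phi>" "S \<subseteq> S'" "D' \<subseteq> D" "\<And>q. q \<in> D' \<Longrightarrow> \<phi> q = \<phi>' q"
  shows "has_Mellin_transform \<mu> S' D' \<phi>'"
  using assms by (auto simp: has_Mellin_transform_def elim: AE_mp)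

lemma powr_complex_of_real_pos:
  "x > 0 \<Longrightarrow> complex_of_real x powr q = exp (q * of_real (ln x))"
  by (simp add: powr_def Ln_of_real)

lemma norm_powr_complex_of_real_pos:
  "x > 0 \<Longrightarrow> norm (complex_of_real x powr q) = x powr (Re q)"
  by (simp add: powr_complex_of_real_pos powr_def)

lemma has_Mellin_transform_char:
  assumes M: "has_Mellin_transform \<mu> S D \<phi>" and S: "S \<subseteq> {0<..}" and t: "\<i> * of_real t \<in> D"
  shows "char (distr \<mu> borel ln) t = \<phi> (\<i> * of_real t)"
proof -
  interpret real_distribution \<mu> by (rule has_Mellin_transformD(1)[OF M])
  have "char (distr \<mu> borel ln) t = (LINT x|\<mu>. iexp (t * ln x))"
    unfolding char_def by (subst integral_distr) auto
  also have "\<dots> = (LINT x|\<mu>. complex_of_real x powr (\<i> * of_real t))"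
  proof (rule integral_cong_AE)
    show "AE x in \<mu>. iexp (t * ln x) = complex_of_real x powr (\<i> * of_real t)"
      using has_Mellin_transformD(2)[OF M]
    proof eventually_elim
      case (elim x)
      hence "x > 0" using S by auto
      thus ?case by (simp add: powr_complex_of_real_pos mult_ac)
    qed
    show "(\<lambda>x. complex_of_real x powr (\<i> * of_real t)) \<in> borel_measurable \<mu>"
      using has_Mellin_transformD(3)[OF M t] by auto
  qed auto
  also have "\<dots> = \<phi> (\<i> * of_real t)" by (rule has_Mellin_transformD(4)[OF M t])
  finally show ?thesis .
qed

text \<open>On the imaginary axis the transform is the characteristic function of the law of
  \<open>ln\<close>, so Levy's theorem identifies these laws, and \<open>exp\<close> maps them back
  because the supports are positive. The two domains may differ, as the transform of a power is
  recorded on the imaginary axis alone.\<close>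

lemma has_Mellin_transform_unique:
  assumes M: "has_Mellin_transform \<mu> S D \<phi>" and N: "has_Mellin_transform \<nu> S' D' \<psi>"
    and S: "S \<subseteq> {0<..}" "S' \<subseteq> {0<..}"
    and t: "\<And>t. \<i> * of_real t \<in> D" "\<And>t. \<i> * of_real t \<in> D'"
    and eq: "\<And>t. \<phi> (\<i> * of_real t) = \<psi> (\<i> * of_real t)"
  shows "\<mu> = \<nu>"
proof -
  have rec: "distr (distr \<rho> borel ln) borel exp = \<rho>"
    if "has_Mellin_transform \<rho> R E F" "R \<subseteq> {0<..}" for \<rho> R E F
  proof -
    interpret real_distribution \<rho> by (rule has_Mellin_transformD(1)[OF that(1)])
    have "distr (distr \<rho> borel ln) borel exp = distr \<rho> borel (\<lambda>x. exp (ln x))"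
      by (subst distr_distr) (auto simp: o_def)
    also have "\<dots> = distr \<rho> borel (\<lambda>x. x)"
    proof (rule distr_cong_AE)
      show "AE x in \<rho>. exp (ln x) = x"
        using has_Mellin_transformD(2)[OF that(1)] by eventually_elim (use that(2) in auto)
    qed auto
    also have "\<dots> = \<rho>" by (rule distr_id2) simp
    finally show ?thesis .
  qed
  have "distr \<mu> borel ln = distr \<nu> borel ln"
  proof (rule Levy_uniqueness)
    interpret \<mu>: real_distribution \<mu> by (rule has_Mellin_transformD(1)[OF M])
    interpret \<nu>: real_distribution \<nu> by (rule has_Mellin_transformD(1)[OF N])
    show "real_distribution (distr \<mu> borel ln)" "real_distribution (distr \<nu> borel ln)"
      by (auto intro!: \<mu>.real_distribution_distr \<nu>.real_distribution_distr)
    show "char (distr \<mu> borel ln) = char (distr \<nu> borel ln)"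
      by (rule ext) (simp add: has_Mellin_transform_char[OF M S(1) t(1)]
            has_Mellin_transform_char[OF N S(2) t(2)] eq)
  qed
  thus ?thesis using rec[OF M S(1)] rec[OF N S(2)] by metis
qed

text \<open>Treats powers and reciprocals at once: both maps act on the Mellin transform by a
  substitution \<open>h\<close> in the variable.\<close>

lemma has_Mellin_transform_distr:
  assumes M: "has_Mellin_transform \<mu> S D \<phi>" and g: "g \<in> borel_measurable borel"
    and gS: "\<And>x. x \<in> S \<Longrightarrow> g x \<in> S'" and h: "\<And>q. q \<in> D' \<Longrightarrow> h q \<in> D"
    and eq: "\<And>x q. x \<in> S \<Longrightarrow> q \<in> D' \<Longrightarrow> complex_of_real (g x) powr q = complex_of_real x powr (h q)"
    and meas: "S' \<in> sets borel"
  shows "has_Mellin_transform (distr \<mu> borel g) S' D' (\<lambda>q. \<phi> (h q))"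
  unfolding has_Mellin_transform_def
proof (intro conjI ballI)
  interpret real_distribution \<mu> by (rule has_Mellin_transformD(1)[OF M])
  have gm [measurable]: "g \<in> borel_measurable \<mu>" using g by simp
  show "real_distribution (distr \<mu> borel g)" by (rule real_distribution_distr) simp
  show "AE x in distr \<mu> borel g. x \<in> S'"
    using has_Mellin_transformD(2)[OF M] meas by (subst AE_distr_iff) (auto elim!: eventually_mono intro: gS)
  fix q assume q: "q \<in> D'"
  have pm [measurable]: "(\<lambda>x. complex_of_real x powr q) \<in> borel_measurable borel"
    unfolding powr_def by measurable
  have ae: "AE x in \<mu>. complex_of_real (g x) powr q = complex_of_real x powr (h q)"
    using has_Mellin_transformD(2)[OF M] by eventually_elim (rule eq[OF _ q])
  have m2: "(\<lambda>x. complex_of_real x powr (h q)) \<in> borel_measurable \<mu>"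
    using has_Mellin_transformD(3)[OF M h[OF q]] by auto
  have m1: "(\<lambda>x. complex_of_real (g x) powr q) \<in> borel_measurable \<mu>"
    using measurable_compose[OF gm pm] .
  show "integrable (distr \<mu> borel g) (\<lambda>x. complex_of_real x powr q)"
    using has_Mellin_transformD(3)[OF M h[OF q]] integrable_cong_AE[OF m1 m2 ae]
    by (subst integrable_distr_eq) auto
  show "(LINT x|distr \<mu> borel g. complex_of_real x powr q) = \<phi> (h q)"
    using has_Mellin_transformD(4)[OF M h[OF q]] integral_cong_AE[OF m1 m2 ae]
    by (subst integral_distr) auto
qed

lemma has_Mellin_transform_power:
  assumes "has_Mellin_transform \<mu> S D \<phi>" "S \<subseteq> {0<..}" "\<And>q. q \<in> D' \<Longrightarrow> of_real p * q \<in> D"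
  shows "has_Mellin_transform (power_law \<mu> p) {0<..} D' (\<lambda>q. \<phi> (of_real p * q))"
  unfolding power_law_def
proof (rule has_Mellin_transform_distr[OF assms(1) _ _ assms(3)])
  fix x q assume "x \<in> S"
  hence "x > 0" using assms(2) by auto
  thus "complex_of_real (x powr p) powr q = complex_of_real x powr (of_real p * q)"
    by (simp add: powr_complex_of_real_pos ln_powr mult_ac)
qed (use assms(2) in auto)

lemma has_Mellin_transform_recip:
  assumes "has_Mellin_transform \<mu> S D \<phi>" "S \<subseteq> {0<..}" "\<And>q. q \<in> D' \<Longrightarrow> - q \<in> D"
  shows "has_Mellin_transform (recip_law \<mu>) {0<..} D' (\<lambda>q. \<phi> (- q))"
  unfolding recip_law_def
proof (rule has_Mellin_transform_distr[OF assms(1) _ _ assms(3)])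
  fix x q assume "x \<in> S"
  hence "x > 0" using assms(2) by auto
  thus "complex_of_real (1 / x) powr q = complex_of_real x powr (- q)"
    using powr_complex_of_real_pos[of "1 / x" q] by (simp add: powr_complex_of_real_pos ln_div)
qed (use assms(2) in auto)

text \<open>Realised by a product of independent variables on the product measure, where Fubini
  multiplies the transforms. It assembles \<open>M_law\<close> from its four factors.\<close>

lemma has_Mellin_transform_mult:
  assumes M: "has_Mellin_transform \<mu> {0<..} D \<phi>" and N: "has_Mellin_transform \<nu> {0<..} D \<psi>"
  shows "\<exists>\<rho>. has_Mellin_transform \<rho> {0<..} D (\<lambda>q. \<phi> q * \<psi> q)"
proof -
  interpret \<mu>: real_distribution \<mu> by (rule has_Mellin_transformD(1)[OF M])
  interpret \<nu>: real_distribution \<nu> by (rule has_Mellin_transformD(1)[OF N])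
  interpret P: pair_prob_space \<mu> \<nu> ..
  define \<rho> where "\<rho> = distr (\<mu> \<Otimes>\<^sub>M \<nu>) borel (\<lambda>(x, y). x * y)"
  have "has_Mellin_transform \<rho> {0<..} D (\<lambda>q. \<phi> q * \<psi> q)"
    unfolding has_Mellin_transform_def
  proof (intro conjI ballI)
    have [measurable]: "(\<lambda>(x, y). x * y) \<in> borel_measurable (\<mu> \<Otimes>\<^sub>M \<nu>)" by measurable
    show "real_distribution \<rho>"
      unfolding \<rho>_def by (rule P.real_distribution_distr) simp
    have ae: "AE z in \<mu> \<Otimes>\<^sub>M \<nu>. fst z > 0 \<and> snd z > 0"
    proof (rule P.AE_pair_measure)
      show "{z \<in> space (\<mu> \<Otimes>\<^sub>M \<nu>). fst z > 0 \<and> snd z > 0} \<in> sets (\<mu> \<Otimes>\<^sub>M \<nu>)" by measurable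
      show "AE x in \<mu>. AE y in \<nu>. fst (x, y) > 0 \<and> snd (x, y) > 0"
        using has_Mellin_transformD(2)[OF M]
      proof eventually_elim
        case (elim x)
        show ?case using has_Mellin_transformD(2)[OF N] by eventually_elim (use elim in auto)
      qed
    qed
    have "AE z in \<mu> \<Otimes>\<^sub>M \<nu>. (case z of (x, y) \<Rightarrow> x * y) \<in> {0<..}"
      using ae by eventually_elim (auto simp: case_prod_unfold)
    thus "AE x in \<rho>. x \<in> {0<..}"
      unfolding \<rho>_def by (subst AE_distr_iff) auto
    fix q assume q: "q \<in> D"
    have pm [measurable]: "(\<lambda>x. complex_of_real x powr q) \<in> borel_measurable borel"
      unfolding powr_def by measurable
    let ?f = "\<lambda>x. complex_of_real x powr q"
    have i: "integrable \<mu> ?f" "integrable \<nu> ?f"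
      using has_Mellin_transformD(3)[OF M q] has_Mellin_transformD(3)[OF N q] by auto
    have ipair: "integrable (\<mu> \<Otimes>\<^sub>M \<nu>) (\<lambda>(x, y). ?f x * ?f y)"
    proof (rule P.Fubini_integrable)
      show "(\<lambda>(x, y). ?f x * ?f y) \<in> borel_measurable (\<mu> \<Otimes>\<^sub>M \<nu>)" by measurable
      show "integrable \<mu> (\<lambda>x. LINT y|\<nu>. norm (case (x, y) of (x, y) \<Rightarrow> ?f x * ?f y))"
        using i by (simp add: norm_mult)
      show "AE x in \<mu>. integrable \<nu> (\<lambda>y. case (x, y) of (x, y) \<Rightarrow> ?f x * ?f y)"
        using i by auto
    qed
    have val: "(LINT z|(\<mu> \<Otimes>\<^sub>M \<nu>). (case z of (x, y) \<Rightarrow> ?f x * ?f y)) = \<phi> q * \<psi> q"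
      using P.integral_fst'[OF ipair] has_Mellin_transformD(4)[OF M q] has_Mellin_transformD(4)[OF N q]
      by simp
    have ae2: "AE z in \<mu> \<Otimes>\<^sub>M \<nu>. ?f (case z of (x, y) \<Rightarrow> x * y) = (case z of (x, y) \<Rightarrow> ?f x * ?f y)"
      using ae
    proof eventually_elim
      case (elim z)
      thus ?case
        using powr_complex_of_real_pos[of "fst z * snd z" q]
        by (simp add: case_prod_unfold powr_complex_of_real_pos ln_mult exp_add[symmetric] distrib_left)
    qed
    have m: "(\<lambda>z. ?f (case z of (x, y) \<Rightarrow> x * y)) \<in> borel_measurable (\<mu> \<Otimes>\<^sub>M \<nu>)"
      "(\<lambda>z. case z of (x, y) \<Rightarrow> ?f x * ?f y) \<in> borel_measurable (\<mu> \<Otimes>\<^sub>M \<nu>)" by measurable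
    show "integrable \<rho> ?f"
      unfolding \<rho>_def using ipair integrable_cong_AE[OF m ae2] by (subst integrable_distr_eq) auto
    show "(LINT x|\<rho>. ?f x) = \<phi> q * \<psi> q"
      unfolding \<rho>_def using val integral_cong_AE[OF m ae2] by (subst integral_distr) auto
  qed
  thus ?thesis by blast
qed

section \<open>Normal and lognormal laws\<close>

lemma distr_normal_density_affine:
  assumes "\<sigma> > 0" "\<alpha> \<noteq> 0"
  shows "distr (density lborel (normal_density \<mu> \<sigma>)) lborel (\<lambda>x. \<beta> + \<alpha> * x)
     = density lborel (normal_density (\<beta> + \<alpha> * \<mu>) (\<bar>\<alpha>\<bar> * \<sigma>))"
proof -
  interpret prob_space "density lborel (normal_density \<mu> \<sigma>)"
    by (rule prob_space_normal_density) fact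
  have "distributed (density lborel (normal_density \<mu> \<sigma>)) lborel (\<lambda>x. x) (normal_density \<mu> \<sigma>)"
    unfolding distributed_def by (auto simp: distr_id2)
  from normal_density_affine[OF this assms, of \<beta>] show ?thesis
    by (simp add: distributed_def)
qed

lemma
  assumes \<sigma>: "\<sigma> > 0"
  shows integrable_normal_iexp: "integrable lborel (\<lambda>x. normal_density m \<sigma> x *\<^sub>R iexp (b * x))"
    and integral_normal_iexp: "(LINT x|lborel. normal_density m \<sigma> x *\<^sub>R iexp (b * x))
      = exp (\<i> * of_real (b * m) - of_real (b\<^sup>2 * \<sigma>\<^sup>2 / 2))"
proof -
  let ?M = "density lborel (normal_density m \<sigma>)"
  interpret prob_space ?M by (rule prob_space_normal_density[OF \<sigma>])
  have "integrable ?M (\<lambda>x. iexp (b * x))"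
    by (rule integrable_const_bound[of _ 1]) auto
  thus "integrable lborel (\<lambda>x. normal_density m \<sigma> x *\<^sub>R iexp (b * x))"
    by (subst (asm) integrable_density) auto
  have M: "?M = distr std_normal_distribution lborel (\<lambda>x. m + \<sigma> * x)"
    using distr_normal_density_affine[of 1 \<sigma> 0 m] \<sigma> by simp
  have "(LINT x|lborel. normal_density m \<sigma> x *\<^sub>R iexp (b * x)) = (LINT x|?M. iexp (b * x))"
    by (subst integral_density) auto
  also have "\<dots> = (LINT x|std_normal_distribution. iexp (b * (m + \<sigma> * x)))"
    unfolding M by (subst integral_distr) auto
  also have "\<dots> = (LINT x|std_normal_distribution. iexp (b * m) * iexp ((b * \<sigma>) * x))"
    by (intro Bochner_Integration.integral_cong refl) (simp add: exp_add[symmetric] algebra_simps)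
  also have "\<dots> = iexp (b * m) * char std_normal_distribution (b * \<sigma>)"
    by (simp add: char_def)
  also have "\<dots> = exp (\<i> * of_real (b * m) - of_real (b\<^sup>2 * \<sigma>\<^sup>2 / 2))"
    by (simp only: char_std_normal_distribution exp_of_real[symmetric] exp_add[symmetric])
       (simp add: power_mult_distrib)
  finally show "(LINT x|lborel. normal_density m \<sigma> x *\<^sub>R iexp (b * x))
      = exp (\<i> * of_real (b * m) - of_real (b\<^sup>2 * \<sigma>\<^sup>2 / 2))" .
qed

text \<open>The real part of \<open>q\<close> tilts the density: completing the square makes
  \<open>normal_density \<kappa> \<sigma> x * exp (Re q * x)\<close> a constant multiple of a normal
  density with shifted mean. The imaginary part then gives a characteristic function.\<close>

lemma has_Mellin_transform_lognormal:
  fixes \<kappa> \<sigma> :: real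
  assumes \<sigma>: "\<sigma> > 0"
  shows "has_Mellin_transform (distr (density lborel (normal_density \<kappa> \<sigma>)) borel exp) {0<..} UNIV
     (\<lambda>q. exp (of_real \<kappa> * q + of_real (\<sigma>\<^sup>2 / 2) * q\<^sup>2))"
  unfolding has_Mellin_transform_def
proof (intro conjI ballI)
  let ?N = "density lborel (normal_density \<kappa> \<sigma>)"
  interpret N: prob_space ?N by (rule prob_space_normal_density[OF \<sigma>])
  show "real_distribution (distr ?N borel exp)"
    by (rule N.real_distribution_distr) simp
  show "AE x in distr ?N borel exp. x \<in> {0<..}"
    by (subst AE_distr_iff) auto
  fix q :: complex
  define a b where "a = Re q" and "b = Im q"
  have pm [measurable]: "(\<lambda>x. complex_of_real x powr q) \<in> borel_measurable borel"
    unfolding powr_def by measurable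
  have em: "(\<lambda>x. complex_of_real (exp x) powr q) \<in> borel_measurable borel"
    by (rule measurable_compose[OF _ pm]) measurable
  define m where "m = \<kappa> + a * \<sigma>\<^sup>2"
  define C where "C = exp (a * \<kappa> + a\<^sup>2 * \<sigma>\<^sup>2 / 2)"
  have shift: "normal_density \<kappa> \<sigma> x * exp (a * x) = C * normal_density m \<sigma> x" for x
  proof -
    have "- (x - \<kappa>)\<^sup>2 / (2 * \<sigma>\<^sup>2) + a * x = a * \<kappa> + a\<^sup>2 * \<sigma>\<^sup>2 / 2 + - (x - m)\<^sup>2 / (2 * \<sigma>\<^sup>2)"
      using \<sigma> by (simp add: m_def field_simps power2_eq_square)
    hence "exp (- (x - \<kappa>)\<^sup>2 / (2 * \<sigma>\<^sup>2)) * exp (a * x) = C * exp (- (x - m)\<^sup>2 / (2 * \<sigma>\<^sup>2))"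
      unfolding C_def exp_add[symmetric] by simp
    thus ?thesis by (simp add: normal_density_def)
  qed
  note chr = integrable_normal_iexp[OF \<sigma>, of m b] integral_normal_iexp[OF \<sigma>, of m b]
  have pt: "normal_density \<kappa> \<sigma> x *\<^sub>R (complex_of_real (exp x) powr q)
      = of_real C * (normal_density m \<sigma> x *\<^sub>R iexp (b * x))" for x
  proof -
    have "complex_of_real (exp x) powr q = of_real (exp (a * x)) * iexp (b * x)"
    proof -
      have "q * of_real x = of_real (a * x) + \<i> * of_real (b * x)"
        by (simp add: a_def b_def complex_eq_iff)
      moreover have "complex_of_real (exp x) powr q = exp (q * of_real x)"
        by (subst powr_complex_of_real_pos) auto
      ultimately show ?thesis by (simp only: exp_add exp_of_real)
    qed
    hence "normal_density \<kappa> \<sigma> x *\<^sub>R (complex_of_real (exp x) powr q)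
        = of_real (normal_density \<kappa> \<sigma> x * exp (a * x)) * iexp (b * x)"
      by (simp add: scaleR_conv_of_real)
    thus ?thesis unfolding shift by (simp add: scaleR_conv_of_real)
  qed
  have val: "of_real C * exp (\<i> * of_real (b * m) - of_real (b\<^sup>2 * \<sigma>\<^sup>2 / 2)) = exp (of_real \<kappa> * q + of_real (\<sigma>\<^sup>2 / 2) * q\<^sup>2)"
  proof -
    have "q = of_real a + \<i> * of_real b" by (simp add: a_def b_def complex_eq_iff)
    hence "of_real (a * \<kappa> + a\<^sup>2 * \<sigma>\<^sup>2 / 2) + (\<i> * of_real (b * m) - of_real (b\<^sup>2 * \<sigma>\<^sup>2 / 2))
        = of_real \<kappa> * q + of_real (\<sigma>\<^sup>2 / 2) * q\<^sup>2"
      by (simp add: m_def power2_eq_square field_simps)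
    thus ?thesis unfolding C_def exp_of_real[symmetric] exp_add[symmetric] by simp
  qed
  have "integrable lborel (\<lambda>x. normal_density \<kappa> \<sigma> x *\<^sub>R (complex_of_real (exp x) powr q))"
    unfolding pt by (intro integrable_mult_right chr(1))
  hence "integrable ?N (\<lambda>x. complex_of_real (exp x) powr q)"
    by (rule iffD2[OF integrable_density, rotated 3]) (use em in auto)
  thus "integrable (distr ?N borel exp) (\<lambda>x. complex_of_real x powr q)"
    by (rule iffD2[OF integrable_distr_eq, rotated 2]) auto
  have "(LINT x|distr ?N borel exp. complex_of_real x powr q) = (LINT x|?N. complex_of_real (exp x) powr q)"
    by (rule integral_distr) auto
  also have "\<dots> = (LINT x|lborel. normal_density \<kappa> \<sigma> x *\<^sub>R (complex_of_real (exp x) powr q))"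
    by (rule integral_density) (use em in auto)
  also have "\<dots> = exp (of_real \<kappa> * q + of_real (\<sigma>\<^sup>2 / 2) * q\<^sup>2)"
    unfolding pt val[symmetric] chr(2)[symmetric] by (rule integral_mult_right_zero)
  finally show "(LINT x|distr ?N borel exp. complex_of_real x powr q)
      = exp (of_real \<kappa> * q + of_real (\<sigma>\<^sup>2 / 2) * q\<^sup>2)" .
qed

section \<open>Infinite products of independent variables\<close>

lemma integrable_exp_halfline:
  fixes z :: complex
  assumes z: "Re z > 0"
  shows "integrable lborel (\<lambda>t. indicator {0<..} t *\<^sub>R exp (- (z * of_real t)))"
proof (rule Bochner_Integration.integrable_bound)
  have "(\<lambda>t. exp (- (Re z * t))) integrable_on {0..}"
    using has_integral_exp_minus_to_infinity[of "Re z" 0] z by (auto simp: integrable_on_def)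
  hence "(\<lambda>t. exp (- (Re z * t))) absolutely_integrable_on {0..}"
    by (intro nonnegative_absolutely_integrable_1) auto
  hence "integrable lebesgue (\<lambda>t. indicator {0..} t *\<^sub>R exp (- (Re z * t)))"
    by (simp only: set_integrable_def)
  thus "integrable lborel (\<lambda>t. indicator {0..} t *\<^sub>R exp (- (Re z * t)))"
    by (subst (asm) integrable_completion) auto
qed (auto simp: indicator_def)

lemma integral_exp_halfline:
  fixes z :: complex
  assumes z: "Re z > 0"
  shows "(LINT t|lborel. indicator {0<..} t *\<^sub>R exp (- (z * of_real t))) = 1 / z"
proof -
  have z0: "z \<noteq> 0" using z by auto
  let ?F = "\<lambda>t. - exp (- (z * of_real t)) / z"
  have e: "einterval 0 \<infinity> = {0::real<..}"
    by (auto simp: einterval_def zero_ereal_def)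
  have "(LBINT t=0..\<infinity>. exp (- (z * complex_of_real t))) = 0 - ?F 0"
  proof (rule interval_integral_FTC_integrable)
    fix t :: real
    show "(?F has_vector_derivative exp (- (z * complex_of_real t))) (at t)"
      using z0 by (intro has_vector_derivative_real_field[of "\<lambda>w. - exp (- (z * w)) / z"])
        (auto intro!: derivative_eq_intros)
    show "isCont (\<lambda>t. exp (- (z * complex_of_real t))) t"
      by (intro continuous_intros)
  next
    show "set_integrable lborel (einterval 0 \<infinity>) (\<lambda>t. exp (- (z * complex_of_real t)))"
      using integrable_exp_halfline[OF z] by (simp add: e set_integrable_def)
    have "(?F \<longlongrightarrow> ?F 0) (at_right 0)"
      using z0 by (intro tendsto_intros) auto
    thus "((?F \<circ> real_of_ereal) \<longlongrightarrow> ?F 0) (at_right 0)"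
      by (simp add: zero_ereal_def ereal_tendsto_simps)
    have "((\<lambda>t. exp (- (Re z * t)) / norm z) \<longlongrightarrow> 0 / norm z) at_top"
    proof (intro tendsto_divide tendsto_const)
      have "filterlim (\<lambda>t. Re z * t) at_top at_top"
        using z by (intro filterlim_tendsto_pos_mult_at_top[OF tendsto_const]) (auto simp: filterlim_ident)
      thus "((\<lambda>t. exp (- (Re z * t))) \<longlongrightarrow> 0) at_top"
        by (intro filterlim_compose[OF exp_at_bot]) (simp add: filterlim_uminus_at_bot)
    qed (use z0 in auto)
    hence "(?F \<longlongrightarrow> 0) at_top"
      by (subst tendsto_norm_zero_iff[symmetric]) (simp add: norm_divide)
    thus "((?F \<circ> real_of_ereal) \<longlongrightarrow> 0) (at_left \<infinity>)"
      by (simp add: ereal_tendsto_simps)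
  qed auto
  thus ?thesis
    by (simp add: interval_lebesgue_integral_def set_lebesgue_integral_def e)
qed

text \<open>The contribution of one lattice point, \<open>c\<close> being \<open>b0\<close> plus the
  lattice value: each quotient of \<Gamma> values is replaced by the inverse quotient of linear
  factors.\<close>

definition beta_factor :: "real \<Rightarrow> real \<Rightarrow> real \<Rightarrow> complex \<Rightarrow> complex" where
  "beta_factor c b1 b2 q = of_real c / (q + of_real c) * ((q + of_real (c + b1)) / of_real (c + b1))
     * ((q + of_real (c + b2)) / of_real (c + b2))
     * (of_real (c + b1 + b2) / (q + of_real (c + b1 + b2)))"

text \<open>The sign condition covers both admissible families at once, positive \<open>b1\<close>,
  \<open>b2\<close> and equal \<open>b1\<close>, \<open>b2\<close> of either sign.\<close>

definition beta_params :: "real \<Rightarrow> real \<Rightarrow> real \<Rightarrow> bool" where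
  "beta_params c b1 b2 \<longleftrightarrow> c > 0 \<and> c + b1 > 0 \<and> c + b2 > 0 \<and> c + b1 + b2 > 0 \<and> b1 * b2 \<ge> 0"

text \<open>
  The law is the image of a density on the line under \<open>t \<mapsto> exp (- max 0 t)\<close>: the mass on
  \<open>(-1, 0)\<close> becomes an atom at 1.
\<close>

lemma beta_factor_Mellin:
  assumes b: "beta_params c b1 b2"
  shows "\<exists>\<mu>. has_Mellin_transform \<mu> {0<..1} {q. Re q > - min c (c + b1 + b2)} (beta_factor c b1 b2)"
proof -
  define B where "B = b1 + b2"
  \<comment> \<open>\<open>p\<close> is the limit of \<open>beta_factor\<close> as \<open>q\<close>
    tends to infinity, hence the mass at 1. The rest is \<open>p * b1 * b2\<close> divided by the
    product of \<open>q + c\<close> and \<open>q + c + B\<close>; its partial fractions give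
    \<alpha> and two exponential densities.\<close>
  define p where "p = c * (c + B) / ((c + b1) * (c + b2))"
  define \<alpha> where "\<alpha> = p * b1 * b2 / B"
  define D where "D = {q. Re q > - min c (c + b1 + b2)}"
  have pos: "c > 0" "c + b1 > 0" "c + b2 > 0" "c + B > 0" "b1 * b2 \<ge> 0"
    using b by (auto simp: beta_params_def B_def)
  have p: "p > 0" using pos by (simp add: p_def)
  \<comment> \<open>For \<open>B = 0\<close> division by zero makes \<alpha> equal to 0. This is the
    right value, because \<open>b1\<close> and \<open>b2\<close> then vanish and the law is the
    point mass at 1.\<close>
  have B0: "b1 = 0 \<and> b2 = 0" if "B = 0"
  proof -
    have "b2 = - b1" using that by (simp add: B_def)
    hence "b1 * b1 \<le> 0" using pos(5) by simp
    hence "b1\<^sup>2 \<le> 0" by (simp add: power2_eq_square)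
    thus ?thesis using \<open>b2 = - b1\<close> by simp
  qed
  define f where "f = (\<lambda>t. p * indicator {-1<..<0} t
      + \<alpha> * (indicator {0<..} t * (exp (- (c * t)) - exp (- ((c + B) * t)))) :: real)"
  define g where "g = (\<lambda>t::real. exp (- max 0 t))"
  \<comment> \<open>By \<open>b1 * b2 \<ge> 0\<close>, \<alpha> has the sign of \<open>B\<close>,
    and so does the difference of the exponentials; their product is nonnegative.\<close>
  have f_nonneg: "f t \<ge> 0" for t
  proof -
    have "\<alpha> * (exp (- (c * t)) - exp (- ((c + B) * t))) \<ge> 0" if "t > 0"
    proof (cases "B \<ge> 0")
      case True
      hence "\<alpha> \<ge> 0" using pos p by (simp add: \<alpha>_def mult.assoc)
      moreover have "exp (- (c * t)) \<ge> exp (- ((c + B) * t))"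
        using True that by (simp add: algebra_simps)
      ultimately show ?thesis by simp
    next
      case False
      hence "\<alpha> \<le> 0" using pos p by (simp add: \<alpha>_def mult.assoc divide_nonneg_neg)
      moreover have "exp (- (c * t)) \<le> exp (- ((c + B) * t))"
        using False that by (simp add: algebra_simps mult_nonpos_nonneg)
      ultimately show ?thesis by (simp add: mult_nonpos_nonpos)
    qed
    thus ?thesis using p by (simp add: f_def indicator_def)
  qed
  have f_meas [measurable]: "f \<in> borel_measurable borel" unfolding f_def by measurable
  have g_meas [measurable]: "g \<in> borel_measurable borel" unfolding g_def by measurable
  have fg: "f t *\<^sub>R (complex_of_real (g t) powr q)
      = of_real p * of_real (indicator {-1<..<0} t)
        + of_real \<alpha> * (indicator {0<..} t *\<^sub>R exp (- ((q + of_real c) * of_real t))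
          - indicator {0<..} t *\<^sub>R exp (- ((q + of_real (c + B)) * of_real t)))" for q t
  proof (cases "t > 0")
    case True
    have g: "complex_of_real (g t) powr q = exp (- (q * of_real t))"
      using True by (subst powr_complex_of_real_pos) (auto simp: g_def)
    have e: "exp (- ((q + of_real x) * of_real t)) = of_real (exp (- (x * t))) * exp (- (q * of_real t))"
      for x
      by (simp only: exp_of_real[symmetric] exp_add[symmetric]) (simp add: algebra_simps)
    show ?thesis using True unfolding g e
      by (simp add: f_def scaleR_conv_of_real algebra_simps)
  next
    case False
    hence "complex_of_real (g t) powr q = 1" by (simp add: g_def)
    thus ?thesis using False by (simp add: f_def scaleR_conv_of_real)
  qed
  have ind: "integrable lborel (\<lambda>t::real. complex_of_real (indicator {-1<..<0} t))"
    "(LINT t::real|lborel. complex_of_real (indicator {-1<..<0} t)) = 1"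
    by simp_all
  have rq: "Re (q + of_real c) > 0" "Re (q + of_real (c + B)) > 0" if "q \<in> D" for q
    using that by (auto simp: D_def B_def)
  have int: "integrable lborel (\<lambda>t. f t *\<^sub>R (complex_of_real (g t) powr q))" if "q \<in> D" for q
    unfolding fg using rq[OF that] ind
    by (intro Bochner_Integration.integrable_add Bochner_Integration.integrable_diff
         integrable_mult_right integrable_exp_halfline)
  have val: "(LINT t|lborel. f t *\<^sub>R (complex_of_real (g t) powr q)) = beta_factor c b1 b2 q"
    if "q \<in> D" for q
  proof -
    have "(LINT t|lborel. f t *\<^sub>R (complex_of_real (g t) powr q))
      = of_real p * 1 + of_real \<alpha> * (1 / (q + of_real c) - 1 / (q + of_real (c + B)))"
      unfolding fg using rq[OF that] ind
      by (subst Bochner_Integration.integral_add)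
         (auto intro!: Bochner_Integration.integrable_diff integrable_mult_right integrable_exp_halfline
            simp: Bochner_Integration.integral_diff integrable_exp_halfline integral_exp_halfline)
    also have "\<dots> = beta_factor c b1 b2 q"
    proof -
      define x where "x = q + of_real c"
      define y where "y = q + of_real (c + B)"
      have "Re x > 0" "Re y > 0" using rq[OF that] by (simp_all add: x_def y_def)
      hence xy: "x \<noteq> 0" "y \<noteq> 0" by auto
      have "of_real \<alpha> * (1 / x - 1 / y) = of_real (\<alpha> * B) / (x * y)"
        using xy by (simp add: x_def y_def field_simps)
      also have "\<alpha> * B = p * (b1 * b2)" using B0 by (auto simp: \<alpha>_def)
      finally have "of_real p * 1 + of_real \<alpha> * (1 / x - 1 / y)
          = of_real p * ((x * y + of_real (b1 * b2)) / (x * y))"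
        using xy by (simp add: field_simps)
      also have "x * y + of_real (b1 * b2) = (q + of_real (c + b1)) * (q + of_real (c + b2))"
        by (simp add: x_def y_def B_def algebra_simps)
      also have "of_real p * ((q + of_real (c + b1)) * (q + of_real (c + b2)) / (x * y)) = beta_factor c b1 b2 q"
        by (simp add: beta_factor_def p_def x_def y_def B_def add.assoc mult_ac)
      finally show ?thesis unfolding x_def y_def .
    qed
    finally show ?thesis .
  qed
  have D0: "0 \<in> D" using pos by (simp add: D_def B_def)
  have "integrable lborel (\<lambda>t. complex_of_real (f t))"
    using int[OF D0] by (simp add: scaleR_conv_of_real g_def)
  hence fi: "integrable lborel f" by (simp add: complex_of_real_integrable_eq)
  have "complex_of_real (LINT t|lborel. f t) = (LINT t|lborel. complex_of_real (f t))"
    by simp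
  also have "\<dots> = beta_factor c b1 b2 0"
    using val[OF D0] by (simp add: scaleR_conv_of_real g_def)
  also have "\<dots> = 1" using pos by (simp add: beta_factor_def B_def flip: of_real_add)
  finally have f1: "(LINT t|lborel. f t) = 1" by (simp only: of_real_eq_1_iff)
  have "emeasure (density lborel f) UNIV = 1"
    using f1 fi f_nonneg by (simp add: emeasure_density nn_integral_eq_integral)
  then interpret N: prob_space "density lborel f" by (intro prob_spaceI) simp
  have "has_Mellin_transform (distr (density lborel f) borel g) {0<..1} D (beta_factor c b1 b2)"
    unfolding has_Mellin_transform_def
  proof (intro conjI ballI)
    show "real_distribution (distr (density lborel f) borel g)"
      by (rule N.real_distribution_distr) simp
    show "AE x in distr (density lborel f) borel g. x \<in> {0<..1}"
      by (subst AE_distr_iff) (auto simp: g_def)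
    fix q assume q: "q \<in> D"
    have pm [measurable]: "(\<lambda>x. complex_of_real x powr q) \<in> borel_measurable borel"
      unfolding powr_def by measurable
    have em: "(\<lambda>t. complex_of_real (g t) powr q) \<in> borel_measurable borel"
      by (rule measurable_compose[OF g_meas pm])
    have "integrable (density lborel f) (\<lambda>t. complex_of_real (g t) powr q)"
      by (rule iffD2[OF integrable_density, rotated 3, OF int[OF q]]) (use em f_nonneg in auto)
    thus "integrable (distr (density lborel f) borel g) (\<lambda>x. complex_of_real x powr q)"
      by (rule iffD2[OF integrable_distr_eq, rotated 2]) auto
    have "(LINT x|distr (density lborel f) borel g. complex_of_real x powr q)
        = (LINT t|density lborel f. complex_of_real (g t) powr q)"
      by (rule integral_distr) auto
    also have "\<dots> = (LINT t|lborel. f t *\<^sub>R (complex_of_real (g t) powr q))"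
      by (rule integral_density) (use em f_nonneg in auto)
    finally show "(LINT x|distr (density lborel f) borel g. complex_of_real x powr q) = beta_factor c b1 b2 q"
      unfolding val[OF q] .
  qed
  thus ?thesis unfolding D_def by blast
qed

text \<open>Only the first \<open>n\<close> coordinates enter, so the infinite product measure is
  projected to the finite one, where integrals of products factor.\<close>

lemma
  fixes \<mu> :: "nat \<Rightarrow> real measure" and f :: "nat \<Rightarrow> real \<Rightarrow> complex"
  assumes \<mu>: "\<And>i. prob_space (\<mu> i)" and f: "\<And>i. integrable (\<mu> i) (f i)"
  shows integrable_PiM_prod: "integrable (PiM UNIV \<mu>) (\<lambda>\<omega>. \<Prod>i<n. f i (\<omega> i))" (is ?th1)
    and integral_PiM_prod:
      "(LINT \<omega>|PiM UNIV \<mu>. (\<Prod>i<n. f i (\<omega> i))) = (\<Prod>i<n. LINT x|\<mu> i. f i x)" (is ?th2)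
proof -
  interpret product_prob_space \<mu> UNIV by (rule product_prob_spaceI) (rule \<mu>)
  have D: "distr (PiM UNIV \<mu>) (PiM {..<n} \<mu>) (\<lambda>x. restrict x {..<n}) = PiM {..<n} \<mu>"
    by (rule distr_PiM_restrict_finite) auto
  have r: "(\<lambda>x. restrict x {..<n}) \<in> measurable (PiM UNIV \<mu>) (PiM {..<n} \<mu>)"
    by (rule measurable_restrict_subset) simp
  have [measurable]: "f i \<in> borel_measurable (\<mu> i)" for i using f by auto
  have m: "(\<lambda>x. \<Prod>i<n. f i (x i)) \<in> borel_measurable (PiM {..<n} \<mu>)" by measurable
  have "integrable (PiM {..<n} \<mu>) (\<lambda>x. \<Prod>i<n. f i (x i))"
    by (rule product_integrable_prod) (auto intro: f)
  hence "integrable (distr (PiM UNIV \<mu>) (PiM {..<n} \<mu>) (\<lambda>x. restrict x {..<n})) (\<lambda>x. \<Prod>i<n. f i (x i))"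
    by (simp only: D)
  thus ?th1 by (subst (asm) integrable_distr_eq[OF r m]) simp
  have "(\<Prod>i<n. LINT x|\<mu> i. f i x) = (LINT x|PiM {..<n} \<mu>. (\<Prod>i<n. f i (x i)))"
    by (rule product_integral_prod[symmetric]) (auto intro: f)
  also have "\<dots> = (LINT x|distr (PiM UNIV \<mu>) (PiM {..<n} \<mu>) (\<lambda>x. restrict x {..<n}). (\<Prod>i<n. f i (x i)))"
    by (simp only: D)
  also have "\<dots> = (LINT \<omega>|PiM UNIV \<mu>. (\<Prod>i<n. f i (\<omega> i)))"
    by (subst integral_distr[OF r m]) simp
  finally show ?th2 by simp
qed

lemma powr_mult_of_real_pos:
  fixes x y :: real
  assumes "x > 0" "y > 0"
  shows "complex_of_real (x * y) powr q = complex_of_real x powr q * complex_of_real y powr q"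
  using assms unfolding powr_complex_of_real_pos[OF assms(1)] powr_complex_of_real_pos[OF assms(2)]
      powr_complex_of_real_pos[OF mult_pos_pos[OF assms]]
  by (simp add: ln_mult exp_add[symmetric] distrib_left)

lemma powr_prod_of_real_pos:
  fixes x :: "nat \<Rightarrow> real"
  assumes "\<And>i. x i > 0"
  shows "complex_of_real (\<Prod>i<n. x i) powr q = (\<Prod>i<n. complex_of_real (x i) powr q)"
proof (induction n)
  case (Suc n)
  have pos: "(\<Prod>i<n. x i) > 0" using assms by (intro prod_pos) auto
  have "complex_of_real ((\<Prod>i<n. x i) * x n) powr q
      = complex_of_real (\<Prod>i<n. x i) powr q * complex_of_real (x n) powr q"
    by (rule powr_mult_of_real_pos[OF pos assms])
  thus ?case using Suc by simp
qed simp

text \<open>Partial products of variables in (0,1] decrease and so converge; the limit 0 has to be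
  excluded. Convergence of the transforms at \<open>q = - r\<close> bounds the moments of order
  \<open>- r\<close>, and monotone convergence makes the supremum of the inverse powers integrable.
  This supremum keeps the limit positive and also dominates the powers, so the transforms pass to
  the limit.\<close>

lemma has_Mellin_transform_infinite_product:
  fixes \<mu> :: "nat \<Rightarrow> real measure" and m :: real
  assumes m: "m > 0"
    and M: "\<And>i. has_Mellin_transform (\<mu> i) {0<..1} {q. Re q > - m} (R i)"
    and lim: "\<And>q. Re q > - m \<Longrightarrow> (\<lambda>n. \<Prod>i<n. R i q) \<longlonglongrightarrow> \<phi> q"
  shows "\<exists>\<nu>. has_Mellin_transform \<nu> {0<..1} {q. Re q > - m} \<phi>"
proof -
  have rd: "real_distribution (\<mu> i)" for i by (rule has_Mellin_transformD(1)[OF M])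
  have pr: "prob_space (\<mu> i)" for i using rd[of i] by (simp add: real_distribution_def)
  have sets_\<mu> [measurable_cong]: "sets (\<mu> i) = sets borel" for i
    using rd[of i] by (simp add: real_distribution_def real_distribution_axioms_def)
  define P where "P = PiM UNIV \<mu>"
  interpret P: prob_space P unfolding P_def by (rule prob_space_PiM) (rule pr)
  have coord [measurable]: "(\<lambda>\<omega>. \<omega> i) \<in> borel_measurable P" for i
  proof -
    have "(\<lambda>\<omega>. \<omega> i) \<in> measurable P (\<mu> i)" unfolding P_def by (rule measurable_component_singleton) simp
    thus ?thesis using measurable_cong_sets[OF refl sets_\<mu>] by blast
  qed
  define X :: "nat \<Rightarrow> (nat \<Rightarrow> real) \<Rightarrow> real" where "X = (\<lambda>n \<omega>. \<Prod>i<n. \<omega> i)"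
  have X_meas [measurable]: "X n \<in> borel_measurable P" for n unfolding X_def by measurable
  have "AE \<omega> in P. \<omega> i \<in> {0<..1}" for i
    unfolding P_def by (rule AE_PiM_component) (use pr has_Mellin_transformD(2)[OF M] in auto)
  hence ae: "AE \<omega> in P. \<forall>i. \<omega> i \<in> {0<..1}" by (simp add: AE_all_countable)
  have X_pos: "X n \<omega> > 0" if "\<forall>i. \<omega> i \<in> {0<..1}" for n \<omega>
    unfolding X_def using that by (intro prod_pos) auto
  have X_le1: "X n \<omega> \<le> 1" if "\<forall>i. \<omega> i \<in> {0<..1}" for n \<omega>
    unfolding X_def using that by (intro prod_le_1) (auto intro: less_imp_le)
  have X_dec: "X (Suc n) \<omega> \<le> X n \<omega>" if "\<forall>i. \<omega> i \<in> {0<..1}" for n \<omega>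
    using X_pos[OF that, of n] that by (simp add: X_def mult_left_le)
  have pm: "(\<lambda>x. complex_of_real x powr q) \<in> borel_measurable borel" for q
    unfolding powr_def by measurable
  have Xq_meas [measurable]: "(\<lambda>\<omega>. complex_of_real (X n \<omega>) powr q) \<in> borel_measurable P" for n q
    by (rule measurable_compose[OF X_meas pm])
  have Xq: "integrable P (\<lambda>\<omega>. complex_of_real (X n \<omega>) powr q)" (is "?int n q")
    "(LINT \<omega>|P. complex_of_real (X n \<omega>) powr q) = (\<Prod>i<n. R i q)" (is "?val n q")
    if q: "Re q > - m" for n q
  proof -
    have int: "integrable (\<mu> i) (\<lambda>x. complex_of_real x powr q)" for i
      using has_Mellin_transformD(3)[OF M] q by auto
    have e: "AE \<omega> in P. complex_of_real (X n \<omega>) powr q = (\<Prod>i<n. complex_of_real (\<omega> i) powr q)"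
      using ae
    proof eventually_elim
      case (elim \<omega>)
      thus ?case unfolding X_def by (intro powr_prod_of_real_pos) auto
    qed
    note I = integrable_PiM_prod[of \<mu> "\<lambda>_ x. complex_of_real x powr q", OF pr int, of n, folded P_def]
    have pm': "(\<lambda>\<omega>. \<Prod>i<n. complex_of_real (\<omega> i) powr q) \<in> borel_measurable P" using I by auto
    show "?int n q" using integrable_cong_AE[OF Xq_meas pm' e] I by blast
    have "(LINT \<omega>|P. complex_of_real (X n \<omega>) powr q) = (LINT \<omega>|P. (\<Prod>i<n. complex_of_real (\<omega> i) powr q))"
      by (rule integral_cong_AE[OF Xq_meas pm' e])
    also have "\<dots> = (\<Prod>i<n. LINT x|\<mu> i. complex_of_real x powr q)"
      by (rule integral_PiM_prod[of \<mu> "\<lambda>_ x. complex_of_real x powr q", OF pr int, of n, folded P_def])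
    also have "\<dots> = (\<Prod>i<n. R i q)"
      using has_Mellin_transformD(4)[OF M] q by simp
    finally show "?val n q" .
  qed
  \<comment> \<open>The supremum is taken in \<open>ennreal\<close>, where it exists before its
    finiteness is known.\<close>
  define G where "G = (\<lambda>r \<omega>. SUP n. ennreal (X n \<omega> powr (- r)))"
  have G_meas [measurable]: "G r \<in> borel_measurable P" for r unfolding G_def by measurable
  have G_fin: "(\<integral>\<^sup>+\<omega>. G r \<omega> \<partial>P) < \<infinity>" if r: "0 < r" "r < m" for r
  proof -
    have r': "Re (- complex_of_real r) > - m" using r by simp
    have "Bseq (\<lambda>n. \<Prod>i<n. R i (- of_real r))"
      using convergent_imp_Bseq lim[OF r'] by (auto simp: convergent_def)
    then obtain C where C: "\<And>n. norm (\<Prod>i<n. R i (- of_real r)) \<le> C" by (auto simp: Bseq_def)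
    have le: "(\<integral>\<^sup>+\<omega>. ennreal (X n \<omega> powr (- r)) \<partial>P) \<le> ennreal C" for n
    proof -
      have e: "AE \<omega> in P. complex_of_real (X n \<omega>) powr (- of_real r) = of_real (X n \<omega> powr (- r))"
        using ae
      proof eventually_elim
        case (elim \<omega>)
        show ?case using powr_of_real[of "X n \<omega>" "- r"] X_pos[OF elim, of n] by simp
      qed
      have m1: "(\<lambda>\<omega>. complex_of_real (X n \<omega> powr (- r))) \<in> borel_measurable P" by measurable
      have "integrable P (\<lambda>\<omega>. complex_of_real (X n \<omega> powr (- r)))"
        using Xq(1)[OF r'] integrable_cong_AE[OF Xq_meas m1 e] by blast
      hence i: "integrable P (\<lambda>\<omega>. X n \<omega> powr (- r))" by (simp add: complex_of_real_integrable_eq)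
      have "complex_of_real (LINT \<omega>|P. X n \<omega> powr (- r)) = (LINT \<omega>|P. complex_of_real (X n \<omega> powr (- r)))"
        by simp
      also have "\<dots> = (\<Prod>i<n. R i (- of_real r))"
        using Xq(2)[OF r', of n] integral_cong_AE[OF Xq_meas m1 e] by simp
      finally have "norm (complex_of_real (LINT \<omega>|P. X n \<omega> powr (- r))) \<le> C" using C[of n] by simp
      hence "(LINT \<omega>|P. X n \<omega> powr (- r)) \<le> C" by (simp add: abs_le_iff)
      moreover have "(\<integral>\<^sup>+\<omega>. ennreal (X n \<omega> powr (- r)) \<partial>P) = ennreal (LINT \<omega>|P. X n \<omega> powr (- r))"
        by (rule nn_integral_eq_integral[OF i]) simp
      ultimately show ?thesis by (simp add: ennreal_leI)
    qed
    have "(\<integral>\<^sup>+\<omega>. G r \<omega> \<partial>P) = (SUP n. \<integral>\<^sup>+\<omega>. ennreal (X n \<omega> powr (- r)) \<partial>P)"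
      unfolding G_def
    proof (rule nn_integral_monotone_convergence_SUP_AE)
      show "AE \<omega> in P. ennreal (X n \<omega> powr (- r)) \<le> ennreal (X (Suc n) \<omega> powr (- r))" for n
        using ae
      proof eventually_elim
        case (elim \<omega>)
        show ?case using X_pos[OF elim, of "Suc n"] X_dec[OF elim, of n] r
          by (intro ennreal_leI powr_mono2') auto
      qed
    qed measurable
    also have "\<dots> \<le> ennreal C" by (intro SUP_least le)
    also have "\<dots> < \<infinity>" by simp
    finally show ?thesis .
  qed
  have G_AE: "AE \<omega> in P. G r \<omega> \<noteq> \<infinity>" if "0 < r" "r < m" for r
    using G_fin[OF that] by (intro nn_integral_PInf_AE) auto
  have G_ge: "X n \<omega> powr (- r) \<le> enn2real (G r \<omega>)" if "G r \<omega> \<noteq> \<infinity>" for n r \<omega>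
  proof -
    have "ennreal (X n \<omega> powr (- r)) \<le> G r \<omega>" unfolding G_def by (rule SUP_upper) simp
    also have "G r \<omega> = ennreal (enn2real (G r \<omega>))" using that by (simp add: less_top)
    finally show ?thesis by (subst (asm) ennreal_le_iff) auto
  qed
  define Y where "Y = (\<lambda>\<omega>. lim (\<lambda>n. X n \<omega>))"
  have Y_meas [measurable]: "Y \<in> borel_measurable P"
    unfolding Y_def by (rule borel_measurable_lim_metric) measurable
  have G_half: "AE \<omega> in P. G (m / 2) \<omega> \<noteq> \<infinity>" by (rule G_AE) (use m in auto)
  have Y: "AE \<omega> in P. (\<lambda>n. X n \<omega>) \<longlonglongrightarrow> Y \<omega> \<and> Y \<omega> \<in> {0<..1}"
    using ae G_half
  proof eventually_elim
    case (elim \<omega>)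
    hence \<omega>: "\<forall>i. \<omega> i \<in> {0<..1}" and G: "G (m / 2) \<omega> \<noteq> \<infinity>" by auto
    have "decseq (\<lambda>n. X n \<omega>)" using X_dec[OF \<omega>] by (simp add: decseq_Suc_iff)
    then obtain L where L: "(\<lambda>n. X n \<omega>) \<longlonglongrightarrow> L"
      using decseq_convergent[of "\<lambda>n. X n \<omega>" 0] X_pos[OF \<omega>] by (metis less_imp_le)
    hence YL: "Y \<omega> = L" unfolding Y_def by (rule limI)
    define g where "g = enn2real (G (m / 2) \<omega>)"
    have "g powr (- (2 / m)) \<le> X n \<omega>" for n
    proof -
      have "0 < X n \<omega> powr (- (m / 2))" using X_pos[OF \<omega>, of n] by simp
      hence "g powr (- (2 / m)) \<le> (X n \<omega> powr (- (m / 2))) powr (- (2 / m))"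
        using G_ge[OF G, of n] m unfolding g_def by (intro powr_mono2') auto
      also have "\<dots> = X n \<omega>" using m X_pos[OF \<omega>, of n] by (simp add: powr_powr)
      finally show ?thesis .
    qed
    hence "g powr (- (2 / m)) \<le> L" by (intro LIMSEQ_le_const[OF L]) auto
    \<comment> \<open>\<open>X 0\<close> is the empty product 1, so \<open>g \<ge> 1\<close>; this
      excludes \<open>g = 0\<close>, for which \<open>powr\<close> would return 0.\<close>
    moreover have "g powr (- (2 / m)) > 0"
      using G_ge[OF G, of 0] by (simp add: g_def X_def)
    ultimately have "L > 0" by linarith
    moreover have "L \<le> 1" by (rule LIMSEQ_le_const2[OF L]) (use X_le1[OF \<omega>] in auto)
    ultimately show ?case using L YL by auto
  qed
  have "has_Mellin_transform (distr P borel Y) {0<..1} {q. Re q > - m} \<phi>"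
    unfolding has_Mellin_transform_def
  proof (intro conjI ballI)
    show "real_distribution (distr P borel Y)" by (rule P.real_distribution_distr) simp
    have "AE \<omega> in P. Y \<omega> \<in> {0<..1}" using Y by eventually_elim auto
    thus "AE x in distr P borel Y. x \<in> {0<..1}" by (subst AE_distr_iff) auto
    fix q assume "q \<in> {q. Re q > - m}"
    hence q: "Re q > - m" by simp
    \<comment> \<open>For \<open>Re q < 0\<close> the modulus of the power is exactly
      \<open>X n \<omega> powr (- r)\<close>. For \<open>Re q \<ge> 0\<close> it is at most 1, which
      the summand 1 in \<open>w\<close> covers, and \<open>m / 2\<close> is merely a point between 0
      and \<open>m\<close>.\<close>
    define r where "r = (if Re q < 0 then - Re q else m / 2)"
    have r: "0 < r" "r < m" using q m by (auto simp: r_def)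
    define w where "w = (\<lambda>\<omega>. 1 + enn2real (G r \<omega>))"
    have "integrable P (\<lambda>\<omega>. enn2real (G r \<omega>))"
    proof (rule integrableI_nonneg)
      have "(\<integral>\<^sup>+\<omega>. ennreal (enn2real (G r \<omega>)) \<partial>P) = (\<integral>\<^sup>+\<omega>. G r \<omega> \<partial>P)"
        using G_AE[OF r] by (intro nn_integral_cong_AE) (auto elim!: eventually_mono simp: less_top)
      thus "(\<integral>\<^sup>+\<omega>. ennreal (enn2real (G r \<omega>)) \<partial>P) < \<infinity>" using G_fin[OF r] by simp
    qed auto
    hence w: "integrable P w" unfolding w_def by simp
    have Yq_meas: "(\<lambda>\<omega>. complex_of_real (Y \<omega>) powr q) \<in> borel_measurable P"
      by (rule measurable_compose[OF Y_meas pm])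
    have conv: "AE \<omega> in P. (\<lambda>n. complex_of_real (X n \<omega>) powr q) \<longlonglongrightarrow> complex_of_real (Y \<omega>) powr q"
      using Y
    proof eventually_elim
      case (elim \<omega>)
      thus ?case by (intro tendsto_powr_complex tendsto_of_real tendsto_const) (auto simp: complex_nonpos_Reals_iff)
    qed
    have dom: "AE \<omega> in P. norm (complex_of_real (X n \<omega>) powr q) \<le> w \<omega>" for n
      using ae G_AE[OF r]
    proof eventually_elim
      case (elim \<omega>)
      have "X n \<omega> powr Re q \<le> 1 + X n \<omega> powr (- r)"
        using X_pos[OF elim(1), of n] X_le1[OF elim(1), of n]
          powr_mono2[of "Re q" "X n \<omega>" 1]
        by (auto simp: r_def intro: add_increasing2)
      thus ?case using G_ge[OF elim(2), of n] X_pos[OF elim(1), of n]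
        by (simp add: norm_powr_complex_of_real_pos w_def)
    qed
    note DC = Yq_meas Xq_meas w conv dom
    show "integrable (distr P borel Y) (\<lambda>x. complex_of_real x powr q)"
      using integrable_dominated_convergence[OF DC] by (subst integrable_distr_eq[OF Y_meas pm])
    have "(\<lambda>n. LINT \<omega>|P. complex_of_real (X n \<omega>) powr q) \<longlonglongrightarrow> (LINT \<omega>|P. complex_of_real (Y \<omega>) powr q)"
      by (rule integral_dominated_convergence[OF DC])
    hence "(\<lambda>n. \<Prod>i<n. R i q) \<longlonglongrightarrow> (LINT \<omega>|P. complex_of_real (Y \<omega>) powr q)"
      by (simp only: Xq(2)[OF q])
    hence "(LINT \<omega>|P. complex_of_real (Y \<omega>) powr q) = \<phi> q"
      using lim[OF q] LIMSEQ_unique by blast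
    thus "(LINT x|distr P borel Y. complex_of_real x powr q) = \<phi> q"
      by (subst integral_distr[OF Y_meas pm])
  qed
  thus ?thesis by blast
qed

section \<open>Existence and inversion of the laws\<close>

lemma Re_pos_imp_nonzero: "Re z > 0 \<Longrightarrow> z \<noteq> 0"
  by auto

text \<open>The sign pattern is that of the \<Gamma> quotient. A lattice point formally contributes
  \<open>- Ln (w + of_real (lat a1 a2 k))\<close> to the logarithm of
  \<open>double_Gamma a1 a2 w\<close>, whence the minus sign in \<open>beta_mellin\<close>.\<close>

definition beta_log :: "real \<Rightarrow> real \<Rightarrow> real \<Rightarrow> real \<Rightarrow> real \<Rightarrow> complex \<Rightarrow> nat \<times> nat \<Rightarrow> complex" where
  "beta_log a1 a2 b0 b1 b2 q k =
     (let L = (\<lambda>w. Ln (w + of_real (lat a1 a2 k)))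
      in L (q + of_real b0) - L (of_real b0)
       + (L (of_real b0 + of_real b1) - L (q + of_real b0 + of_real b1))
       + (L (of_real b0 + of_real b2) - L (q + of_real b0 + of_real b2))
       + (L (q + of_real b0 + of_real b1 + of_real b2) - L (of_real b0 + of_real b1 + of_real b2)))"

definition beta_mellin :: "real \<Rightarrow> real \<Rightarrow> real \<Rightarrow> real \<Rightarrow> real \<Rightarrow> complex \<Rightarrow> complex" where
  "beta_mellin a1 a2 b0 b1 b2 q = exp (- (\<Sum>\<^sub>\<infinity>k. beta_log a1 a2 b0 b1 b2 q k))"

lemma beta_params_Re:
  assumes b: "beta_params b0 b1 b2" and q: "Re q > - min b0 (b0 + b1 + b2)"
  shows "Re q + b0 > 0" "Re q + b0 + b1 > 0" "Re q + b0 + b2 > 0" "Re q + b0 + b1 + b2 > 0"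
    "b0 > 0" "b0 + b1 > 0" "b0 + b2 > 0" "b0 + b1 + b2 > 0"
proof -
  have "b1 \<ge> 0 \<and> b2 \<ge> 0 \<or> b1 \<le> 0 \<and> b2 \<le> 0"
    using b by (simp add: beta_params_def zero_le_mult_iff)
  thus "Re q + b0 > 0" "Re q + b0 + b1 > 0" "Re q + b0 + b2 > 0" "Re q + b0 + b1 + b2 > 0"
    "b0 > 0" "b0 + b1 > 0" "b0 + b2 > 0" "b0 + b1 + b2 > 0"
    using b q by (auto simp: beta_params_def)
qed

text \<open>The eight arguments form the mixed difference with steps \<open>q\<close>,
  \<open>b1\<close>, \<open>b2\<close>, under which quadratic polynomials vanish. The separate sums
  of logarithms diverge and have to be regularised, but the regularisation disappears from the
  combination; summability and the product formula come out together.\<close>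

lemma
  assumes a: "a1 > 0" "a2 > 0" and b: "beta_params b0 b1 b2" and q: "Re q > - min b0 (b0 + b1 + b2)"
  defines "G \<equiv> double_Gamma a1 a2"
  defines "c0 \<equiv> complex_of_real b0" and "c1 \<equiv> complex_of_real b1" and "c2 \<equiv> complex_of_real b2"
  shows summable_beta_log: "beta_log a1 a2 b0 b1 b2 q summable_on UNIV" (is ?th1)
    and double_Gamma_quotient:
      "G (q + c0) / G c0 * (G (c0 + c1) / G (q + c0 + c1)) * (G (c0 + c2) / G (q + c0 + c2))
         * (G (q + c0 + c1 + c2) / G (c0 + c1 + c2)) = beta_mellin a1 a2 b0 b1 b2 q" (is ?th2)
proof -
  define D where "D = (\<lambda>w. deriv (double_zeta a1 a2 w) 0)"
  obtain d0 d1 d2 where d: "\<And>w. Re w > 0 \<Longrightarrow>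
     ((\<lambda>k. let x = 1 + of_real (lat a1 a2 k); y = w + of_real (lat a1 a2 k)
           in Ln y - Ln x - (w - 1) / x + (w - 1)\<^sup>2 / (2 * x\<^sup>2)) has_sum
          (d0 + d1 * w + d2 * w\<^sup>2 - D w)) UNIV"
    using double_zeta_quadratic_0[OF a] unfolding D_def by blast
  define f where "f = (\<lambda>w k. let x = 1 + of_real (lat a1 a2 k); y = w + of_real (lat a1 a2 k)
           in Ln y - Ln x - (w - 1) / x + (w - 1)\<^sup>2 / (2 * x\<^sup>2) :: complex)"
  define p where "p = (\<lambda>w. d0 + d1 * w + d2 * w\<^sup>2)"
  have h: "(f w has_sum (p w - D w)) UNIV" if "Re w > 0" for w
    unfolding f_def p_def by (rule d[OF that])
  note re = beta_params_Re[OF b q]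
  have quad: "((A + B * (q + c0) + C * (q + c0)\<^sup>2) - (A + B * c0 + C * c0\<^sup>2))
      + ((A + B * (c0 + c1) + C * (c0 + c1)\<^sup>2) - (A + B * (q + c0 + c1) + C * (q + c0 + c1)\<^sup>2))
      + ((A + B * (c0 + c2) + C * (c0 + c2)\<^sup>2) - (A + B * (q + c0 + c2) + C * (q + c0 + c2)\<^sup>2))
      + ((A + B * (q + c0 + c1 + c2) + C * (q + c0 + c1 + c2)\<^sup>2)
          - (A + B * (c0 + c1 + c2) + C * (c0 + c1 + c2)\<^sup>2)) = 0" for A B C
    by (simp add: power2_eq_square algebra_simps)
  have p_quad: "(p (q + c0) - p c0) + (p (c0 + c1) - p (q + c0 + c1)) + (p (c0 + c2) - p (q + c0 + c2))
      + (p (q + c0 + c1 + c2) - p (c0 + c1 + c2)) = 0"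
    unfolding p_def by (rule quad)
  have lin_diff: "((P1 - D1) - (P2 - D2)) + ((P3 - D3) - (P4 - D4)) + ((P5 - D5) - (P6 - D6)) + ((P7 - D7) - (P8 - D8))
      = ((P1 - P2) + (P3 - P4) + (P5 - P6) + (P7 - P8)) - ((D1 - D2) + (D3 - D4) + (D5 - D6) + (D7 - D8))"
    for P1 P2 P3 P4 P5 P6 P7 P8 D1 D2 D3 D4 D5 D6 D7 D8 :: complex
    by (simp add: algebra_simps)
  have lin_add: "((P1 + D1) - (P2 + D2)) + ((P3 + D3) - (P4 + D4)) + ((P5 + D5) - (P6 + D6)) + ((P7 + D7) - (P8 + D8))
      = ((P1 - P2) + (P3 - P4) + (P5 - P6) + (P7 - P8)) + ((D1 - D2) + (D3 - D4) + (D5 - D6) + (D7 - D8))"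
    for P1 P2 P3 P4 P5 P6 P7 P8 D1 D2 D3 D4 D5 D6 D7 D8 :: complex
    by (simp add: algebra_simps)
  define T where "T = (D (q + c0) - D c0) + (D (c0 + c1) - D (q + c0 + c1))
     + (D (c0 + c2) - D (q + c0 + c2)) + (D (q + c0 + c1 + c2) - D (c0 + c1 + c2))"
  have sums: "((\<lambda>k. (f (q + c0) k - f c0 k) + (f (c0 + c1) k - f (q + c0 + c1) k)
      + (f (c0 + c2) k - f (q + c0 + c2) k) + (f (q + c0 + c1 + c2) k - f (c0 + c1 + c2) k)) has_sum
     (((p (q + c0) - D (q + c0)) - (p c0 - D c0)) + ((p (c0 + c1) - D (c0 + c1)) - (p (q + c0 + c1) - D (q + c0 + c1)))
      + ((p (c0 + c2) - D (c0 + c2)) - (p (q + c0 + c2) - D (q + c0 + c2)))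
      + ((p (q + c0 + c1 + c2) - D (q + c0 + c1 + c2)) - (p (c0 + c1 + c2) - D (c0 + c1 + c2))))) UNIV"
    by (intro has_sum_add has_sum_diff h) (use re in \<open>simp_all add: c0_def c1_def c2_def\<close>)
  have total: "((p (q + c0) - D (q + c0)) - (p c0 - D c0)) + ((p (c0 + c1) - D (c0 + c1)) - (p (q + c0 + c1) - D (q + c0 + c1)))
      + ((p (c0 + c2) - D (c0 + c2)) - (p (q + c0 + c2) - D (q + c0 + c2)))
      + ((p (q + c0 + c1 + c2) - D (q + c0 + c1 + c2)) - (p (c0 + c1 + c2) - D (c0 + c1 + c2))) = - T"
    unfolding lin_diff p_quad T_def by (rule diff_0)
  have terms: "(\<lambda>k. (f (q + c0) k - f c0 k) + (f (c0 + c1) k - f (q + c0 + c1) k)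
      + (f (c0 + c2) k - f (q + c0 + c2) k) + (f (q + c0 + c1 + c2) k - f (c0 + c1 + c2) k))
      = beta_log a1 a2 b0 b1 b2 q"
  proof
    fix k
    define r where "r = inverse (1 + complex_of_real (lat a1 a2 k))"
    define t where "t = inverse (2 * (1 + complex_of_real (lat a1 a2 k))\<^sup>2)"
    \<comment> \<open>The regularising terms form a quadratic polynomial in \<open>w\<close> whose
      coefficients depend on \<open>k\<close> alone, so \<open>quad\<close> removes them at each
      lattice point just as it removes \<open>p\<close> from the total.\<close>
    have f: "f w k = Ln (w + of_real (lat a1 a2 k))
        + ((r + t - Ln (1 + of_real (lat a1 a2 k))) + (- r - 2 * t) * w + t * w\<^sup>2)" for w
    proof -
      have "l - l' - (w - 1) * r + (w - 1)\<^sup>2 * t = l + ((r + t - l') + (- r - 2 * t) * w + t * w\<^sup>2)"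
        for l l' r t :: complex
        by (simp add: power2_eq_square algebra_simps)
      thus ?thesis unfolding f_def Let_def r_def t_def divide_inverse by blast
    qed
    show "(f (q + c0) k - f c0 k) + (f (c0 + c1) k - f (q + c0 + c1) k)
      + (f (c0 + c2) k - f (q + c0 + c2) k) + (f (q + c0 + c1 + c2) k - f (c0 + c1 + c2) k)
      = beta_log a1 a2 b0 b1 b2 q k"
      unfolding f beta_log_def Let_def c0_def[symmetric] c1_def[symmetric] c2_def[symmetric]
      by (subst lin_add, subst quad, rule add_0_right)
  qed
  have S: "(beta_log a1 a2 b0 b1 b2 q has_sum - T) UNIV"
    using sums unfolding total terms .
  thus ?th1 by (auto simp: summable_on_def)
  have "beta_mellin a1 a2 b0 b1 b2 q = exp T"
    using infsumI[OF S] by (simp add: beta_mellin_def)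
  thus ?th2
    by (simp add: G_def double_Gamma_def T_def D_def exp_add exp_diff)
qed

lemma exp_beta_log:
  assumes a: "a1 > 0" "a2 > 0" and b: "beta_params b0 b1 b2" and q: "Re q > - min b0 (b0 + b1 + b2)"
  shows "exp (- beta_log a1 a2 b0 b1 b2 q k) = beta_factor (b0 + lat a1 a2 k) b1 b2 q"
proof -
  have K: "lat a1 a2 k \<ge> 0" by (rule lat_nonneg[OF a])
  have e: "exp (Ln (w + of_real (lat a1 a2 k))) = w + of_real (lat a1 a2 k)" if "Re w > 0" for w
  proof -
    have "Re (w + of_real (lat a1 a2 k)) > 0" using that K by simp
    thus ?thesis by (intro exp_Ln Re_pos_imp_nonzero)
  qed
  have pos: "Re (q + of_real b0) > 0" "Re (of_real b0) > 0" "Re (of_real b0 + of_real b1) > 0"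
    "Re (q + of_real b0 + of_real b1) > 0" "Re (of_real b0 + of_real b2) > 0"
    "Re (q + of_real b0 + of_real b2) > 0" "Re (q + of_real b0 + of_real b1 + of_real b2) > 0"
    "Re (of_real b0 + of_real b1 + of_real b2) > 0"
    using beta_params_Re[OF b q] by simp_all
  have split: "exp (- ((A - B) + (C - D) + (E - F) + (G - H)))
      = exp B / exp A * (exp D / exp C) * (exp F / exp E) * (exp H / exp G)"
    for A B C D E F G H :: complex
    by (simp add: exp_add exp_diff exp_minus field_simps)
  show ?thesis
    unfolding beta_log_def Let_def split e[OF pos(1)] e[OF pos(2)] e[OF pos(3)] e[OF pos(4)]
      e[OF pos(5)] e[OF pos(6)] e[OF pos(7)] e[OF pos(8)]
    by (simp add: beta_factor_def add_ac)
qed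

text \<open>Every logarithm is shifted by \<open>ln \<kappa>\<close>; four occur with plus and four
  with minus, so the shifts cancel in each summand.\<close>

lemma beta_mellin_scale:
  assumes \<kappa>: "\<kappa> > 0" and a: "a1 > 0" "a2 > 0"
    and b: "beta_params b0 b1 b2" and q: "Re q > - min b0 (b0 + b1 + b2)"
  shows "beta_mellin (\<kappa> * a1) (\<kappa> * a2) (\<kappa> * b0) (\<kappa> * b1) (\<kappa> * b2) (of_real \<kappa> * q)
    = beta_mellin a1 a2 b0 b1 b2 q"
proof -
  have "beta_log (\<kappa> * a1) (\<kappa> * a2) (\<kappa> * b0) (\<kappa> * b1) (\<kappa> * b2) (of_real \<kappa> * q) k
      = beta_log a1 a2 b0 b1 b2 q k" for k
  proof -
    have K: "lat a1 a2 k \<ge> 0" by (rule lat_nonneg[OF a])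
    have e: "Ln (of_real \<kappa> * w + of_real (lat (\<kappa> * a1) (\<kappa> * a2) k))
        = of_real (ln \<kappa>) + Ln (w + of_real (lat a1 a2 k))" if "Re w > 0" for w
    proof -
      have "Re (w + of_real (lat a1 a2 k)) > 0" using that K by simp
      hence "w + of_real (lat a1 a2 k) \<noteq> 0" by (rule Re_pos_imp_nonzero)
      moreover have "of_real \<kappa> * w + of_real (lat (\<kappa> * a1) (\<kappa> * a2) k) = of_real \<kappa> * (w + of_real (lat a1 a2 k))"
        by (simp add: lat_def algebra_simps)
      ultimately show ?thesis using Ln_times_of_real[OF \<kappa>] Ln_of_real[OF \<kappa>] by simp
    qed
    note e' = e[of "q + of_real b0"] e[of "of_real b0"] e[of "of_real b0 + of_real b1"]
      e[of "q + of_real b0 + of_real b1"] e[of "of_real b0 + of_real b2"] e[of "q + of_real b0 + of_real b2"]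
      e[of "q + of_real b0 + of_real b1 + of_real b2"] e[of "of_real b0 + of_real b1 + of_real b2"]
    show ?thesis
      using beta_params_Re[OF b q] e'
      by (simp add: beta_log_def Let_def distrib_left)
  qed
  thus ?thesis by (simp add: beta_mellin_def)
qed

lemma beta_mellin_swap_a: "beta_mellin a2 a1 b0 b1 b2 q = beta_mellin a1 a2 b0 b1 b2 q"
proof -
  have "beta_log a2 a1 b0 b1 b2 q (prod.swap k) = beta_log a1 a2 b0 b1 b2 q k" for k
    by (simp add: beta_log_def lat_def add.commute)
  moreover have "(\<Sum>\<^sub>\<infinity>k. beta_log a2 a1 b0 b1 b2 q (prod.swap k)) = (\<Sum>\<^sub>\<infinity>k. beta_log a2 a1 b0 b1 b2 q k)"
    by (rule infsum_reindex_bij_betw) simp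
  ultimately show ?thesis by (simp add: beta_mellin_def)
qed

lemma beta_mellin_swap_b: "beta_mellin a1 a2 b0 b2 b1 q = beta_mellin a1 a2 b0 b1 b2 q"
  by (simp add: beta_mellin_def beta_log_def Let_def algebra_simps)

text \<open>Scaling by \<open>1 / \<tau>\<close> sends the periods (\<tau>, 1) to (1, 1 / \<tau>),
  and exchanging periods replaces (\<tau>, 1) by (1, \<tau>).\<close>

lemma beta_mellin_inversion:
  assumes \<tau>: "\<tau> > 0" and b: "beta_params b0 b1 b2" and q: "Re q > - min b0 (b0 + b1 + b2)"
  shows "beta_mellin 1 (1 / \<tau>) (b0 / \<tau>) (b1 / \<tau>) (b2 / \<tau>) (of_real (1 / \<tau>) * q) = beta_mellin 1 \<tau> b0 b1 b2 q"
  using beta_mellin_scale[of "1 / \<tau>" \<tau> 1 b0 b1 b2 q] \<tau> b q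
  by (simp add: beta_mellin_swap_a[of \<tau> 1])

lemma beta_params_scale:
  assumes "\<tau> > 0" "beta_params b0 b1 b2"
  shows "beta_params (b0 / \<tau>) (b1 / \<tau>) (b2 / \<tau>)"
  using assms by (simp add: beta_params_def add_divide_distrib[symmetric])

text \<open>The lattice is enumerated by \<open>prod_decode\<close>; unconditional summability of
  the logarithms makes the partial products converge in this order. Uniqueness then identifies the
  limit law with the one described by \<open>beta22\<close>.\<close>

lemma has_Mellin_transform_beta22:
  assumes a: "a1 > 0" "a2 > 0" and b: "beta_params b0 b1 b2"
  shows "has_Mellin_transform (beta22 a1 a2 b0 b1 b2) {0<..1} {q. Re q > - min b0 (b0 + b1 + b2)}
    (beta_mellin a1 a2 b0 b1 b2)"
proof -
  \<comment> \<open>This bound belongs to the origin of the lattice. The other lattice points have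
    half planes at least as large, so all factors share \<open>Re q > - m\<close>.\<close>
  define m where "m = min b0 (b0 + b1 + b2)"
  have m: "m > 0" using b by (auto simp: m_def beta_params_def)
  define c where "c = (\<lambda>n. b0 + lat a1 a2 (prod_decode n))"
  have K: "lat a1 a2 k \<ge> 0" for k by (rule lat_nonneg[OF a])
  have "\<exists>\<mu>. has_Mellin_transform \<mu> {0<..1} {q. Re q > - m} (beta_factor (c n) b1 b2)" for n
  proof -
    have "beta_params (c n) b1 b2"
      using b K[of "prod_decode n"] by (auto simp: beta_params_def c_def)
    from beta_factor_Mellin[OF this] obtain \<mu> where
      "has_Mellin_transform \<mu> {0<..1} {q. Re q > - min (c n) (c n + b1 + b2)} (beta_factor (c n) b1 b2)" ..
    hence "has_Mellin_transform \<mu> {0<..1} {q. Re q > - m} (beta_factor (c n) b1 b2)"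
      by (rule has_Mellin_transform_mono) (use K[of "prod_decode n"] in \<open>auto simp: c_def m_def\<close>)
    thus ?thesis by blast
  qed
  then obtain \<mu> where \<mu>: "\<And>n. has_Mellin_transform (\<mu> n) {0<..1} {q. Re q > - m} (beta_factor (c n) b1 b2)"
    by metis
  have lim: "(\<lambda>n. \<Prod>i<n. beta_factor (c i) b1 b2 q) \<longlonglongrightarrow> beta_mellin a1 a2 b0 b1 b2 q" if q: "Re q > - m" for q
  proof -
    have "(beta_log a1 a2 b0 b1 b2 q has_sum (\<Sum>\<^sub>\<infinity>k. beta_log a1 a2 b0 b1 b2 q k)) UNIV"
      using summable_beta_log[OF a b] q by (simp add: m_def)
    hence "((\<lambda>n. beta_log a1 a2 b0 b1 b2 q (prod_decode n)) has_sum (\<Sum>\<^sub>\<infinity>k. beta_log a1 a2 b0 b1 b2 q k)) UNIV"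
      by (subst has_sum_reindex_bij_betw[OF bij_prod_decode])
    hence "(\<lambda>n. \<Sum>i<n. beta_log a1 a2 b0 b1 b2 q (prod_decode i)) \<longlonglongrightarrow> (\<Sum>\<^sub>\<infinity>k. beta_log a1 a2 b0 b1 b2 q k)"
      using has_sum_imp_sums by (auto simp: sums_def)
    hence "(\<lambda>n. exp (- (\<Sum>i<n. beta_log a1 a2 b0 b1 b2 q (prod_decode i)))) \<longlonglongrightarrow> beta_mellin a1 a2 b0 b1 b2 q"
      unfolding beta_mellin_def by (intro tendsto_intros)
    moreover have "exp (- (\<Sum>i<n. beta_log a1 a2 b0 b1 b2 q (prod_decode i))) = (\<Prod>i<n. beta_factor (c i) b1 b2 q)" for n
      using exp_beta_log[OF a b, of q] q by (simp add: sum_negf[symmetric] exp_sum c_def m_def)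
    ultimately show ?thesis by simp
  qed
  obtain \<nu> where \<nu>: "has_Mellin_transform \<nu> {0<..1} {q. Re q > - m} (beta_mellin a1 a2 b0 b1 b2)"
    using has_Mellin_transform_infinite_product[OF m \<mu> lim] by blast
  define \<phi> where "\<phi> = (\<lambda>q. let G = double_Gamma a1 a2; c0 = complex_of_real b0;
          c1 = complex_of_real b1; c2 = complex_of_real b2
      in G (q + c0) / G c0 * (G (c0 + c1) / G (q + c0 + c1)) *
                (G (c0 + c2) / G (q + c0 + c2)) *
                (G (q + c0 + c1 + c2) / G (c0 + c1 + c2)))"
  have \<phi>: "\<phi> q = beta_mellin a1 a2 b0 b1 b2 q" if "Re q > - m" for q
    using double_Gamma_quotient[OF a b, of q] that by (simp add: \<phi>_def Let_def m_def)
  have \<nu>': "has_Mellin_transform \<nu> {0<..1} {q. Re q > - m} \<phi>"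
    by (rule has_Mellin_transform_mono[OF \<nu>]) (use \<phi> in auto)
  have "beta22 a1 a2 b0 b1 b2 = (THE \<mu>. has_Mellin_transform \<mu> {0<..1} {q. Re q > - m} \<phi>)"
    by (simp add: beta22_def Let_def \<phi>_def m_def)
  also have "\<dots> = \<nu>"
  proof (rule the_equality[where P = "\<lambda>\<mu>. has_Mellin_transform \<mu> {0<..1} {q. Re q > - m} \<phi>", OF \<nu>'])
    fix \<mu> assume "has_Mellin_transform \<mu> {0<..1} {q. Re q > - m} \<phi>"
    thus "\<mu> = \<nu>" by (rule has_Mellin_transform_unique[OF _ \<nu>']) (use m in auto)
  qed
  finally show ?thesis using \<nu> by (simp add: m_def)
qed

lemma has_Mellin_transform_recip_beta22:
  assumes a: "a1 > 0" "a2 > 0" and b: "beta_params b0 b1 b2"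
  shows "has_Mellin_transform (recip_law (beta22 a1 a2 b0 b1 b2)) {0<..} {q. Re q < min b0 (b0 + b1 + b2)}
    (\<lambda>q. beta_mellin a1 a2 b0 b1 b2 (- q))"
  by (rule has_Mellin_transform_recip[OF has_Mellin_transform_beta22[OF a b]]) auto

lemma recip_beta22_inversion:
  assumes \<tau>: "\<tau> > 0" and b: "beta_params b0 b1 b2"
  shows "power_law (recip_law (beta22 1 (1 / \<tau>) (b0 / \<tau>) (b1 / \<tau>) (b2 / \<tau>))) (1 / \<tau>)
    = recip_law (beta22 1 \<tau> b0 b1 b2)"
proof (rule has_Mellin_transform_unique)
  have b': "beta_params (b0 / \<tau>) (b1 / \<tau>) (b2 / \<tau>)" by (rule beta_params_scale[OF \<tau> b])
  have pos: "b0 > 0" "b0 + b1 + b2 > 0" using b by (auto simp: beta_params_def)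
  show "has_Mellin_transform (recip_law (beta22 1 \<tau> b0 b1 b2)) {0<..} {q. Re q < min b0 (b0 + b1 + b2)}
    (\<lambda>q. beta_mellin 1 \<tau> b0 b1 b2 (- q))"
    by (rule has_Mellin_transform_recip_beta22[OF _ \<tau> b]) simp
  show "has_Mellin_transform (power_law (recip_law (beta22 1 (1 / \<tau>) (b0 / \<tau>) (b1 / \<tau>) (b2 / \<tau>))) (1 / \<tau>))
    {0<..} {q. Re q = 0} (\<lambda>q. beta_mellin 1 (1 / \<tau>) (b0 / \<tau>) (b1 / \<tau>) (b2 / \<tau>) (- (of_real (1 / \<tau>) * q)))"
  proof (rule has_Mellin_transform_power[OF has_Mellin_transform_recip_beta22[OF _ _ b']])
    fix q :: complex assume "q \<in> {q. Re q = 0}"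
    thus "of_real (1 / \<tau>) * q \<in> {q. Re q < min (b0 / \<tau>) (b0 / \<tau> + b1 / \<tau> + b2 / \<tau>)}"
      using pos \<tau> by (simp add: add_divide_distrib[symmetric])
  qed (use \<tau> in auto)
  show "beta_mellin 1 (1 / \<tau>) (b0 / \<tau>) (b1 / \<tau>) (b2 / \<tau>) (- (of_real (1 / \<tau>) * (\<i> * of_real t)))
      = beta_mellin 1 \<tau> b0 b1 b2 (- (\<i> * of_real t))" for t
    using beta_mellin_inversion[OF \<tau> b, of "- (\<i> * of_real t)"] pos by simp
qed (use b in \<open>auto simp: beta_params_def\<close>)

lemma beta22_swap_b: "beta22 a1 a2 b0 b2 b1 = beta22 a1 a2 b0 b1 b2"
  by (simp add: beta22_def Let_def add_ac mult_ac)

text \<open>The transform of the factorization of \<open>M_law\<close>. The exponential belongs to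
  \<open>L_law\<close> merged with the power of 2: the normal mean is
  \<open>ln 2 * (1 + \<tau> - 2 * (x1 + x2)) / \<tau>\<close> and the variance is
  \<open>4 * ln 2 / \<tau>\<close>. The other three factors belong to X1, X2, X3, with
  \<open>- q\<close> for the reciprocals.\<close>

definition M_mellin :: "real \<Rightarrow> real \<Rightarrow> real \<Rightarrow> complex \<Rightarrow> complex" where
  "M_mellin \<tau> x1 x2 q =
     exp (of_real (ln 2 * (1 + \<tau> - 2 * (x1 + x2)) / \<tau>) * q + of_real (2 * ln 2 / \<tau>) * q\<^sup>2)
     * beta_mellin 1 \<tau> x1 ((x2 - x1) / 2) ((x2 - x1) / 2) (- q)
     * beta_mellin 1 \<tau> ((x1 + x2) / 2) (1 / 2) (\<tau> / 2) (- q)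
     * beta_mellin 1 \<tau> (1 + \<tau>) ((x1 + x2 - 1 - \<tau>) / 2) ((x1 + x2 - 1 - \<tau>) / 2) (- q)"

lemma M_params:
  assumes "\<tau> > 0" "x1 > 0" "x2 > 0"
  shows "beta_params x1 ((x2 - x1) / 2) ((x2 - x1) / 2)"
    and "beta_params ((x1 + x2) / 2) (1 / 2) (\<tau> / 2)"
    and "beta_params (1 + \<tau>) ((x1 + x2 - 1 - \<tau>) / 2) ((x1 + x2 - 1 - \<tau>) / 2)"
  unfolding beta_params_def using assms
  by (intro conjI zero_le_square; simp add: field_simps)+

lemma double_Gamma_nonzero: "double_Gamma a1 a2 w \<noteq> 0"
  by (simp add: double_Gamma_def)

text \<open>Isolates the field arithmetic. Primed letters stand for values at \<open>q = 0\<close>;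
  \<open>m\<close>, \<open>h\<close>, \<open>t\<close>, \<open>n\<close> are the \<Gamma> values at
  a midpoint and its translates by half periods. After cancellation they occur only in the product
  of all four, which duplication evaluates.\<close>

lemma quotient_product_identity:
  fixes E E' g1 g1' g2 g2' m m' h h' t t' n n' gT gT' gX gX' G2 :: complex
  assumes nz: "E \<noteq> 0" "E' \<noteq> 0" "m \<noteq> 0" "m' \<noteq> 0" "h \<noteq> 0" "h' \<noteq> 0" "t \<noteq> 0" "t' \<noteq> 0" "n \<noteq> 0" "n' \<noteq> 0"
      "gX' \<noteq> 0" "G2 \<noteq> 0"
    and 1: "m * h * t * n = E * G2" and 2: "m' * h' * t' * n' = E' * gX'"
  shows "E / E' * (g1 / g1' * (m' / m) * (m' / m) * (g2 / g2')) * (m / m' * (h' / h) * (t' / t) * (n / n'))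
      * (gT / gT' * (n' / n) * (n' / n) * (gX / gX')) = g1 / g1' * (g2 / g2') * (gT / gT') * (gX / G2)"
proof -
  have "E / E' * (g1 / g1' * (m' / m) * (m' / m) * (g2 / g2')) * (m / m' * (h' / h) * (t' / t) * (n / n'))
      * (gT / gT' * (n' / n) * (n' / n) * (gX / gX'))
    = (g1 / g1' * (g2 / g2') * (gT / gT') * gX) * (E * (m' * h' * t' * n') / (E' * gX' * (m * h * t * n)))"
    using nz by (simp add: field_simps)
  also have "E * (m' * h' * t' * n') / (E' * gX' * (m * h * t * n)) = 1 / G2"
    unfolding 1 2 using nz by simp
  finally show ?thesis by simp
qed

text \<open>The \<beta> transforms contribute values of \<open>G\<close> at the midpoint
  \<open>m\<close> of \<open>x1\<close> and \<open>x2\<close>, at \<open>m - q\<close>, and at the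
  translates of both by half periods. Each group of four collapses by duplication, to
  \<open>G (c1 + c2)\<close> and to \<open>G (c1 + c2 - 2 * q)\<close>, up to the factors
  \<open>E\<close>.\<close>

lemma M_mellin_double_Gamma:
  fixes \<tau> x1 x2 :: real
  assumes \<tau>: "\<tau> > 0" and x: "x1 > 0" "x2 > 0" and q: "Re q < min x1 (min x2 (1 + \<tau>))"
  defines "G \<equiv> double_Gamma 1 \<tau>"
  defines "c1 \<equiv> complex_of_real x1" and "c2 \<equiv> complex_of_real x2" and "c \<equiv> complex_of_real (1 + \<tau>)"
  shows "G (c1 - q) / G c1 * (G (c2 - q) / G c2) * (G (c - q) / G c) * (G (c1 + c2 - q) / G (c1 + c2 - 2 * q))
     = M_mellin \<tau> x1 x2 q"
proof -
  have G: "G w \<noteq> 0" for w by (simp add: G_def double_Gamma_nonzero)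
  define m where "m = (c1 + c2) / 2"
  define T where "T = complex_of_real \<tau>"
  have c: "c = 1 + T" by (simp add: c_def T_def)
  note P = M_params[OF \<tau> x]
  have B1: "beta_mellin 1 \<tau> x1 ((x2 - x1) / 2) ((x2 - x1) / 2) (- q)
      = G (c1 - q) / G c1 * (G m / G (m - q)) * (G m / G (m - q)) * (G (c2 - q) / G c2)"
  proof -
    define d where "d = complex_of_real ((x2 - x1) / 2)"
    have e: "of_real x1 = c1" "- q + c1 = c1 - q" "c1 + d = m" "c1 - q + d = m - q"
      "m - q + d = c2 - q" "m + d = c2"
      by (simp_all add: c1_def c2_def m_def d_def field_simps)
    have "- min x1 (x1 + (x2 - x1) / 2 + (x2 - x1) / 2) < Re (- q)"
      using q by (simp add: min_def field_simps split: if_splits)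
    from double_Gamma_quotient[OF zero_less_one \<tau> P(1) this] show ?thesis
      unfolding G_def d_def[symmetric] e by simp
  qed
  have B2: "beta_mellin 1 \<tau> ((x1 + x2) / 2) (1 / 2) (\<tau> / 2) (- q)
      = G (m - q) / G m * (G (m + 1 / 2) / G (m - q + 1 / 2)) * (G (m + T / 2) / G (m - q + T / 2))
         * (G (m - q + (1 + T) / 2) / G (m + (1 + T) / 2))"
  proof -
    have "- q + of_real ((x1 + x2) / 2) = m - q" "of_real ((x1 + x2) / 2) = m"
      "m + complex_of_real (1 / 2) = m + 1 / 2" "m - q + complex_of_real (1 / 2) = m - q + 1 / 2"
      "m + complex_of_real (\<tau> / 2) = m + T / 2" "m - q + complex_of_real (\<tau> / 2) = m - q + T / 2"
      "m - q + 1 / 2 + T / 2 = m - q + (1 + T) / 2" "m + 1 / 2 + T / 2 = m + (1 + T) / 2"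
      "complex_of_real (\<tau> / 2) = T / 2" "complex_of_real (1 / 2) = 1 / 2"
      by (simp_all add: c1_def c2_def m_def T_def add_divide_distrib)
    note e = this
    have "- min ((x1 + x2) / 2) ((x1 + x2) / 2 + 1 / 2 + \<tau> / 2) < Re (- q)"
    proof -
      have "Re q < x1" "Re q < x2" using q by simp_all
      hence h: "Re q < (x1 + x2) / 2" by (simp add: field_simps)
      with \<tau> have "Re q < (x1 + x2) / 2 + 1 / 2 + \<tau> / 2" by linarith
      thus ?thesis using h by simp
    qed
    from double_Gamma_quotient[OF zero_less_one \<tau> P(2) this] show ?thesis
      unfolding G_def e by (simp add: add_divide_distrib add.assoc)
  qed
  have B3: "beta_mellin 1 \<tau> (1 + \<tau>) ((x1 + x2 - 1 - \<tau>) / 2) ((x1 + x2 - 1 - \<tau>) / 2) (- q)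
      = G (c - q) / G c * (G (m + (1 + T) / 2) / G (m - q + (1 + T) / 2))
         * (G (m + (1 + T) / 2) / G (m - q + (1 + T) / 2)) * (G (c1 + c2 - q) / G (c1 + c2))"
  proof -
    define d where "d = complex_of_real ((x1 + x2 - 1 - \<tau>) / 2)"
    have e: "of_real (1 + \<tau>) = c" "- q + c = c - q" "c + d = m + (1 + T) / 2"
      "c - q + d = m - q + (1 + T) / 2" "m - q + (1 + T) / 2 + d = c1 + c2 - q" "m + (1 + T) / 2 + d = c1 + c2"
      by (simp_all add: c1_def c2_def m_def T_def c_def d_def field_simps)
    have "- min (1 + \<tau>) (1 + \<tau> + (x1 + x2 - 1 - \<tau>) / 2 + (x1 + x2 - 1 - \<tau>) / 2) < Re (- q)"
      using q \<tau> x by (simp add: min_def field_simps split: if_splits)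
    from double_Gamma_quotient[OF zero_less_one \<tau> P(3) this] show ?thesis
      unfolding G_def d_def[symmetric] e by simp
  qed
  define Z where "Z = (\<lambda>w. double_zeta 1 \<tau> w 0)"
  define E where "E = (\<lambda>w. exp (of_real (ln 2) * Z w))"
  have rem: "Re m > 0" "Re (m - q) > 0"
    using x q by (auto simp: m_def c1_def c2_def)
  have dup: "G w * G (w + 1 / 2) * G (w + T / 2) * G (w + (1 + T) / 2) = E (2 * w) * G (2 * w)" if "Re w > 0" for w
    using double_Gamma_duplication[of 1 \<tau> w] \<tau> that by (simp add: G_def E_def Z_def T_def)
  have 2: "2 * m = c1 + c2" "2 * (m - q) = c1 + c2 - 2 * q" by (simp_all add: m_def)
  \<comment> \<open>The explicit quadratic polynomial enters here: its difference between the two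
    arguments has no constant term, and after multiplication by \<open>ln 2\<close> the coefficient
    of \<open>q\<close> is the normal mean and that of \<open>q\<^sup>2\<close> half the
    variance.\<close>
  have EE: "E (c1 + c2 - 2 * q) / E (c1 + c2)
     = exp (of_real (ln 2 * (1 + \<tau> - 2 * (x1 + x2)) / \<tau>) * q + of_real (2 * ln 2 / \<tau>) * q\<^sup>2)"
  proof -
    obtain z0 where z: "\<And>w. Re w > 0 \<Longrightarrow> Z w = z0 - of_real ((1 + \<tau>) / (2 * \<tau>)) * w + of_real (1 / (2 * \<tau>)) * w\<^sup>2"
      using double_zeta_0_eq[of 1 \<tau>] \<tau> by (auto simp: Z_def)
    have re: "Re (c1 + c2 - 2 * q) > 0" "Re (c1 + c2) > 0"
    proof -
      have "Re (2 * (m - q)) > 0" "Re (2 * m) > 0" using rem by simp_all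
      thus "Re (c1 + c2 - 2 * q) > 0" "Re (c1 + c2) > 0" by (simp_all only: 2)
    qed
    have T0: "T \<noteq> 0" using \<tau> by (simp add: T_def)
    have "Z (c1 + c2 - 2 * q) - Z (c1 + c2) = (1 + T) / T * q - 2 * (c1 + c2) / T * q + 2 / T * q\<^sup>2"
      unfolding z[OF re(1)] z[OF re(2)] using T0
      by (simp add: T_def[symmetric] field_simps power2_eq_square)
    hence "of_real (ln 2) * Z (c1 + c2 - 2 * q) - of_real (ln 2) * Z (c1 + c2)
       = of_real (ln 2) * ((1 + T) / T * q - 2 * (c1 + c2) / T * q + 2 / T * q\<^sup>2)"
      by (simp add: right_diff_distrib[symmetric])
    also have "\<dots> = of_real (ln 2 * (1 + \<tau> - 2 * (x1 + x2)) / \<tau>) * q + of_real (2 * ln 2 / \<tau>) * q\<^sup>2"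
      using T0 by (simp add: T_def c1_def c2_def field_simps)
    finally show ?thesis by (simp add: E_def exp_diff[symmetric])
  qed
  show ?thesis
    unfolding M_mellin_def B1 B2 B3 EE[symmetric]
    by (rule quotient_product_identity[symmetric])
       (use dup[OF rem(2)] dup[OF rem(1)] in \<open>simp_all add: G 2 E_def del: mult_eq_0_iff\<close>)
qed

text \<open>Multiplying the four factor laws gives a law with transform \<open>M_mellin\<close>;
  since this equals the \<Gamma> quotient on the domain, the description in \<open>M_law\<close> is
  met.\<close>

lemma has_Mellin_transform_M_law:
  assumes \<tau>: "\<tau> > 0" and x: "x1 > 0" "x2 > 0"
  shows "has_Mellin_transform (M_law 1 \<tau> x1 x2) {0<..} {q. Re q < min x1 (min x2 (1 + \<tau>))} (M_mellin \<tau> x1 x2)"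
proof -
  define D where "D = {q::complex. Re q < min x1 (min x2 (1 + \<tau>))}"
  note P = M_params[OF \<tau> x]
  note R = has_Mellin_transform_recip_beta22[of 1 \<tau>]
  define \<sigma> where "\<sigma> = sqrt (4 * ln 2 / \<tau>)"
  have \<sigma>: "\<sigma> > 0" "\<sigma>\<^sup>2 / 2 = 2 * ln 2 / \<tau>" using \<tau> by (simp_all add: \<sigma>_def)
  have L: "\<exists>\<rho>. has_Mellin_transform \<rho> {0<..} D
     (\<lambda>q. exp (of_real (ln 2 * (1 + \<tau> - 2 * (x1 + x2)) / \<tau>) * q + of_real (2 * ln 2 / \<tau>) * q\<^sup>2))"
    using has_Mellin_transform_mono[OF has_Mellin_transform_lognormal[OF \<sigma>(1)], unfolded \<sigma>(2), OF order.refl subset_UNIV refl]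
    by blast
  have B1: "has_Mellin_transform (recip_law (beta22 1 \<tau> x1 ((x2 - x1) / 2) ((x2 - x1) / 2))) {0<..} D
      (\<lambda>q. beta_mellin 1 \<tau> x1 ((x2 - x1) / 2) ((x2 - x1) / 2) (- q))"
    by (rule has_Mellin_transform_mono[OF R[OF _ \<tau> P(1)]]) (auto simp: D_def)
  have B2: "has_Mellin_transform (recip_law (beta22 1 \<tau> ((x1 + x2) / 2) (1 / 2) (\<tau> / 2))) {0<..} D
      (\<lambda>q. beta_mellin 1 \<tau> ((x1 + x2) / 2) (1 / 2) (\<tau> / 2) (- q))"
  proof (rule has_Mellin_transform_mono[OF R[OF zero_less_one \<tau> P(2)]])
    show "D \<subseteq> {q. Re q < min ((x1 + x2) / 2) ((x1 + x2) / 2 + 1 / 2 + \<tau> / 2)}"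
    proof
      fix q assume "q \<in> D"
      hence "Re q < x1" "Re q < x2" by (simp_all add: D_def)
      hence h: "Re q < (x1 + x2) / 2" by (simp add: field_simps)
      with \<tau> have "Re q < (x1 + x2) / 2 + 1 / 2 + \<tau> / 2" by linarith
      thus "q \<in> {q. Re q < min ((x1 + x2) / 2) ((x1 + x2) / 2 + 1 / 2 + \<tau> / 2)}" using h by simp
    qed
  qed auto
  have B3: "has_Mellin_transform (recip_law (beta22 1 \<tau> (1 + \<tau>) ((x1 + x2 - 1 - \<tau>) / 2) ((x1 + x2 - 1 - \<tau>) / 2))) {0<..} D
      (\<lambda>q. beta_mellin 1 \<tau> (1 + \<tau>) ((x1 + x2 - 1 - \<tau>) / 2) ((x1 + x2 - 1 - \<tau>) / 2) (- q))"
    by (rule has_Mellin_transform_mono[OF R[OF _ \<tau> P(3)]]) (use \<tau> x in \<open>auto simp: D_def field_simps\<close>)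
  obtain \<nu> where \<nu>: "has_Mellin_transform \<nu> {0<..} D (M_mellin \<tau> x1 x2)"
  proof -
    obtain \<rho>0 where 0: "has_Mellin_transform \<rho>0 {0<..} D
        (\<lambda>q. exp (of_real (ln 2 * (1 + \<tau> - 2 * (x1 + x2)) / \<tau>) * q + of_real (2 * ln 2 / \<tau>) * q\<^sup>2))"
      using L by blast
    obtain \<rho>1 where 1: "has_Mellin_transform \<rho>1 {0<..} D (\<lambda>q.
        exp (of_real (ln 2 * (1 + \<tau> - 2 * (x1 + x2)) / \<tau>) * q + of_real (2 * ln 2 / \<tau>) * q\<^sup>2)
        * beta_mellin 1 \<tau> x1 ((x2 - x1) / 2) ((x2 - x1) / 2) (- q))"
      using has_Mellin_transform_mult[OF 0 B1] ..
    obtain \<rho>2 where 2: "has_Mellin_transform \<rho>2 {0<..} D (\<lambda>q.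
        exp (of_real (ln 2 * (1 + \<tau> - 2 * (x1 + x2)) / \<tau>) * q + of_real (2 * ln 2 / \<tau>) * q\<^sup>2)
        * beta_mellin 1 \<tau> x1 ((x2 - x1) / 2) ((x2 - x1) / 2) (- q)
        * beta_mellin 1 \<tau> ((x1 + x2) / 2) (1 / 2) (\<tau> / 2) (- q))"
      using has_Mellin_transform_mult[OF 1 B2] ..
    have "\<exists>\<nu>. has_Mellin_transform \<nu> {0<..} D (M_mellin \<tau> x1 x2)"
      using has_Mellin_transform_mult[OF 2 B3] unfolding M_mellin_def[abs_def] .
    thus thesis using that by blast
  qed
  define \<phi> where "\<phi> = (\<lambda>q. let G = double_Gamma 1 \<tau>; c1 = complex_of_real x1; c2 = complex_of_real x2;
          c = complex_of_real (1 + \<tau>)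
      in G (c1 - q) / G c1 * (G (c2 - q) / G c2) * (G (c - q) / G c) *
                (G (c1 + c2 - q) / G (c1 + c2 - 2 * q)))"
  have \<phi>: "\<phi> q = M_mellin \<tau> x1 x2 q" if "q \<in> D" for q
    using M_mellin_double_Gamma[OF \<tau> x, of q] that unfolding \<phi>_def Let_def D_def by simp
  have \<nu>': "has_Mellin_transform \<nu> {0<..} D \<phi>"
    by (rule has_Mellin_transform_mono[OF \<nu>]) (use \<phi> in auto)
  have "M_law 1 \<tau> x1 x2 = (THE \<mu>. has_Mellin_transform \<mu> {0<..} D \<phi>)"
    by (simp add: M_law_def Let_def \<phi>_def D_def)
  also have "\<dots> = \<nu>"
  proof (rule the_equality[where P = "\<lambda>\<mu>. has_Mellin_transform \<mu> {0<..} D \<phi>", OF \<nu>'])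
    fix \<mu> assume "has_Mellin_transform \<mu> {0<..} D \<phi>"
    thus "\<mu> = \<nu>" by (rule has_Mellin_transform_unique[OF _ \<nu>']) (use \<tau> x in \<open>auto simp: D_def\<close>)
  qed
  finally show ?thesis using \<nu> by (simp add: D_def)
qed

text \<open>In the exponential the involution multiplies the linear coefficient by \<tau> and the
  quadratic one by \<tau>^2, which the factor \<open>1 / \<tau>\<close> in the argument
  undoes.\<close>

lemma M_mellin_inversion:
  assumes \<tau>: "\<tau> > 0" and x: "x1 > 0" "x2 > 0" and q: "Re q = 0"
  shows "M_mellin (1 / \<tau>) (x1 / \<tau>) (x2 / \<tau>) (of_real (1 / \<tau>) * q) = M_mellin \<tau> x1 x2 q"
proof -
  note P = M_params[OF \<tau> x]
  have Z: "Re (- q) = 0" using q by simp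
  have inv: "beta_mellin 1 (1 / \<tau>) (b0 / \<tau>) (b1 / \<tau>) (b2 / \<tau>) (- (of_real (1 / \<tau>) * q))
      = beta_mellin 1 \<tau> b0 b1 b2 (- q)" if "beta_params b0 b1 b2" for b0 b1 b2
  proof -
    have "Re (- q) > - min b0 (b0 + b1 + b2)" using that Z by (simp add: beta_params_def)
    from beta_mellin_inversion[OF \<tau> that this] show ?thesis by simp
  qed
  have 1: "(x2 / \<tau> - x1 / \<tau>) / 2 = ((x2 - x1) / 2) / \<tau>" "(x1 / \<tau> + x2 / \<tau>) / 2 = ((x1 + x2) / 2) / \<tau>"
    "1 / 2 = (\<tau> / 2) / \<tau>" "1 / \<tau> / 2 = (1 / 2) / \<tau>" "1 + 1 / \<tau> = (1 + \<tau>) / \<tau>"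
    "(x1 / \<tau> + x2 / \<tau> - 1 - 1 / \<tau>) / 2 = ((x1 + x2 - 1 - \<tau>) / 2) / \<tau>"
    using \<tau> by (simp_all add: field_simps)
  \<comment> \<open>The involution exchanges two parameters here: \<open>1 / 2\<close> and
    \<open>1 / \<tau> / 2\<close> are \<open>\<tau> / 2\<close> and \<open>1 / 2\<close> divided by
    \<tau>. The symmetry in \<open>b1\<close> and \<open>b2\<close> restores the order.\<close>
  have b2: "beta_mellin 1 (1 / \<tau>) ((x1 / \<tau> + x2 / \<tau>) / 2) (1 / 2) (1 / \<tau> / 2) (- (of_real (1 / \<tau>) * q))
      = beta_mellin 1 \<tau> ((x1 + x2) / 2) (1 / 2) (\<tau> / 2) (- q)"
  proof -
    have "beta_params ((x1 + x2) / 2) (\<tau> / 2) (1 / 2)"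
      using P(2) by (simp add: beta_params_def add_ac mult_ac)
    from inv[OF this] show ?thesis
      unfolding 1(2,4) using \<tau> by (simp add: beta_mellin_swap_b[of 1 \<tau> _ "\<tau> / 2" "1 / 2"])
  qed
  have e: "of_real (ln 2 * (1 + 1 / \<tau> - 2 * (x1 / \<tau> + x2 / \<tau>)) / (1 / \<tau>)) * (of_real (1 / \<tau>) * q)
        + of_real (2 * ln 2 / (1 / \<tau>)) * (of_real (1 / \<tau>) * q)\<^sup>2
      = of_real (ln 2 * (1 + \<tau> - 2 * (x1 + x2)) / \<tau>) * q + of_real (2 * ln 2 / \<tau>) * q\<^sup>2"
    using \<tau> by (simp add: field_simps power2_eq_square)
  show ?thesis
    unfolding M_mellin_def e b2 unfolding 1(1) 1(5) 1(6) inv[OF P(1)] inv[OF P(3)] ..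
qed

lemma M_law_inversion:
  assumes \<tau>: "\<tau> > 0" and x: "x1 > 0" "x2 > 0"
  shows "power_law (M_law 1 (1 / \<tau>) (x1 / \<tau>) (x2 / \<tau>)) (1 / \<tau>) = M_law 1 \<tau> x1 x2"
proof (rule has_Mellin_transform_unique)
  show "has_Mellin_transform (M_law 1 \<tau> x1 x2) {0<..} {q. Re q < min x1 (min x2 (1 + \<tau>))} (M_mellin \<tau> x1 x2)"
    by (rule has_Mellin_transform_M_law[OF \<tau> x])
  have \<tau>': "1 / \<tau> > 0" and x': "x1 / \<tau> > 0" "x2 / \<tau> > 0" using \<tau> x by auto
  show "has_Mellin_transform (power_law (M_law 1 (1 / \<tau>) (x1 / \<tau>) (x2 / \<tau>)) (1 / \<tau>)) {0<..}
     {q. Re q = 0} (\<lambda>q. M_mellin (1 / \<tau>) (x1 / \<tau>) (x2 / \<tau>) (of_real (1 / \<tau>) * q))"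
    by (rule has_Mellin_transform_power[OF has_Mellin_transform_M_law[OF \<tau>' x']])
       (use \<tau>' x' in \<open>auto simp: add_pos_pos\<close>)
  show "M_mellin (1 / \<tau>) (x1 / \<tau>) (x2 / \<tau>) (of_real (1 / \<tau>) * (\<i> * of_real t)) = M_mellin \<tau> x1 x2 (\<i> * of_real t)" for t
    by (rule M_mellin_inversion[OF \<tau> x]) simp
qed (use \<tau> x in auto)

text \<open>A power of a lognormal variable scales the normal one: the standard deviation
  \<open>sqrt (4 * ln 2 * \<tau>)\<close> divided by \<tau> is
  \<open>sqrt (4 * ln 2 / \<tau>)\<close>.\<close>

lemma L_law_inversion:
  assumes \<tau>: "\<tau> > 0"
  shows "power_law (L_law (1 / \<tau>)) (1 / \<tau>) = L_law \<tau>"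
proof -
  define \<sigma> where "\<sigma> = sqrt (4 * ln 2 / (1 / \<tau>))"
  let ?N = "density lborel (normal_density 0 \<sigma>)"
  have \<sigma>: "\<sigma> > 0" using \<tau> by (simp add: \<sigma>_def)
  have s: "\<bar>1 / \<tau>\<bar> * \<sigma> = sqrt (4 * ln 2 / \<tau>)"
  proof -
    have "(\<bar>1 / \<tau>\<bar> * \<sigma>)\<^sup>2 = 4 * ln 2 / \<tau>"
      using \<tau> by (simp add: \<sigma>_def power_mult_distrib power_divide) (simp add: power2_eq_square)
    thus ?thesis using \<sigma> by (intro real_sqrt_unique[symmetric]) auto
  qed
  have "power_law (L_law (1 / \<tau>)) (1 / \<tau>) = distr ?N borel (\<lambda>x. exp (0 + (1 / \<tau>) * x))"
    unfolding power_law_def L_law_def \<sigma>_def[symmetric]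
    by (subst distr_distr) (auto simp: o_def powr_def)
  also have "\<dots> = distr (distr ?N lborel (\<lambda>x. 0 + (1 / \<tau>) * x)) borel exp"
    by (subst distr_distr) (auto simp: o_def)
  also have "distr ?N lborel (\<lambda>x. 0 + (1 / \<tau>) * x) = density lborel (normal_density 0 (sqrt (4 * ln 2 / \<tau>)))"
    using distr_normal_density_affine[of \<sigma> "1 / \<tau>" 0 0] \<sigma> \<tau> unfolding s by simp
  finally show ?thesis unfolding L_law_def .
qed

theorem theorem5p6:
  fixes \<tau> l1 l2 :: real
  assumes "\<tau> > 0" and "1 + \<tau> * (1 + l1) > 0" and "1 + \<tau> * (1 + l2) > 0"
  shows "power_law (L_law (1 / \<tau>)) (1 / \<tau>) = L_law \<tau> \<and>
    power_law (X1_law (1 / \<tau>) (\<tau> * l1) (\<tau> * l2)) (1 / \<tau>) = X1_law \<tau> l1 l2 \<and>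
    power_law (X2_law (1 / \<tau>) (\<tau> * l1) (\<tau> * l2)) (1 / \<tau>) = X2_law \<tau> l1 l2 \<and>
    power_law (X3_law (1 / \<tau>) (\<tau> * l1) (\<tau> * l2)) (1 / \<tau>) = X3_law \<tau> l1 l2 \<and>
    power_law (M_law 1 (1 / \<tau>) (x_par (1 / \<tau>) (\<tau> * l1)) (x_par (1 / \<tau>) (\<tau> * l2))) (1 / \<tau>)
      = M_law 1 \<tau> (x_par \<tau> l1) (x_par \<tau> l2)"
proof -
  define x1 x2 where "x1 = x_par \<tau> l1" and "x2 = x_par \<tau> l2"
  have x: "x1 > 0" "x2 > 0" using assms by (simp_all add: x1_def x2_def x_par_def)
  \<comment> \<open>The involution divides \<open>x1\<close>, \<open>x2\<close> and
    \<open>1 + \<tau>\<close> alike by \<tau>, so all parameters of the laws are scaled by one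
    factor, up to an exchange in X2.\<close>
  have x': "x_par (1 / \<tau>) (\<tau> * l1) = x1 / \<tau>" "x_par (1 / \<tau>) (\<tau> * l2) = x2 / \<tau>"
    using assms(1) by (simp_all add: x1_def x2_def x_par_def field_simps)
  note P = M_params[OF assms(1) x]
  \<comment> \<open>In X2 the scaled values of \<open>1 / 2\<close> and \<open>\<tau> / 2\<close>
    come out interchanged, so the inversion is applied to the interchanged triple.\<close>
  have P2: "beta_params ((x1 + x2) / 2) (\<tau> / 2) (1 / 2)"
    using P(2) by (simp add: beta_params_def add_ac mult_ac)
  have e: "(x2 / \<tau> - x1 / \<tau>) / 2 = ((x2 - x1) / 2) / \<tau>" "(x1 / \<tau> + x2 / \<tau>) / 2 = ((x1 + x2) / 2) / \<tau>"
    "1 / \<tau> / 2 = (1 / 2) / \<tau>" "1 + 1 / \<tau> = (1 + \<tau>) / \<tau>"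
    "(x1 / \<tau> + x2 / \<tau> - 1 - 1 / \<tau>) / 2 = ((x1 + x2 - 1 - \<tau>) / 2) / \<tau>"
    using assms(1) by (simp_all add: field_simps)
  have "power_law (X1_law (1 / \<tau>) (\<tau> * l1) (\<tau> * l2)) (1 / \<tau>) = X1_law \<tau> l1 l2"
    unfolding X1_law_def Let_def x' x1_def[symmetric] x2_def[symmetric] e
    by (rule recip_beta22_inversion[OF assms(1) P(1)])
  moreover have "power_law (X2_law (1 / \<tau>) (\<tau> * l1) (\<tau> * l2)) (1 / \<tau>) = X2_law \<tau> l1 l2"
    using recip_beta22_inversion[OF assms(1) P2] assms(1)
    unfolding X2_law_def Let_def x' x1_def[symmetric] x2_def[symmetric] e
    by (simp add: beta22_swap_b[of 1 \<tau> _ "\<tau> / 2" "1 / 2"])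
  moreover have "power_law (X3_law (1 / \<tau>) (\<tau> * l1) (\<tau> * l2)) (1 / \<tau>) = X3_law \<tau> l1 l2"
    unfolding X3_law_def Let_def x' x1_def[symmetric] x2_def[symmetric] e
    by (rule recip_beta22_inversion[OF assms(1) P(3)])
  ultimately show ?thesis
    using L_law_inversion[OF assms(1)] M_law_inversion[OF assms(1) x]
    unfolding x' x1_def[symmetric] x2_def[symmetric] by blast
qed

end
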